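(* Let $k$ be a Noetherian commutative ring with unit and let $A$ be a unital associative $k$-algebra that is finitely generated as a $k$-module. Then $HS_n(A)$ is a finitely generated $k$-module for every $n\ge 0$.
   Context: Category $\Delta S$: objects are the sets $[n]=\{0,1,\dots,n\}$, $n\ge 0$; a morphism $[n]\to[m]$ is a set map $f$ together with a total order on each fibre $f^{-1}(j)$. The composite of $f:[n]\to[m]$ and $g:[m]\to[l]$ has underlying map $g\circ f$, and the fibre over $i$ is ordered by concatenating the ordered fibres $f^{-1}(j)$, with $j$ running over $g^{-1}(i)$ in its given order. The symmetric bar construction is the covariant functor $B_*^{sym}A:\Delta S\to k\text{-Mod}$, $[n]\mapsto A^{\otimes(n+1)}$ (tensor over $k$); a morphism $\alpha:[n]\to[m]$ sends $a_0\otimes\cdots\otimes a_n$ to $b_0\otimes\cdots\otimes b_m$, where $b_j$ is the product of the $a_i$, $i\in\alpha^{-1}(j)$, in the given order of the fibre ($b_j=1$ if the fibre is empty). Symmetric homology is $HS_*(A)=\mathrm{Tor}_*^{\Delta S}(\underline{k},B_*^{sym}A)$, where $\underline{k}$ is the constant contravariant functor with value $k$; equivalently, the left derived functors of $\mathrm{colim}_{\Delta S}$ evaluated at $B_*^{sym}A$. *)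

theory Defs
  imports "HOL-Algebra.Ring_Divisibility" "HOL-Algebra.Module"
begin

subsection \<open>Modules over a commutative ring\<close>

text \<open>The library locale \<open>algebra\<close> only covers commutative algebras.\<close>

locale assoc_algebra = module R A + ring A
  for R :: "('r, 'b) ring_scheme" (structure)
    and A :: "('r, 'a, 'c) module_scheme" (structure) +
  assumes smult_mult_left:
      "\<lbrakk>r \<in> carrier R; x \<in> carrier A; y \<in> carrier A\<rbrakk> \<Longrightarrow>
        (r \<odot>\<^bsub>A\<^esub> x) \<otimes>\<^bsub>A\<^esub> y = r \<odot>\<^bsub>A\<^esub> (x \<otimes>\<^bsub>A\<^esub> y)"
    and smult_mult_right:
      "\<lbrakk>r \<in> carrier R; x \<in> carrier A; y \<in> carrier A\<rbrakk> \<Longrightarrow>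
        x \<otimes>\<^bsub>A\<^esub> (r \<odot>\<^bsub>A\<^esub> y) = r \<odot>\<^bsub>A\<^esub> (x \<otimes>\<^bsub>A\<^esub> y)"

definition submodule_span ::
  "('r, 'b) ring_scheme \<Rightarrow> ('r, 'm, 'c) module_scheme \<Rightarrow> 'm set \<Rightarrow> 'm set"
  where "submodule_span R M S = \<Inter>{N. submodule N R M \<and> S \<subseteq> N}"

definition fin_gen_module :: "('r, 'b) ring_scheme \<Rightarrow> ('r, 'm, 'c) module_scheme \<Rightarrow> bool"
  where "fin_gen_module R M \<longleftrightarrow>
    (\<exists>S. finite S \<and> S \<subseteq> carrier M \<and> submodule_span R M S = carrier M)"

definition module_hom ::
  "('r, 'b) ring_scheme \<Rightarrow> ('r, 'm, 'c) module_scheme \<Rightarrow> ('r, 'n, 'd) module_scheme \<Rightarrow> ('m \<Rightarrow> 'n) set"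
  where "module_hom R M N = {h \<in> carrier M \<rightarrow> carrier N.
    (\<forall>x\<in>carrier M. \<forall>y\<in>carrier M. h (x \<oplus>\<^bsub>M\<^esub> y) = h x \<oplus>\<^bsub>N\<^esub> h y) \<and>
    (\<forall>r\<in>carrier R. \<forall>x\<in>carrier M. h (r \<odot>\<^bsub>M\<^esub> x) = r \<odot>\<^bsub>N\<^esub> h x)}"

text \<open>The record type \<open>module\<close> extends \<open>ring\<close>; the fields \<open>mult\<close> and \<open>one\<close> of a module are junk.\<close>

definition quot_module :: "('r, 'm, 'c) module_scheme \<Rightarrow> 'm set \<Rightarrow> ('r, 'm set) module"
  where "quot_module M N =
    \<lparr>carrier = a_rcosets\<^bsub>M\<^esub> N, monoid.mult = undefined, one = undefined,
     ring.zero = N, add = (<+>\<^bsub>M\<^esub>), smult = (\<lambda>r C. \<Union>x\<in>C. N +>\<^bsub>M\<^esub> (r \<odot>\<^bsub>M\<^esub> x))\<rparr>"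

definition free_module :: "('r, 'b) ring_scheme \<Rightarrow> 's set \<Rightarrow> ('r, 's \<Rightarrow> 'r) module"
  where "free_module R S =
    \<lparr>carrier = {f. f ` S \<subseteq> carrier R \<and> (\<forall>x. x \<notin> S \<longrightarrow> f x = \<zero>\<^bsub>R\<^esub>) \<and> finite {x. f x \<noteq> \<zero>\<^bsub>R\<^esub>}},
     monoid.mult = undefined, one = undefined,
     ring.zero = (\<lambda>_. \<zero>\<^bsub>R\<^esub>), add = (\<lambda>f g x. f x \<oplus>\<^bsub>R\<^esub> g x), smult = (\<lambda>r f x. r \<otimes>\<^bsub>R\<^esub> f x)\<rparr>"

definition basis :: "('r, 'b) ring_scheme \<Rightarrow> 's \<Rightarrow> 's \<Rightarrow> 'r"
  where "basis R s = (\<lambda>x. if x = s then \<one>\<^bsub>R\<^esub> else \<zero>\<^bsub>R\<^esub>)"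

text \<open>The linear extension of a map \<open>\<phi>\<close> between bases.\<close>

definition free_map :: "('r, 'b) ring_scheme \<Rightarrow> ('s \<Rightarrow> 't) \<Rightarrow> ('s \<Rightarrow> 'r) \<Rightarrow> 't \<Rightarrow> 'r"
  where "free_map R \<phi> f = (\<lambda>y. \<Oplus>\<^bsub>R\<^esub>x\<in>{x. f x \<noteq> \<zero>\<^bsub>R\<^esub> \<and> \<phi> x = y}. f x)"

text \<open>The module with generators \<open>S\<close> and relators \<open>T\<close>, and the map induced between two such modules
  by a map \<open>\<phi>\<close> of generators that is compatible with the relators.\<close>

definition presented_module ::
  "('r, 'b) ring_scheme \<Rightarrow> 's set \<Rightarrow> ('s \<Rightarrow> 'r) set \<Rightarrow> ('r, ('s \<Rightarrow> 'r) set) module"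
  where "presented_module R S T =
    quot_module (free_module R S) (submodule_span R (free_module R S) T)"

definition presented_map ::
  "('r, 'b) ring_scheme \<Rightarrow> 't set \<Rightarrow> ('t \<Rightarrow> 'r) set \<Rightarrow> ('s \<Rightarrow> 't) \<Rightarrow> ('s \<Rightarrow> 'r) set \<Rightarrow> ('t \<Rightarrow> 'r) set"
  where "presented_map R S T \<phi> C =
    (\<Union>f\<in>C. submodule_span R (free_module R S) T +>\<^bsub>free_module R S\<^esub> free_map R \<phi> f)"


subsection \<open>Homology of non-negatively graded complexes\<close>

text \<open>The differential \<open>d i\<close> maps \<open>C (Suc i)\<close> to \<open>C i\<close>.\<close>

fun cycles :: "(nat \<Rightarrow> ('r, 'm) module) \<Rightarrow> (nat \<Rightarrow> 'm \<Rightarrow> 'm) \<Rightarrow> nat \<Rightarrow> 'm set"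
  where
    "cycles C d 0 = carrier (C 0)"
  | "cycles C d (Suc i) = {x \<in> carrier (C (Suc i)). d i x = \<zero>\<^bsub>C i\<^esub>}"

definition homology ::
  "(nat \<Rightarrow> ('r, 'm) module) \<Rightarrow> (nat \<Rightarrow> 'm \<Rightarrow> 'm) \<Rightarrow> nat \<Rightarrow> ('r, 'm set) module"
  where "homology C d n =
    quot_module ((C n)\<lparr>carrier := cycles C d n\<rparr>) (d n ` carrier (C (Suc n)))"


subsection \<open>The category \<open>\<Delta>S\<close>\<close>

text \<open>The object \<open>[n] = {0..n}\<close> is represented by the number \<open>n\<close>.  The total order on the fibre
  over \<open>j\<close> is given by the list \<open>fib \<alpha> j\<close> enumerating that fibre in increasing order.\<close>

record ds_mor =
  src :: nat
  tgt :: nat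
  fn :: "nat \<Rightarrow> nat"
  fib :: "nat \<Rightarrow> nat list"

definition ds_hom :: "nat \<Rightarrow> nat \<Rightarrow> ds_mor set"
  where "ds_hom n m = {\<alpha>. src \<alpha> = n \<and> tgt \<alpha> = m \<and> fn \<alpha> \<in> {0..n} \<rightarrow>\<^sub>E {0..m} \<and>
    (\<forall>j. distinct (fib \<alpha> j) \<and> set (fib \<alpha> j) = {i \<in> {0..n}. fn \<alpha> i = j})}"

definition ds_id :: "nat \<Rightarrow> ds_mor"
  where "ds_id n = \<lparr>src = n, tgt = n, fn = (\<lambda>i\<in>{0..n}. i), fib = (\<lambda>j. if j \<le> n then [j] else [])\<rparr>"

definition ds_comp :: "ds_mor \<Rightarrow> ds_mor \<Rightarrow> ds_mor"
  where "ds_comp \<beta> \<alpha> =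
    \<lparr>src = src \<alpha>, tgt = tgt \<beta>, fn = compose {0..src \<alpha>} (fn \<beta>) (fn \<alpha>),
     fib = (\<lambda>i. concat (map (fib \<alpha>) (fib \<beta> i)))\<rparr>"

lemma ds_id_in_hom: "ds_id n \<in> ds_hom n n"
  by (auto simp: ds_id_def ds_hom_def)

lemma ds_comp_in_hom:
  assumes "\<alpha> \<in> ds_hom n m" "\<beta> \<in> ds_hom m l"
  shows "ds_comp \<beta> \<alpha> \<in> ds_hom n l"
proof -
  have a: "src \<alpha> = n" "fn \<alpha> \<in> {0..n} \<rightarrow>\<^sub>E {0..m}" "\<And>j. distinct (fib \<alpha> j)"
    "\<And>j. set (fib \<alpha> j) = {i \<in> {0..n}. fn \<alpha> i = j}"
    using assms(1) by (auto simp: ds_hom_def)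
  have b: "tgt \<beta> = l" "fn \<beta> \<in> {0..m} \<rightarrow>\<^sub>E {0..l}" "\<And>j. distinct (fib \<beta> j)"
    "\<And>j. set (fib \<beta> j) = {i \<in> {0..m}. fn \<beta> i = j}"
    using assms(2) by (auto simp: ds_hom_def)
  have dist: "distinct (concat (map (fib \<alpha>) xs))" if "distinct xs" for xs
    using that by (induction xs) (auto simp: a)
  have "set (concat (map (fib \<alpha>) (fib \<beta> j))) = {i \<in> {0..n}. fn \<beta> (fn \<alpha> i) = j}" for j
    using a(2) by (auto simp: a(4) b(4) PiE_iff)
  moreover have "compose {0..n} (fn \<beta>) (fn \<alpha>) \<in> {0..n} \<rightarrow>\<^sub>E {0..l}"
    using a(2) b(2) by (auto simp: compose_def PiE_iff extensional_def)
  ultimately show ?thesis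
    using a b dist by (auto simp: ds_comp_def ds_hom_def compose_def)
qed

lemma ds_comp_id_right: "\<alpha> \<in> ds_hom n m \<Longrightarrow> ds_comp \<alpha> (ds_id n) = \<alpha>"
proof -
  assume a: "\<alpha> \<in> ds_hom n m"
  have "concat (map (\<lambda>j. if j \<le> n then [j] else []) xs) = xs" if "set xs \<subseteq> {0..n}" for xs
    using that by (induction xs) auto
  moreover have "set (fib \<alpha> x) \<subseteq> {0..n}" for x
    using a by (auto simp: ds_hom_def)
  ultimately have "concat (map (\<lambda>j. if j \<le> n then [j] else []) (fib \<alpha> x)) = fib \<alpha> x" for x
    by blast
  with a show ?thesis
    by (intro ds_mor.equality)
      (auto simp: ds_comp_def ds_id_def ds_hom_def compose_def PiE_iff extensional_def fun_eq_iff)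
qed

lemma ds_comp_id_left: "\<alpha> \<in> ds_hom n m \<Longrightarrow> ds_comp (ds_id m) \<alpha> = \<alpha>"
proof -
  assume a: "\<alpha> \<in> ds_hom n m"
  have "fib \<alpha> j = []" if "\<not> j \<le> m" for j
  proof -
    have "set (fib \<alpha> j) = {i \<in> {0..n}. fn \<alpha> i = j}" "fn \<alpha> \<in> {0..n} \<rightarrow>\<^sub>E {0..m}"
      using a by (auto simp: ds_hom_def)
    then have "set (fib \<alpha> j) = {}"
      using that by (auto simp: PiE_iff)
    then show ?thesis by simp
  qed
  with a show ?thesis
    by (intro ds_mor.equality)
      (auto simp: ds_comp_def ds_id_def ds_hom_def compose_def PiE_iff extensional_def fun_eq_iff)
qed

lemma ds_comp_assoc:
  assumes "\<alpha> \<in> ds_hom n m" "\<beta> \<in> ds_hom m l" "\<gamma> \<in> ds_hom l k"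
  shows "ds_comp \<gamma> (ds_comp \<beta> \<alpha>) = ds_comp (ds_comp \<gamma> \<beta>) \<alpha>"
proof -
  have "concat (map (\<lambda>i. concat (map f (g i))) xs) = concat (map f (concat (map g xs)))"
    for f :: "nat \<Rightarrow> nat list" and g xs
    by (induction xs) auto
  with assms show ?thesis
    by (auto simp: ds_comp_def ds_hom_def compose_def PiE_iff fun_eq_iff)
qed


subsection \<open>Functors from \<open>\<Delta>S\<close> to modules\<close>

record ('r, 'm) ds_functor =
  obj :: "nat \<Rightarrow> ('r, 'm) module"
  arr :: "ds_mor \<Rightarrow> 'm \<Rightarrow> 'm"

definition contravariant :: "('r, 'b) ring_scheme \<Rightarrow> ('r, 'm) ds_functor \<Rightarrow> bool"
  where "contravariant R G \<longleftrightarrow>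
    (\<forall>n. module R (obj G n)) \<and>
    (\<forall>n m. \<forall>\<alpha>\<in>ds_hom n m. arr G \<alpha> \<in> module_hom R (obj G m) (obj G n)) \<and>
    (\<forall>n. \<forall>x\<in>carrier (obj G n). arr G (ds_id n) x = x) \<and>
    (\<forall>n m l. \<forall>\<alpha>\<in>ds_hom n m. \<forall>\<beta>\<in>ds_hom m l. \<forall>x\<in>carrier (obj G l).
      arr G (ds_comp \<beta> \<alpha>) x = arr G \<alpha> (arr G \<beta> x))"

text \<open>Natural transformations between contravariant functors.\<close>

definition nat_trans ::
  "('r, 'b) ring_scheme \<Rightarrow> ('r, 'm) ds_functor \<Rightarrow> ('r, 'n) ds_functor \<Rightarrow> (nat \<Rightarrow> 'm \<Rightarrow> 'n) \<Rightarrow> bool"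
  where "nat_trans R G H \<eta> \<longleftrightarrow>
    (\<forall>n. \<eta> n \<in> module_hom R (obj G n) (obj H n)) \<and>
    (\<forall>n m. \<forall>\<alpha>\<in>ds_hom n m. \<forall>x\<in>carrier (obj G m). \<eta> n (arr G \<alpha> x) = arr H \<alpha> (\<eta> m x))"

definition const_functor :: "('r, 'b) ring_scheme \<Rightarrow> ('r, 'r) ds_functor"
  where "const_functor R =
    \<lparr>obj = (\<lambda>_. \<lparr>carrier = carrier R, monoid.mult = monoid.mult R, one = one R, ring.zero = ring.zero R, add = ring.add R,
                 smult = monoid.mult R\<rparr>),
     arr = (\<lambda>_ x. x)\<rparr>"

text \<open>Projectivity in the category of contravariant functors: lifting along epimorphisms, which are
  the pointwise surjective transformations.  A definition can only quantify over functors whose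
  values live in fixed types.  The types chosen for \<open>M\<close> and \<open>N\<close> are large enough to detect
  projectivity: \<open>N\<close> may be \<open>P\<close> itself, and \<open>M\<close> may be its free cover, the direct sum of the
  representables \<open>R[Hom(-, [m])]\<close> over all \<open>m\<close> and all \<open>x \<in> P[m]\<close>, whose elements are finitely
  supported functions on pairs \<open>(\<alpha>, x)\<close>.  If that cover splits, then \<open>P\<close> has the lifting property
  for functors with values in arbitrary types.\<close>

definition projective_functor :: "('r, 'b) ring_scheme \<Rightarrow> ('r, 'm) ds_functor \<Rightarrow> bool"
  where "projective_functor R P \<longleftrightarrow> contravariant R P \<and>
    (\<forall>(M :: ('r, ds_mor \<times> 'm \<Rightarrow> 'r) ds_functor) (N :: ('r, 'm) ds_functor) g h.
      contravariant R M \<and> contravariant R N \<and>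
      nat_trans R M N g \<and> (\<forall>n. g n ` carrier (obj M n) = carrier (obj N n)) \<and>
      nat_trans R P N h \<longrightarrow>
      (\<exists>l. nat_trans R P M l \<and> (\<forall>n. \<forall>x\<in>carrier (obj P n). g n (l n x) = h n x)))"

text \<open>Exactness of \<open>\<dots> \<rightarrow> P 1 \<rightarrow> P 0 \<rightarrow> G \<rightarrow> 0\<close> with differentials \<open>d i : P (Suc i) \<rightarrow> P i\<close> and
  augmentation \<open>e\<close>.\<close>

definition projective_resolution ::
  "('r, 'b) ring_scheme \<Rightarrow> ('r, 'n) ds_functor \<Rightarrow> (nat \<Rightarrow> ('r, 'm) ds_functor) \<Rightarrow>
    (nat \<Rightarrow> nat \<Rightarrow> 'm \<Rightarrow> 'm) \<Rightarrow> (nat \<Rightarrow> 'm \<Rightarrow> 'n) \<Rightarrow> bool"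
  where "projective_resolution R G P d e \<longleftrightarrow>
    (\<forall>i. projective_functor R (P i)) \<and>
    (\<forall>i. nat_trans R (P (Suc i)) (P i) (d i)) \<and>
    nat_trans R (P 0) G e \<and>
    (\<forall>n. e n ` carrier (obj (P 0) n) = carrier (obj G n)) \<and>
    (\<forall>n. d 0 n ` carrier (obj (P 1) n) = {x \<in> carrier (obj (P 0) n). e n x = \<zero>\<^bsub>obj G n\<^esub>}) \<and>
    (\<forall>i n. d (Suc i) n ` carrier (obj (P (Suc (Suc i))) n) =
      {x \<in> carrier (obj (P (Suc i)) n). d i n x = \<zero>\<^bsub>obj (P i) n\<^esub>})"


subsection \<open>Tensor product over \<open>\<Delta>S\<close> and Tor\<close>

text \<open>For \<open>G\<close> contravariant and \<open>F\<close> covariant, the tensor product is the quotient of the direct sum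
  of all \<open>G[n] \<otimes> F[n]\<close> by the relations \<open>\<alpha>\<^sup>* x \<otimes> y = x \<otimes> \<alpha>\<^sub>* y\<close>; the generator \<open>(n, x, y)\<close> stands
  for \<open>x \<otimes> y\<close> in the summand of \<open>[n]\<close>.\<close>

definition fun_tensor_gens ::
  "('r, 'm) ds_functor \<Rightarrow> ('r, 'f) ds_functor \<Rightarrow> (nat \<times> 'm \<times> 'f) set"
  where "fun_tensor_gens G F =
    {(n, x, y). x \<in> carrier (obj G n) \<and> y \<in> carrier (obj F n)}"

definition fun_tensor_rels ::
  "('r, 'b) ring_scheme \<Rightarrow> ('r, 'm) ds_functor \<Rightarrow> ('r, 'f) ds_functor \<Rightarrow>
    (nat \<times> 'm \<times> 'f \<Rightarrow> 'r) set"
  where "fun_tensor_rels R G F = (let L = free_module R (fun_tensor_gens G F); b = basis R in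
    {b (n, x \<oplus>\<^bsub>obj G n\<^esub> x', y) \<ominus>\<^bsub>L\<^esub> (b (n, x, y) \<oplus>\<^bsub>L\<^esub> b (n, x', y)) | n x x' y.
      x \<in> carrier (obj G n) \<and> x' \<in> carrier (obj G n) \<and> y \<in> carrier (obj F n)} \<union>
    {b (n, x, y \<oplus>\<^bsub>obj F n\<^esub> y') \<ominus>\<^bsub>L\<^esub> (b (n, x, y) \<oplus>\<^bsub>L\<^esub> b (n, x, y')) | n x y y'.
      x \<in> carrier (obj G n) \<and> y \<in> carrier (obj F n) \<and> y' \<in> carrier (obj F n)} \<union>
    {b (n, r \<odot>\<^bsub>obj G n\<^esub> x, y) \<ominus>\<^bsub>L\<^esub> (r \<odot>\<^bsub>L\<^esub> b (n, x, y)) | n r x y.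
      r \<in> carrier R \<and> x \<in> carrier (obj G n) \<and> y \<in> carrier (obj F n)} \<union>
    {b (n, x, r \<odot>\<^bsub>obj F n\<^esub> y) \<ominus>\<^bsub>L\<^esub> (r \<odot>\<^bsub>L\<^esub> b (n, x, y)) | n r x y.
      r \<in> carrier R \<and> x \<in> carrier (obj G n) \<and> y \<in> carrier (obj F n)} \<union>
    {b (n, arr G \<alpha> x, y) \<ominus>\<^bsub>L\<^esub> b (m, x, arr F \<alpha> y) | n m \<alpha> x y.
      \<alpha> \<in> ds_hom n m \<and> x \<in> carrier (obj G m) \<and> y \<in> carrier (obj F n)})"

definition fun_tensor ::
  "('r, 'b) ring_scheme \<Rightarrow> ('r, 'm) ds_functor \<Rightarrow> ('r, 'f) ds_functor \<Rightarrow>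
    ('r, (nat \<times> 'm \<times> 'f \<Rightarrow> 'r) set) module"
  where "fun_tensor R G F = presented_module R (fun_tensor_gens G F) (fun_tensor_rels R G F)"

text \<open>The map \<open>\<eta> \<otimes> F\<close> into \<open>fun_tensor R H F\<close> induced by \<open>\<eta> : G \<rightarrow> H\<close>.\<close>

definition fun_tensor_map ::
  "('r, 'b) ring_scheme \<Rightarrow> ('r, 'n) ds_functor \<Rightarrow> ('r, 'f) ds_functor \<Rightarrow> (nat \<Rightarrow> 'm \<Rightarrow> 'n) \<Rightarrow>
    (nat \<times> 'm \<times> 'f \<Rightarrow> 'r) set \<Rightarrow> (nat \<times> 'n \<times> 'f \<Rightarrow> 'r) set"
  where "fun_tensor_map R H F \<eta> =
    presented_map R (fun_tensor_gens H F) (fun_tensor_rels R H F) (\<lambda>(n, x, y). (n, \<eta> n x, y))"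

text \<open>Tor computed from a resolution \<open>(P, d)\<close> of the contravariant argument.\<close>

definition ds_tor ::
  "('r, 'b) ring_scheme \<Rightarrow> (nat \<Rightarrow> ('r, 'm) ds_functor) \<Rightarrow> (nat \<Rightarrow> nat \<Rightarrow> 'm \<Rightarrow> 'm) \<Rightarrow>
    ('r, 'f) ds_functor \<Rightarrow> nat \<Rightarrow> ('r, (nat \<times> 'm \<times> 'f \<Rightarrow> 'r) set set) module"
  where "ds_tor R P d F =
    homology (\<lambda>i. fun_tensor R (P i) F) (\<lambda>i. fun_tensor_map R (P i) F (d i))"


subsection \<open>The symmetric bar construction and symmetric homology\<close>

text \<open>The generator \<open>[a\<^sub>1, \<dots>, a\<^sub>k]\<close> stands for \<open>a\<^sub>1 \<otimes> \<dots> \<otimes> a\<^sub>k\<close>.\<close>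

definition tensor_power_gens :: "('r, 'a, 'c) module_scheme \<Rightarrow> nat \<Rightarrow> 'a list set"
  where "tensor_power_gens A k = {as. length as = k \<and> set as \<subseteq> carrier A}"

definition tensor_power_rels ::
  "('r, 'b) ring_scheme \<Rightarrow> ('r, 'a, 'c) module_scheme \<Rightarrow> nat \<Rightarrow> ('a list \<Rightarrow> 'r) set"
  where "tensor_power_rels R A k = (let L = free_module R (tensor_power_gens A k); b = basis R in
    {b (as[i := x \<oplus>\<^bsub>A\<^esub> y]) \<ominus>\<^bsub>L\<^esub> (b (as[i := x]) \<oplus>\<^bsub>L\<^esub> b (as[i := y])) | as i x y.
      as \<in> tensor_power_gens A k \<and> i < k \<and> x \<in> carrier A \<and> y \<in> carrier A} \<union>
    {b (as[i := r \<odot>\<^bsub>A\<^esub> x]) \<ominus>\<^bsub>L\<^esub> (r \<odot>\<^bsub>L\<^esub> b (as[i := x])) | as i r x.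
      as \<in> tensor_power_gens A k \<and> i < k \<and> r \<in> carrier R \<and> x \<in> carrier A})"

definition bar_sym ::
  "('r, 'b) ring_scheme \<Rightarrow> ('r, 'a, 'c) module_scheme \<Rightarrow> ('r, ('a list \<Rightarrow> 'r) set) ds_functor"
  where "bar_sym R A =
    \<lparr>obj = (\<lambda>n. presented_module R (tensor_power_gens A (Suc n)) (tensor_power_rels R A (Suc n))),
     arr = (\<lambda>\<alpha>. presented_map R
       (tensor_power_gens A (Suc (tgt \<alpha>))) (tensor_power_rels R A (Suc (tgt \<alpha>)))
       (\<lambda>as. map (\<lambda>j. foldr (\<otimes>\<^bsub>A\<^esub>) (map (\<lambda>i. as ! i) (fib \<alpha> j)) \<one>\<^bsub>A\<^esub>) [0..<Suc (tgt \<alpha>)]))\<rparr>"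

text \<open>Symmetric homology computed from \<open>(P, d)\<close>, to be used with an arbitrary projective resolution of
  \<open>const_functor R\<close>.\<close>

definition HS ::
  "('r, 'b) ring_scheme \<Rightarrow> ('r, 'a, 'c) module_scheme \<Rightarrow>
    (nat \<Rightarrow> ('r, 'm) ds_functor) \<Rightarrow> (nat \<Rightarrow> nat \<Rightarrow> 'm \<Rightarrow> 'm) \<Rightarrow> nat \<Rightarrow>
    ('r, (nat \<times> 'm \<times> ('a list \<Rightarrow> 'r) set \<Rightarrow> 'r) set set) module"
  where "HS R A P d = ds_tor R P d (bar_sym R A)"

end

theory Submission
  imports Defs "HOL-Library.Product_Lexorder"
begin

text \<open>It suffices to show that the constant functor has a resolution by free contravariant
  functors with finitely many generators.  Since the ground ring is Noetherian, each syzygy is finitely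
  generated in every degree, so the point is that it is generated in bounded degrees.

  For a pair \<open>p = (a, b)\<close> of letters of \<open>[n]\<close>, merging \<open>b\<close> into \<open>a\<close> is an idempotent endomorphism of
  \<open>[n]\<close> that factors through \<open>[n - 1]\<close>, and these idempotents commute for disjoint pairs.  To a functor
  \<open>G\<close> we attach the complex that has in degree \<open>j\<close> the sum, over all sets \<open>\<mu>\<close> of \<open>j\<close> pairwise disjoint
  pairs, of the elements of \<open>G[n]\<close> invariant under all \<open>p \<in> \<mu>\<close>.  It is exact in \<open>G\<close>, and its homology
  in degree 0 vanishes iff \<open>G[n]\<close> is generated by images of merging maps.  For the constant functor it is
  the chain complex of a matching complex of a complete digraph, and for a free functor a sum of chain
  complexes of matching complexes of unions of paths; both are acyclic in each fixed degree once \<open>n\<close> is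
  large.  By the long exact sequence the same holds for all syzygies, which are therefore generated in
  bounded degrees.

  A given projective resolution is compared with the resolution so obtained only as far as needed: its
  identity is homotopic to a map that factors degreewise through a finitely generated free functor.\<close>

subsection \<open>Alternating complexes of set systems\<close>

text \<open>The index category has infinitely many objects, so finite generation of each tensor
  power of A says nothing by itself about Tor. No Noetherian property of the functor category is
  invoked: only syzygies are controlled, through vanishing homology. Merging is chosen because an
  element invariant under the merge of (a, b) is pulled back from an object with one letter fewer,
  while for a basis element \<alpha> of a free functor invariance just says that b directly follows
  a in an ordered fibre. Fibres thus become paths, whose matching complexes can be treated by hand.
  In the long exact sequence degree j of a kernel depends on degree j + 1 of the image, so degree 0
  of the i-th syzygy rests on degree i of the constant functor; for this reason the induction
  carries every degree, each with its own bound on n. The bounds come from the constant 3j + 2: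
  passing to the link of a neighbour of a suitably chosen pair uses up at most three letters, in a
  complete digraph as at the end of a path, and degree 0 needs one pair, hence two letters.\<close>

definition signed :: "('m, 'c) ring_scheme \<Rightarrow> 'e::linorder \<Rightarrow> 'e set \<Rightarrow> 'm \<Rightarrow> 'm"
  where "signed M p \<mu> x = (if even (card {q \<in> \<mu>. q < p}) then x else \<ominus>\<^bsub>M\<^esub> x)"

text \<open>A chain is stored as the family of its coefficients, so the boundary is read off at a
  face \<open>\<mu>\<close> by collecting the cofaces \<open>insert p \<mu>\<close>. The sign is -1
  to the number of elements of \<open>\<mu>\<close> below \<open>p\<close>. The empty face is
  included, so the complex is augmented.\<close>

definition bd :: "('m, 'c) ring_scheme \<Rightarrow> 'e::linorder set \<Rightarrow> ('e set \<Rightarrow> 'm) \<Rightarrow> 'e set \<Rightarrow> 'm"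
  where "bd M E z \<mu> = (\<Oplus>\<^bsub>M\<^esub>p\<in>E - \<mu>. signed M p \<mu> (z (insert p \<mu>)))"

text \<open>\<open>V\<close> is a coefficient system on the subsets of \<open>E\<close>. The degree
  counts elements, so for finite \<open>E\<close> degree 0 is the single coefficient at the empty
  set, one more than the simplicial dimension. Values elsewhere are pinned to zero, so that chains
  can be compared as functions.\<close>

definition chains :: "('m, 'c) ring_scheme \<Rightarrow> 'e::linorder set \<Rightarrow> ('e set \<Rightarrow> 'm set) \<Rightarrow> nat \<Rightarrow> ('e set \<Rightarrow> 'm) set"
  where "chains M E V j = {z. \<forall>\<mu>. if \<mu> \<subseteq> E \<and> card \<mu> = j then z \<mu> \<in> V \<mu> else z \<mu> = \<zero>\<^bsub>M\<^esub>}"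

definition acyclic_in :: "('m, 'c) ring_scheme \<Rightarrow> 'e::linorder set \<Rightarrow> ('e set \<Rightarrow> 'm set) \<Rightarrow> nat \<Rightarrow> bool"
  where "acyclic_in M E V j \<longleftrightarrow>
    (\<forall>z\<in>chains M E V j. (\<forall>\<mu>\<subseteq>E. bd M E z \<mu> = \<zero>\<^bsub>M\<^esub>) \<longrightarrow>
      (\<exists>y\<in>chains M E V (Suc j). \<forall>\<mu>\<subseteq>E. bd M E y \<mu> = z \<mu>))"

text \<open>With \<open>contr\<close> and \<open>wedge\<close>, the decomposition z = z_0 + u z_1 of
  a chain along a vertex \<open>u\<close>: \<open>del\<close> is the part z_0 in the deletion of
  \<open>u\<close>, \<open>contr\<close> the coefficient z_1 in its link, and \<open>wedge\<close>
  is exterior multiplication by \<open>u\<close> from the left.\<close>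

definition del :: "('m, 'c) ring_scheme \<Rightarrow> 'e \<Rightarrow> ('e set \<Rightarrow> 'm) \<Rightarrow> 'e set \<Rightarrow> 'm"
  where "del M u z \<mu> = (if u \<in> \<mu> then \<zero>\<^bsub>M\<^esub> else z \<mu>)"

definition contr :: "('m, 'c) ring_scheme \<Rightarrow> 'e::linorder \<Rightarrow> ('e set \<Rightarrow> 'm) \<Rightarrow> 'e set \<Rightarrow> 'm"
  where "contr M u z \<mu> = (if u \<in> \<mu> then \<zero>\<^bsub>M\<^esub> else signed M u \<mu> (z (insert u \<mu>)))"

definition wedge :: "('m, 'c) ring_scheme \<Rightarrow> 'e::linorder \<Rightarrow> ('e set \<Rightarrow> 'm) \<Rightarrow> 'e set \<Rightarrow> 'm"
  where "wedge M u y \<mu> = (if u \<in> \<mu> then signed M u (\<mu> - {u}) (y (\<mu> - {u})) else \<zero>\<^bsub>M\<^esub>)"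

context abelian_group
begin

lemma a_inv_zero [simp]: "\<ominus> \<zero> = \<zero>"
  using r_neg[of \<zero>] by simp

lemma a_inv_eq_zero: "x \<in> carrier G \<Longrightarrow> \<ominus> x = \<zero> \<longleftrightarrow> x = \<zero>"
  by (metis a_inv_zero minus_minus)

lemma signed_closed [simp, intro]: "x \<in> carrier G \<Longrightarrow> signed G p \<mu> x \<in> carrier G"
  by (simp add: signed_def)

lemma signed_signed [simp]: "x \<in> carrier G \<Longrightarrow> signed G p \<mu> (signed G p \<mu> x) = x"
  by (simp add: signed_def)

lemma signed_zero [simp]: "signed G p \<mu> \<zero> = \<zero>"
  by (simp add: signed_def)

lemma signed_add: "x \<in> carrier G \<Longrightarrow> y \<in> carrier G \<Longrightarrow>
    signed G p \<mu> (x \<oplus> y) = signed G p \<mu> x \<oplus> signed G p \<mu> y"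
  by (simp add: signed_def minus_add)

lemma signed_minus: "x \<in> carrier G \<Longrightarrow> signed G p \<mu> (\<ominus> x) = \<ominus> signed G p \<mu> x"
  by (simp add: signed_def)

lemma signed_eq_zero: "x \<in> carrier G \<Longrightarrow> signed G p \<mu> x = \<zero> \<Longrightarrow> x = \<zero>"
  by (metis signed_signed signed_zero)

lemma signed_finsum: "finite A \<Longrightarrow> f \<in> A \<rightarrow> carrier G \<Longrightarrow>
    signed G p \<mu> (\<Oplus>i\<in>A. f i) = (\<Oplus>i\<in>A. signed G p \<mu> (f i))"
  by (induction A rule: finite_induct) (simp_all add: Pi_iff signed_add)

lemma minus_finsum: "finite A \<Longrightarrow> f \<in> A \<rightarrow> carrier G \<Longrightarrow>
    \<ominus> (\<Oplus>i\<in>A. f i) = (\<Oplus>i\<in>A. \<ominus> f i)"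
  by (induction A rule: finite_induct) (simp_all add: Pi_iff minus_add)

lemma card_less_insert:
  assumes "finite \<nu>" "u \<notin> \<nu>"
  shows "card {q \<in> insert u \<nu>. q < p} = card {q \<in> \<nu>. q < p} + (if u < p then 1 else 0)"
proof (cases "u < p")
  case True
  then have "{q \<in> insert u \<nu>. q < p} = insert u {q \<in> \<nu>. q < p}" by auto
  with assms True show ?thesis by simp
next
  case False
  then have "{q \<in> insert u \<nu>. q < p} = {q \<in> \<nu>. q < p}" by auto
  with False show ?thesis by simp
qed

text \<open>Inserting \<open>u\<close> changes the sign attached to \<open>p\<close> exactly when u
  < p, and inserting \<open>p\<close> changes that of \<open>u\<close> exactly when p < u; one of
  the two always happens. This gives the Leibniz rule, and the variant \<open>signed_swap'\<close>
  gives the vanishing of the squared boundary.\<close>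

lemma signed_swap:
  fixes p u :: "'e::linorder"
  assumes "finite \<nu>" "u \<notin> \<nu>" "p \<notin> \<nu>" "p \<noteq> u" "x \<in> carrier G"
  shows "signed G p (insert u \<nu>) (signed G u (insert p \<nu>) x) = \<ominus> signed G u \<nu> (signed G p \<nu> x)"
proof -
  have "u < p \<longleftrightarrow> \<not> p < u" using assms(4) by auto
  then show ?thesis
    unfolding signed_def card_less_insert[OF assms(1,2)] card_less_insert[OF assms(1,3)]
    using assms(5) by auto
qed

lemma signed_swap':
  fixes p u :: "'e::linorder"
  assumes "finite \<nu>" "u \<notin> \<nu>" "p \<notin> \<nu>" "p \<noteq> u" "x \<in> carrier G"
  shows "signed G p \<nu> (signed G u (insert p \<nu>) x) = \<ominus> signed G u \<nu> (signed G p (insert u \<nu>) x)"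
proof -
  have "u < p \<longleftrightarrow> \<not> p < u" using assms(4) by auto
  then show ?thesis
    unfolding signed_def card_less_insert[OF assms(1,2)] card_less_insert[OF assms(1,3)]
    using assms(5) by auto
qed

text \<open>The terms at (p, q) and (q, p) cancel. The diagonal is left out of the sum, so nothing
  has to be known about \<open>a p p\<close>, and 2-torsion is harmless.\<close>

lemma finsum_antisym:
  assumes "finite S" "\<And>p q. p \<in> S \<Longrightarrow> q \<in> S \<Longrightarrow> a p q \<in> carrier G"
    "\<And>p q. p \<in> S \<Longrightarrow> q \<in> S \<Longrightarrow> p \<noteq> q \<Longrightarrow> a p q = \<ominus> a q p"
  shows "(\<Oplus>p\<in>S. \<Oplus>q\<in>S - {p}. a p q) = \<zero>"
  using assms
proof (induction S rule: finite_induct)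
  case (insert x S)
  have 1: "(\<Oplus>q\<in>insert x S - {p}. a p q) = a p x \<oplus> (\<Oplus>q\<in>S - {p}. a p q)" if "p \<in> S" for p
  proof -
    have "insert x S - {p} = insert x (S - {p})" using that insert.hyps by auto
    then show ?thesis using insert.hyps insert.prems(1) that by (simp add: Pi_iff)
  qed
  have "(\<Oplus>p\<in>insert x S. \<Oplus>q\<in>insert x S - {p}. a p q)
      = (\<Oplus>q\<in>S. a x q) \<oplus> (\<Oplus>p\<in>S. \<Oplus>q\<in>insert x S - {p}. a p q)"
    using insert.hyps insert.prems(1) by (subst finsum_insert) (auto simp: Pi_iff intro!: finsum_closed)
  also have "(\<Oplus>p\<in>S. \<Oplus>q\<in>insert x S - {p}. a p q) = (\<Oplus>p\<in>S. a p x \<oplus> (\<Oplus>q\<in>S - {p}. a p q))"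
    using insert.hyps insert.prems(1) by (intro finsum_cong') (auto simp: 1 Pi_iff intro!: finsum_closed a_closed)
  also have "\<dots> = (\<Oplus>p\<in>S. a p x) \<oplus> (\<Oplus>p\<in>S. \<Oplus>q\<in>S - {p}. a p q)"
    using insert.hyps insert.prems(1) by (intro finsum_addf) (auto simp: Pi_iff intro!: finsum_closed)
  also have "(\<Oplus>p\<in>S. \<Oplus>q\<in>S - {p}. a p q) = \<zero>"
    using insert.IH insert.prems by blast
  also have "(\<Oplus>p\<in>S. a p x) = (\<Oplus>p\<in>S. \<ominus> a x p)"
    using insert.hyps insert.prems by (intro finsum_cong') (auto simp: Pi_iff)
  also have "\<dots> = \<ominus> (\<Oplus>p\<in>S. a x p)"
    using insert.hyps insert.prems(1) by (intro minus_finsum[symmetric]) (auto simp: Pi_iff)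
  finally show ?case
    using insert.hyps insert.prems(1) by (simp add: Pi_iff r_neg finsum_closed)
qed auto

lemma bd_closed [intro]: "(\<And>\<mu>. z \<mu> \<in> carrier G) \<Longrightarrow> bd G E z \<mu> \<in> carrier G"
  unfolding bd_def by (intro finsum_closed) auto

lemma bd_bd:
  assumes "finite E" "\<And>\<mu>. z \<mu> \<in> carrier G" "\<mu> \<subseteq> E"
  shows "bd G E (bd G E z) \<mu> = \<zero>"
proof -
  have fin: "finite \<mu>" using assms finite_subset by blast
  let ?a = "\<lambda>p q. signed G p \<mu> (signed G q (insert p \<mu>) (z (insert p (insert q \<mu>))))"
  have "bd G E (bd G E z) \<mu> = (\<Oplus>p\<in>E - \<mu>. \<Oplus>q\<in>E - \<mu> - {p}. ?a p q)"
    unfolding bd_def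
  proof (intro finsum_cong')
    fix p assume "p \<in> E - \<mu>"
    have "E - insert p \<mu> = E - \<mu> - {p}" by auto
    then show "signed G p \<mu> (\<Oplus>q\<in>E - insert p \<mu>. signed G q (insert p \<mu>) (z (insert q (insert p \<mu>))))
       = (\<Oplus>q\<in>E - \<mu> - {p}. ?a p q)"
      using assms by (subst signed_finsum) (auto simp: insert_commute)
  qed (use assms in \<open>auto intro!: finsum_closed\<close>)
  also have "\<dots> = \<zero>"
  proof (rule finsum_antisym)
    fix p q assume "p \<in> E - \<mu>" "q \<in> E - \<mu>" "p \<noteq> q"
    then show "?a p q = \<ominus> ?a q p"
      using signed_swap'[OF fin, of q p "z (insert p (insert q \<mu>))"] assms
      by (simp add: insert_commute)
  qed (use assms in auto)
  finally show ?thesis .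
qed

lemma bd_add:
  assumes "\<And>\<mu>. z \<mu> \<in> carrier G" "\<And>\<mu>. w \<mu> \<in> carrier G"
  shows "bd G E (\<lambda>\<mu>. z \<mu> \<oplus> w \<mu>) \<mu> = bd G E z \<mu> \<oplus> bd G E w \<mu>"
  unfolding bd_def using assms by (simp add: signed_add)

lemma bd_minus:
  assumes "finite E" "\<And>\<mu>. z \<mu> \<in> carrier G"
  shows "bd G E (\<lambda>\<mu>. \<ominus> z \<mu>) \<mu> = \<ominus> bd G E z \<mu>"
  unfolding bd_def using assms by (simp add: signed_minus minus_finsum)

text \<open>Deletions and links are complexes on smaller vertex sets \<open>X\<close>; this allows
  their boundaries to be computed over \<open>X\<close> or over \<open>E\<close> alike.\<close>

lemma bd_support:
  assumes "finite E" "X \<subseteq> E" "\<And>\<mu>. z \<mu> \<in> carrier G" "\<And>\<mu>. \<not> \<mu> \<subseteq> X \<Longrightarrow> z \<mu> = \<zero>"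
  shows "bd G E z \<mu> = (if \<mu> \<subseteq> X then bd G X z \<mu> else \<zero>)"
proof (cases "\<mu> \<subseteq> X")
  case True
  have "(\<Oplus>p\<in>E - \<mu>. signed G p \<mu> (z (insert p \<mu>))) = (\<Oplus>p\<in>X - \<mu>. signed G p \<mu> (z (insert p \<mu>)))"
    using assms by (intro add.finprod_mono_neutral_cong_right) auto
  then show ?thesis by (simp add: bd_def True)
next
  case False
  then have "bd G E z \<mu> = (\<Oplus>p\<in>E - \<mu>. \<zero>)"
    unfolding bd_def using assms by (intro finsum_cong') auto
  with False show ?thesis by simp
qed

lemma del_closed: "(\<And>\<mu>. z \<mu> \<in> carrier G) \<Longrightarrow> del G u z \<mu> \<in> carrier G"
  by (simp add: del_def)

lemma contr_closed: "(\<And>\<mu>. z \<mu> \<in> carrier G) \<Longrightarrow> contr G u z \<mu> \<in> carrier G"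
  by (simp add: contr_def)

lemma wedge_closed: "(\<And>\<mu>. z \<mu> \<in> carrier G) \<Longrightarrow> wedge G u z \<mu> \<in> carrier G"
  by (simp add: wedge_def)

lemma del_contr:
  assumes "\<And>\<mu>. z \<mu> \<in> carrier G"
  shows "z \<mu> = del G u z \<mu> \<oplus> wedge G u (contr G u z) \<mu>"
  using assms by (auto simp: del_def contr_def wedge_def insert_absorb)

text \<open>The Leibniz rule d(u y) = y - u d(y) for a chain \<open>y\<close> in the deletion of
  \<open>u\<close>. At a set without \<open>u\<close> only the summand p = u survives; at a set with
  \<open>u\<close> every summand has to move \<open>p\<close> past \<open>u\<close>, which yields
  the minus sign.\<close>

lemma bd_wedge:
  fixes u :: "'e::linorder"
  assumes "finite E" "u \<in> E" "\<mu> \<subseteq> E" "\<And>\<mu>. y \<mu> \<in> carrier G" "\<And>\<mu>. u \<in> \<mu> \<Longrightarrow> y \<mu> = \<zero>"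
  shows "bd G E (wedge G u y) \<mu> = y \<mu> \<oplus> \<ominus> wedge G u (bd G E y) \<mu>"
proof (cases "u \<in> \<mu>")
  case False
  have "bd G E (wedge G u y) \<mu> = (\<Oplus>p\<in>{u}. signed G p \<mu> (wedge G u y (insert p \<mu>)))"
    unfolding bd_def using assms False
    by (intro add.finprod_mono_neutral_cong_right) (auto simp: wedge_def)
  also have "\<dots> = y \<mu>"
    using False assms by (simp add: wedge_def)
  finally show ?thesis
    using False assms by (simp add: wedge_def)
next
  case True
  define \<nu> where "\<nu> = \<mu> - {u}"
  have nu: "\<mu> = insert u \<nu>" "u \<notin> \<nu>" "finite \<nu>"
    using True assms by (auto simp: \<nu>_def intro: finite_subset)
  have "wedge G u (bd G E y) \<mu> = signed G u \<nu> (\<Oplus>p\<in>E - \<nu>. signed G p \<nu> (y (insert p \<nu>)))"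
    using True by (simp add: wedge_def bd_def \<nu>_def)
  also have "(\<Oplus>p\<in>E - \<nu>. signed G p \<nu> (y (insert p \<nu>))) = (\<Oplus>p\<in>E - \<mu>. signed G p \<nu> (y (insert p \<nu>)))"
    using assms nu by (intro add.finprod_mono_neutral_cong_right) auto
  finally have "\<ominus> wedge G u (bd G E y) \<mu> = (\<Oplus>p\<in>E - \<mu>. \<ominus> signed G u \<nu> (signed G p \<nu> (y (insert p \<nu>))))"
    using assms by (simp add: signed_finsum minus_finsum)
  also have "\<dots> = bd G E (wedge G u y) \<mu>"
    unfolding bd_def
  proof (intro finsum_cong')
    fix p assume p: "p \<in> E - \<mu>"
    have "insert p \<mu> - {u} = insert p \<nu>" using p nu by auto
    then show "\<ominus> signed G u \<nu> (signed G p \<nu> (y (insert p \<nu>))) = signed G p \<mu> (wedge G u y (insert p \<mu>))"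
      using True p nu signed_swap[of \<nu> u p "y (insert p \<nu>)"] assms by (simp add: wedge_def)
  qed (use assms in \<open>auto simp: wedge_def\<close>)
  finally show ?thesis
    using True assms(4,5) bd_closed[of "wedge G u y" E \<mu>] wedge_closed[of y u] by simp
qed

end

section \<open>Acyclicity of independence complexes of graphs\<close>

definition indep :: "('e \<Rightarrow> 'e \<Rightarrow> bool) \<Rightarrow> 'e set \<Rightarrow> bool"
  where "indep cf \<mu> \<longleftrightarrow> (\<forall>p\<in>\<mu>. \<forall>q\<in>\<mu>. p \<noteq> q \<longrightarrow> \<not> cf p q)"

text \<open>Constant coefficients on the independence complex of the conflict graph
  \<open>cf\<close>, obtained by letting the coefficient group vanish on dependent sets.\<close>

definition independence_acyclic :: "('m, 'c) ring_scheme \<Rightarrow> ('e::linorder \<Rightarrow> 'e \<Rightarrow> bool) \<Rightarrow> 'e set \<Rightarrow> nat \<Rightarrow> bool"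
  where "independence_acyclic M cf E j = acyclic_in M E (\<lambda>\<mu>. if indep cf \<mu> then carrier M else {\<zero>\<^bsub>M\<^esub>}) j"

context abelian_group
begin

abbreviation "schains cf E j \<equiv> chains G E (\<lambda>\<mu>. if indep cf \<mu> then carrier G else {\<zero>}) j"

lemma schains_iff: "z \<in> schains cf E j \<longleftrightarrow> (\<forall>\<mu>. z \<mu> \<in> carrier G) \<and>
    (\<forall>\<mu>. z \<mu> \<noteq> \<zero> \<longrightarrow> \<mu> \<subseteq> E \<and> card \<mu> = j \<and> indep cf \<mu>)"
proof -
  have "(if \<mu> \<subseteq> E \<and> card \<mu> = j then z \<mu> \<in> (if indep cf \<mu> then carrier G else {\<zero>}) else z \<mu> = \<zero>)
    \<longleftrightarrow> z \<mu> \<in> carrier G \<and> (z \<mu> \<noteq> \<zero> \<longrightarrow> \<mu> \<subseteq> E \<and> card \<mu> = j \<and> indep cf \<mu>)" for \<mu>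
    by (cases "z \<mu> = \<zero>") auto
  then show ?thesis unfolding chains_def by auto
qed

lemma schains_closed: "z \<in> schains cf E j \<Longrightarrow> z \<mu> \<in> carrier G"
  by (auto simp: schains_iff)

lemma schains_zero: "z \<in> schains cf E j \<Longrightarrow> \<not> \<mu> \<subseteq> E \<Longrightarrow> z \<mu> = \<zero>"
  using schains_iff by blast

lemma bd_schains:
  assumes "finite E" "X \<subseteq> E" "z \<in> schains cf X j"
  shows "bd G E z \<mu> = (if \<mu> \<subseteq> X then bd G X z \<mu> else \<zero>)"
  using assms by (intro bd_support) (auto intro: schains_closed schains_zero)

lemma independence_acyclicI:
  assumes "\<And>z. z \<in> schains cf E j \<Longrightarrow> (\<And>\<mu>. \<mu> \<subseteq> E \<Longrightarrow> bd G E z \<mu> = \<zero>) \<Longrightarrow>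
    \<exists>y\<in>schains cf E (Suc j). \<forall>\<mu>\<subseteq>E. bd G E y \<mu> = z \<mu>"
  shows "independence_acyclic G cf E j"
  using assms by (auto simp: independence_acyclic_def acyclic_in_def)

lemma independence_acyclicD:
  assumes "independence_acyclic G cf E j" "z \<in> schains cf E j" "\<And>\<mu>. \<mu> \<subseteq> E \<Longrightarrow> bd G E z \<mu> = \<zero>"
  shows "\<exists>y\<in>schains cf E (Suc j). \<forall>\<mu>\<subseteq>E. bd G E y \<mu> = z \<mu>"
  using assms by (auto simp: independence_acyclic_def acyclic_in_def)

lemma bd_decomp:
  fixes u :: "'e::linorder"
  assumes "finite E" "u \<in> E" "\<And>\<mu>. z \<mu> \<in> carrier G" "\<mu> \<subseteq> E"
  shows "u \<notin> \<mu> \<Longrightarrow> bd G E z \<mu> = bd G E (del G u z) \<mu> \<oplus> contr G u z \<mu>"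
    and "u \<in> \<mu> \<Longrightarrow> bd G E z \<mu> = \<ominus> wedge G u (bd G E (contr G u z)) \<mu>"
proof -
  let ?z0 = "del G u z" and ?z1 = "contr G u z"
  have c: "\<And>\<mu>. ?z0 \<mu> \<in> carrier G" "\<And>\<mu>. ?z1 \<mu> \<in> carrier G" "\<And>\<mu>. wedge G u ?z1 \<mu> \<in> carrier G"
    using assms by (auto intro!: del_closed contr_closed wedge_closed)
  have "z = (\<lambda>\<mu>. ?z0 \<mu> \<oplus> wedge G u ?z1 \<mu>)"
    using del_contr[of z, OF assms(3)] by blast
  then have "bd G E z \<mu> = bd G E (\<lambda>\<mu>. ?z0 \<mu> \<oplus> wedge G u ?z1 \<mu>) \<mu>"
    using assms(3) by simp
  also have "\<dots> = bd G E ?z0 \<mu> \<oplus> (?z1 \<mu> \<oplus> \<ominus> wedge G u (bd G E ?z1) \<mu>)"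
    using c assms by (simp add: bd_add bd_wedge contr_def)
  finally have eq: "bd G E z \<mu> = bd G E ?z0 \<mu> \<oplus> (?z1 \<mu> \<oplus> \<ominus> wedge G u (bd G E ?z1) \<mu>)" .
  have d: "bd G E ?z0 \<mu> \<in> carrier G" "bd G E ?z1 \<mu> \<in> carrier G" "wedge G u (bd G E ?z1) \<mu> \<in> carrier G"
    using c by (auto intro!: wedge_closed)
  show "u \<notin> \<mu> \<Longrightarrow> bd G E z \<mu> = bd G E ?z0 \<mu> \<oplus> ?z1 \<mu>"
    using eq c d by (simp add: wedge_def)
  assume "u \<in> \<mu>"
  moreover from this have "bd G E ?z0 \<mu> = (\<Oplus>p\<in>E - \<mu>. \<zero>)"
    unfolding bd_def by (intro finsum_cong') (auto simp: del_def)
  ultimately show "bd G E z \<mu> = \<ominus> wedge G u (bd G E ?z1) \<mu>"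
    using eq d by (simp add: contr_def)
qed

text \<open>Multiplication of z_0 by the apex \<open>v\<close> contracts the complex. For a cycle z
  = z_0 + v z_1 the condition at sets without \<open>v\<close> reads d z_0 = - z_1, so d(v z_0) =
  z_0 - v d z_0 = z_0 + v z_1 = z.\<close>

lemma independence_acyclic_cone:
  fixes v :: "'e::linorder"
  assumes E: "finite E" "v \<in> E" "\<And>q. q \<in> E \<Longrightarrow> q \<noteq> v \<Longrightarrow> \<not> cf v q \<and> \<not> cf q v"
  shows "independence_acyclic G cf E j"
proof (rule independence_acyclicI)
  fix z assume z: "z \<in> schains cf E j" and bz: "\<And>\<mu>. \<mu> \<subseteq> E \<Longrightarrow> bd G E z \<mu> = \<zero>"
  have zc: "\<And>\<mu>. z \<mu> \<in> carrier G" using z by (auto simp: schains_iff)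
  let ?z0 = "del G v z" and ?z1 = "contr G v z"
  have c: "\<And>\<mu>. ?z0 \<mu> \<in> carrier G" "\<And>\<mu>. ?z1 \<mu> \<in> carrier G"
    using zc by (auto intro!: del_closed contr_closed wedge_closed)
  have "wedge G v ?z0 \<in> schains cf E (Suc j)"
    unfolding schains_iff
  proof (intro conjI allI impI)
    fix \<mu> assume "wedge G v ?z0 \<mu> \<noteq> \<zero>"
    then have v: "v \<in> \<mu>" and nz: "z (\<mu> - {v}) \<noteq> \<zero>"
      by (auto simp: wedge_def del_def split: if_splits)
    then have *: "\<mu> - {v} \<subseteq> E" "card (\<mu> - {v}) = j" "indep cf (\<mu> - {v})"
      using z by (auto simp: schains_iff)
    have "finite \<mu>" using *(1) E finite_subset by (metis finite_Diff2 finite.intros)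
    then show "\<mu> \<subseteq> E" "card \<mu> = Suc j" "indep cf \<mu>"
      using * v E card_Suc_Diff1[of \<mu> v] by (auto simp: indep_def)
  qed (use c in \<open>auto intro!: wedge_closed\<close>)
  moreover have "bd G E (wedge G v ?z0) \<mu> = z \<mu>" if mu: "\<mu> \<subseteq> E" for \<mu>
  proof -
    have "bd G E (wedge G v ?z0) \<mu> = ?z0 \<mu> \<oplus> \<ominus> wedge G v (bd G E ?z0) \<mu>"
      using E c mu by (subst bd_wedge) (auto simp: del_def)
    also have "\<ominus> wedge G v (bd G E ?z0) \<mu> = wedge G v ?z1 \<mu>"
    proof (cases "v \<in> \<mu>")
      case True
      have "bd G E ?z0 (\<mu> - {v}) \<oplus> ?z1 (\<mu> - {v}) = \<zero>"
        using bd_decomp(1)[where z = z and \<mu> = "\<mu> - {v}", OF E(1,2) zc] bz[of "\<mu> - {v}"] mu by force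
      then have "bd G E ?z0 (\<mu> - {v}) = \<ominus> ?z1 (\<mu> - {v})"
        using c bd_closed[of ?z0, OF c(1)] by (metis minus_equality minus_minus)
      then show ?thesis
        using True c by (simp add: wedge_def signed_minus)
    qed (simp add: wedge_def)
    finally show ?thesis using del_contr[of z, OF zc, symmetric] by simp
  qed
  ultimately show "\<exists>y\<in>schains cf E (Suc j). \<forall>\<mu>\<subseteq>E. bd G E y \<mu> = z \<mu>" by blast
qed

text \<open>The Mayer-Vietoris argument for the deletion of \<open>u\<close> and the cone over its
  link. If z = z_0 + u z_1 is a cycle, then z_1 is a cycle of the link and bounds some y_1 there;
  z_0 + y_1 is a cycle of the deletion and bounds some y_0; and y_0 - u y_1 bounds z.\<close>

lemma independence_acyclic_link:
  fixes u :: "'e::linorder"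
  assumes E: "finite E" "u \<in> E" and del: "independence_acyclic G cf (E - {u}) j"
    and link: "j = 0 \<or> independence_acyclic G cf {q \<in> E. q \<noteq> u \<and> \<not> cf u q} (j - 1)"
    and sym: "\<And>p q. cf p q \<Longrightarrow> cf q p"
  shows "independence_acyclic G cf E j"
proof (rule independence_acyclicI)
  fix z assume z: "z \<in> schains cf E j" and bz: "\<And>\<mu>. \<mu> \<subseteq> E \<Longrightarrow> bd G E z \<mu> = \<zero>"
  have zc: "\<And>\<mu>. z \<mu> \<in> carrier G" using z by (auto simp: schains_iff)
  let ?z0 = "del G u z" and ?z1 = "contr G u z"
  have c: "\<And>\<mu>. ?z0 \<mu> \<in> carrier G" "\<And>\<mu>. ?z1 \<mu> \<in> carrier G"
    using zc by (auto intro!: del_closed contr_closed wedge_closed)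
  define E' where "E' = {q \<in> E. q \<noteq> u \<and> \<not> cf u q}"
  have E'E: "E' \<subseteq> E" "E' \<subseteq> E - {u}" by (auto simp: E'_def)
  have fins: "finite \<mu>" if "\<mu> \<subseteq> E" for \<mu> using E that finite_subset by blast
  have "\<exists>y1\<in>schains cf E' j. \<forall>\<mu>\<subseteq>E. bd G E y1 \<mu> = ?z1 \<mu>"
  proof (cases j)
    case 0
    \<comment> \<open>In degree 0 only the empty set carries a coefficient, so there is no part
      along \<open>u\<close> and the link is not consulted.\<close>
    have "?z1 \<mu> = \<zero>" for \<mu>
    proof (rule ccontr)
      assume "?z1 \<mu> \<noteq> \<zero>"
      then have "z (insert u \<mu>) \<noteq> \<zero>" by (auto simp: contr_def split: if_splits)
      then have "insert u \<mu> \<subseteq> E" "card (insert u \<mu>) = 0" using z 0 by (auto simp: schains_iff)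
      then show False using fins by (metis card_0_eq insert_not_empty)
    qed
    moreover have "(\<lambda>_. \<zero>) \<in> schains cf E' j" by (simp add: schains_iff)
    moreover have "bd G E (\<lambda>_. \<zero>) \<mu> = \<zero>" for \<mu> by (simp add: bd_def)
    ultimately show ?thesis by auto
  next
    case (Suc i)
    have z1: "?z1 \<in> schains cf E' i"
      unfolding schains_iff
    proof (intro conjI allI impI)
      fix \<mu> assume "?z1 \<mu> \<noteq> \<zero>"
      then have u: "u \<notin> \<mu>" and nz: "z (insert u \<mu>) \<noteq> \<zero>"
        by (auto simp: contr_def split: if_splits)
      then have *: "insert u \<mu> \<subseteq> E" "card (insert u \<mu>) = Suc i" "indep cf (insert u \<mu>)"
        using z Suc by (auto simp: schains_iff)
      then show "\<mu> \<subseteq> E'" "card \<mu> = i" "indep cf \<mu>"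
        using u fins[of \<mu>] by (auto simp: indep_def E'_def)
    qed (use c in auto)
    have "bd G E ?z1 \<mu> = \<zero>" if mu: "\<mu> \<subseteq> E" "u \<notin> \<mu>" for \<mu>
    proof -
      \<comment> \<open>At sets containing \<open>u\<close> the boundary of \<open>z\<close> is - u
        d(z_1), and at a single set \<open>wedge\<close> only changes a sign, so the boundary of z_1
        vanishes.\<close>
      have "\<ominus> wedge G u (bd G E ?z1) (insert u \<mu>) = \<zero>"
        using bd_decomp(2)[where z = z and \<mu> = "insert u \<mu>", OF E zc] mu E bz[of "insert u \<mu>"] by simp
      then have "\<ominus> signed G u \<mu> (bd G E ?z1 \<mu>) = \<zero>"
        using mu by (simp add: wedge_def)
      then show ?thesis
        using bd_closed[of ?z1, OF c(2)] signed_eq_zero[of "bd G E ?z1 \<mu>" u \<mu>] by (simp add: a_inv_eq_zero)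
    qed
    moreover have "\<mu> \<subseteq> E \<and> u \<notin> \<mu>" if "\<mu> \<subseteq> E'" for \<mu> using that E'E by blast
    ultimately have "bd G E' ?z1 \<mu> = \<zero>" if "\<mu> \<subseteq> E'" for \<mu>
      using that bd_schains[OF E(1) E'E(1) z1, of \<mu>] by simp
    then obtain y1 where y1: "y1 \<in> schains cf E' (Suc i)" "\<And>\<mu>. \<mu> \<subseteq> E' \<Longrightarrow> bd G E' y1 \<mu> = ?z1 \<mu>"
      using independence_acyclicD[of cf E' i ?z1] link Suc z1 by (auto simp: E'_def)
    have "bd G E y1 \<mu> = ?z1 \<mu>" if "\<mu> \<subseteq> E" for \<mu>
      using bd_schains[OF E(1) E'E(1) y1(1), of \<mu>] y1(2)[of \<mu>] schains_zero[OF z1, of \<mu>] by auto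
    with y1 show ?thesis unfolding Suc by blast
  qed
  then obtain y1 where y1: "y1 \<in> schains cf E' j" "\<And>\<mu>. \<mu> \<subseteq> E \<Longrightarrow> bd G E y1 \<mu> = ?z1 \<mu>" by blast
  have y1c: "\<And>\<mu>. y1 \<mu> \<in> carrier G" using y1 by (auto simp: schains_iff)
  have y1u: "y1 \<mu> = \<zero>" if "u \<in> \<mu>" for \<mu>
    using schains_zero[OF y1(1), of \<mu>] that E'E(2) by blast
  define w where "w = (\<lambda>\<mu>. ?z0 \<mu> \<oplus> y1 \<mu>)"
  have w: "w \<in> schains cf (E - {u}) j"
    unfolding schains_iff
  proof (intro conjI allI impI)
    fix \<mu> assume "w \<mu> \<noteq> \<zero>"
    then have "?z0 \<mu> \<noteq> \<zero> \<or> y1 \<mu> \<noteq> \<zero>" by (auto simp: w_def)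
    moreover have "\<mu> \<subseteq> E - {u} \<and> card \<mu> = j \<and> indep cf \<mu>" if "?z0 \<mu> \<noteq> \<zero>"
      using that z by (auto simp: schains_iff del_def split: if_splits)
    moreover have "\<mu> \<subseteq> E' \<and> card \<mu> = j \<and> indep cf \<mu>" if "y1 \<mu> \<noteq> \<zero>"
      using that y1(1) unfolding schains_iff by blast
    ultimately show "\<mu> \<subseteq> E - {u}" "card \<mu> = j" "indep cf \<mu>"
      using E'E(2) by blast+
  qed (use c y1c in \<open>auto simp: w_def\<close>)
  have "bd G E w \<mu> = \<zero>" if "\<mu> \<subseteq> E - {u}" for \<mu>
  proof -
    have "bd G E w \<mu> = bd G E ?z0 \<mu> \<oplus> ?z1 \<mu>"
      using that c y1c y1 by (simp add: w_def bd_add subset_Diff_insert)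
    also have "\<dots> = \<zero>" using bd_decomp(1)[where z = z and \<mu> = \<mu>, OF E zc] that bz[of \<mu>]
      by (simp add: subset_Diff_insert)
    finally show ?thesis .
  qed
  then have "bd G (E - {u}) w \<mu> = \<zero>" if "\<mu> \<subseteq> E - {u}" for \<mu>
    using that bd_schains[OF E(1) _ w, of \<mu>] by auto
  then obtain y0 where y0: "y0 \<in> schains cf (E - {u}) (Suc j)"
      "\<And>\<mu>. \<mu> \<subseteq> E - {u} \<Longrightarrow> bd G (E - {u}) y0 \<mu> = w \<mu>"
    using independence_acyclicD[OF del w] by auto
  have y0c: "\<And>\<mu>. y0 \<mu> \<in> carrier G" using y0 by (auto simp: schains_iff)
  have by0: "bd G E y0 \<mu> = w \<mu>" for \<mu>
    using bd_schains[OF E(1) _ y0(1), of \<mu>] y0(2)[of \<mu>] schains_zero[OF w, of \<mu>] by auto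
  define y where "y = (\<lambda>\<mu>. y0 \<mu> \<oplus> \<ominus> wedge G u y1 \<mu>)"
  have wc: "\<And>\<mu>. wedge G u y1 \<mu> \<in> carrier G" using y1c by (auto intro!: wedge_closed)
  have "y \<in> schains cf E (Suc j)"
    unfolding schains_iff
  proof (intro conjI allI impI)
    fix \<mu> assume "y \<mu> \<noteq> \<zero>"
    then have "y0 \<mu> \<noteq> \<zero> \<or> wedge G u y1 \<mu> \<noteq> \<zero>" by (auto simp: y_def)
    then have "\<mu> \<subseteq> E \<and> card \<mu> = Suc j \<and> indep cf \<mu>"
    proof
      assume "wedge G u y1 \<mu> \<noteq> \<zero>"
      then have u: "u \<in> \<mu>" and nz: "y1 (\<mu> - {u}) \<noteq> \<zero>"
        by (auto simp: wedge_def split: if_splits)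
      then have *: "\<mu> - {u} \<subseteq> E'" "card (\<mu> - {u}) = j" "indep cf (\<mu> - {u})"
        using y1 by (auto simp: schains_iff)
      then have "\<mu> \<subseteq> E" using E'E E by auto
      \<comment> \<open>Independence looks at both orders of a pair, whereas the link is cut out by
        \<open>cf u q\<close> alone; symmetry closes the gap.\<close>
      moreover have "\<not> cf u q \<and> \<not> cf q u" if "q \<in> \<mu>" "q \<noteq> u" for q
        using that *(1) sym[of q u] by (auto simp: E'_def)
      then have "indep cf \<mu>" using *(3) unfolding indep_def by blast
      ultimately show ?thesis
        using *(2) u fins[of \<mu>] card_Suc_Diff1[of \<mu> u] by auto
    qed (use y0 in \<open>auto simp: schains_iff\<close>)
    then show "\<mu> \<subseteq> E" "card \<mu> = Suc j" "indep cf \<mu>" by auto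
  qed (use y0c wc in \<open>auto simp: y_def\<close>)
  moreover have "bd G E y \<mu> = z \<mu>" if mu: "\<mu> \<subseteq> E" for \<mu>
  proof -
    have "wedge G u (bd G E y1) \<mu> = wedge G u ?z1 \<mu>"
      using mu y1(2)[of "\<mu> - {u}"] by (simp add: wedge_def subset_eq)
    then have "bd G E y \<mu> = w \<mu> \<oplus> \<ominus> (y1 \<mu> \<oplus> \<ominus> wedge G u ?z1 \<mu>)"
      unfolding y_def using y0c wc y1c E mu y1u
      by (subst bd_add) (auto simp: bd_minus by0 bd_wedge)
    also have "\<dots> = ?z0 \<mu> \<oplus> wedge G u ?z1 \<mu>"
      using c y1c wedge_closed[of ?z1, OF c(2), of u \<mu>] by (simp add: w_def minus_add a_assoc r_neg2)
    finally show ?thesis using del_contr[of z, OF zc, symmetric] by simp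
  qed
  ultimately show "\<exists>y\<in>schains cf E (Suc j). \<forall>\<mu>\<subseteq>E. bd G E y \<mu> = z \<mu>" by blast
qed

end

text \<open>Once the neighbours of \<open>v\<close> have been deleted one at a time, the independence complex is a cone with
  apex \<open>v\<close>; deleting \<open>u\<close> needs acyclicity of the link of \<open>u\<close> in one degree less.\<close>

primrec reducible :: "('e \<Rightarrow> 'e \<Rightarrow> bool) \<Rightarrow> nat \<Rightarrow> 'e set \<Rightarrow> bool" where
  "reducible cf 0 X \<longleftrightarrow> X \<noteq> {}"
| "reducible cf (Suc j) X \<longleftrightarrow> (\<exists>v\<in>X. \<forall>u\<in>X. u \<noteq> v \<longrightarrow> cf v u \<longrightarrow>
    (\<forall>Z\<subseteq>{q \<in> X. q \<noteq> v \<and> cf v q}. reducible cf j ({q \<in> X. q \<noteq> u \<and> \<not> cf u q} - Z)))"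

text \<open>Starting from the cone that remains without the neighbours \<open>N\<close> of
  \<open>v\<close>, the neighbours are put back one at a time. When \<open>u\<close> returns while
  \<open>N - insert u N'\<close> is still absent, its link is the full link without these vertices.
  The quantifier over \<open>Z\<close> in \<open>reducible\<close> covers every such situation, so
  no order of the neighbours has to be fixed.\<close>

lemma (in abelian_group) reducible_imp_acyclic:
  fixes X :: "'e::linorder set"
  assumes sym: "\<And>p q. cf p q \<Longrightarrow> cf q p" and "finite X" "reducible cf j X"
  shows "independence_acyclic G cf X j"
  using assms(2,3)
proof (induction j arbitrary: X)
  case 0
  \<comment> \<open>All vertices other than \<open>v\<close> are deleted, which in degree 0 requires
    nothing of the links; the single vertex \<open>v\<close> is a cone.\<close>
  have *: "independence_acyclic G cf Y 0" if "finite Y" "Y \<subseteq> X" "v \<in> Y" for Y v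
    using that
  proof (induction "card Y" arbitrary: Y)
    case (Suc n)
    show ?case
    proof (cases "Y = {v}")
      case True
      then show ?thesis by (intro independence_acyclic_cone[of _ v]) auto
    next
      case False
      then obtain u where u: "u \<in> Y" "u \<noteq> v" using Suc.prems by blast
      then have "independence_acyclic G cf (Y - {u}) 0" using Suc by (intro Suc.hyps) auto
      then show ?thesis using Suc u sym by (intro independence_acyclic_link[of Y u]) auto
    qed
  qed auto
  then show ?case using 0 by auto
next
  case (Suc j)
  then obtain v where v: "v \<in> X" and g: "\<And>u Z. u \<in> X \<Longrightarrow> u \<noteq> v \<Longrightarrow> cf v u \<Longrightarrow>
      Z \<subseteq> {q \<in> X. q \<noteq> v \<and> cf v q} \<Longrightarrow> reducible cf j ({q \<in> X. q \<noteq> u \<and> \<not> cf u q} - Z)"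
    by auto
  define N where "N = {q \<in> X. q \<noteq> v \<and> cf v q}"
  have "finite N" using Suc by (simp add: N_def)
  have "independence_acyclic G cf (X - (N - N')) (Suc j)" if "N' \<subseteq> N" "finite N'" for N'
    using that(2,1)
  proof (induction N' rule: finite_induct)
    case empty
    show ?case using Suc v sym by (intro independence_acyclic_cone[of _ v]) (auto simp: N_def)
  next
    case (insert u N')
    let ?E = "X - (N - insert u N')"
    have u: "u \<in> X" "u \<noteq> v" "cf v u" "u \<in> ?E" using insert by (auto simp: N_def)
    have "?E - {u} = X - (N - N')" using insert by auto
    moreover have "{q \<in> ?E. q \<noteq> u \<and> \<not> cf u q} = {q \<in> X. q \<noteq> u \<and> \<not> cf u q} - (N - insert u N')"
      by auto
    moreover have "reducible cf j ({q \<in> X. q \<noteq> u \<and> \<not> cf u q} - (N - insert u N'))"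
      using u by (intro g) (auto simp: N_def)
    ultimately show ?case
      using insert Suc u sym by (intro independence_acyclic_link[of ?E u]) auto
  qed
  from this[of N] \<open>finite N\<close> show ?case by simp
qed

section \<open>Matching complexes of complete digraphs and of paths\<close>

definition clash :: "nat \<times> nat \<Rightarrow> nat \<times> nat \<Rightarrow> bool"
  where "clash p q \<longleftrightarrow> {fst p, snd p} \<inter> {fst q, snd q} \<noteq> {}"

lemma clash_sym: "clash p q \<Longrightarrow> clash q p"
  by (auto simp: clash_def)

text \<open>A neighbour \<open>u\<close> of \<open>(a, b)\<close> shares a letter with it, so the
  two touch at most three letters together. Pairs on the remaining letters do not clash with
  \<open>u\<close>, and they avoid \<open>Z\<close> because its members clash with
  \<open>(a, b)\<close>. Only an inclusion is asked of \<open>X\<close>: a link with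
  \<open>Z\<close> removed may still contain pairs that use the discarded letters.\<close>

lemma reducible_complete:
  assumes "finite L" "3 * j + 2 \<le> card L" "\<And>a b. a \<in> L \<Longrightarrow> b \<in> L \<Longrightarrow> a \<noteq> b \<Longrightarrow> (a, b) \<in> X"
  shows "reducible clash j X"
  using assms
proof (induction j arbitrary: X L)
  case 0
  then have "\<not> card L \<le> Suc 0" by simp
  then obtain a b where "a \<in> L" "b \<in> L" "a \<noteq> b" using card_le_Suc0_iff_eq[OF 0(1)] by blast
  then show ?case using 0(3) by auto
next
  case (Suc j)
  then have "\<not> card L \<le> Suc 0" by simp
  then obtain a b where ab: "a \<in> L" "b \<in> L" "a \<noteq> b" using card_le_Suc0_iff_eq[OF Suc.prems(1)] by blast
  have "reducible clash j ({q \<in> X. q \<noteq> u \<and> \<not> clash u q} - Z)"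
    if u: "clash (a, b) u" "Z \<subseteq> {q \<in> X. q \<noteq> (a, b) \<and> clash (a, b) q}" for u Z
  proof (rule Suc.IH)
    let ?D = "{a, b, fst u, snd u}"
    show "finite (L - ?D)" using Suc by simp
    have "card ?D \<le> 3" using u(1) by (auto simp: clash_def card_insert_if)
    moreover have "card L - card ?D \<le> card (L - ?D)" by (intro diff_card_le_card_Diff) simp
    ultimately show "3 * j + 2 \<le> card (L - ?D)" using Suc.prems(2) by simp
    show "(c, d) \<in> {q \<in> X. q \<noteq> u \<and> \<not> clash u q} - Z" if "c \<in> L - ?D" "d \<in> L - ?D" "c \<noteq> d" for c d
      using that u(2) Suc.prems(3) by (auto simp: clash_def)
  qed
  then show ?case using Suc.prems(3) ab by (simp del: subset_iff) blast
qed

definition steps :: "nat list \<Rightarrow> (nat \<times> nat) set"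
  where "steps w = set (zip w (tl w))"

lemma steps_simps [simp]: "steps [] = {}" "steps [x] = {}" "steps (x # y # w) = insert (x, y) (steps (y # w))"
  by (auto simp: steps_def)

lemma steps_in_set: "q \<in> steps w \<Longrightarrow> fst q \<in> set w \<and> snd q \<in> set w"
  by (induction w rule: induct_list012) auto

text \<open>The last hypothesis cuts the path off from the rest of \<open>X\<close>, which may be
  arbitrary. The end edge \<open>(x1, x2)\<close> then has at most one neighbour,
  \<open>(x2, x3)\<close>, whose link loses the letters \<open>x1\<close>, \<open>x2\<close>,
  \<open>x3\<close> and keeps the path starting at \<open>x4\<close>. Again three letters are spent
  for one degree.\<close>

lemma reducible_path:
  assumes "distinct w" "3 * j + 2 \<le> length w" "steps w \<subseteq> X"
    "\<And>q. q \<in> X \<Longrightarrow> {fst q, snd q} \<inter> set w \<noteq> {} \<Longrightarrow> q \<in> steps w"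
  shows "reducible clash j X"
  using assms
proof (induction j arbitrary: X w)
  case 0
  then obtain x y w' where "w = x # y # w'"
    by (cases w; cases "tl w") auto
  then show ?case using 0 by auto
next
  case (Suc j)
  from Suc.prems(2) obtain x1 x2 x3 x4 w' where w: "w = x1 # x2 # x3 # x4 # w'"
    by (cases w; cases "tl w"; cases "tl (tl w)"; cases "tl (tl (tl w))") auto
  note d = Suc.prems(1)[unfolded w]
  have nin: "q \<in> steps (x4 # w') \<Longrightarrow> q \<noteq> (x1, x2) \<and> q \<noteq> (x2, x3) \<and> \<not> clash (x2, x3) q \<and> \<not> clash (x1, x2) q" for q
    using steps_in_set[of q "x4 # w'"] d by (auto simp: clash_def)
  have nb: "u = (x2, x3)" if "u \<in> X" "u \<noteq> (x1, x2)" "clash (x1, x2) u" for u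
  proof -
    have "u \<in> steps w" using that Suc.prems(4)[of u] by (auto simp: clash_def w)
    then show ?thesis using that d nin[of u] by (auto simp: w clash_def)
  qed
  have "reducible clash j ({q \<in> X. q \<noteq> u \<and> \<not> clash u q} - Z)"
    if u: "u \<in> X" "u \<noteq> (x1, x2)" "clash (x1, x2) u" "Z \<subseteq> {q \<in> X. q \<noteq> (x1, x2) \<and> clash (x1, x2) q}" for u Z
  proof (rule Suc.IH)
    have [simp]: "u = (x2, x3)" using nb u by auto
    show "distinct (x4 # w')" using d by simp
    show "3 * j + 2 \<le> length (x4 # w')" using Suc.prems(2) by (simp add: w)
    show "steps (x4 # w') \<subseteq> {q \<in> X. q \<noteq> u \<and> \<not> clash u q} - Z"
      using nin Suc.prems(3) u(4) by (auto simp: w)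
    fix q assume q: "q \<in> {q \<in> X. q \<noteq> u \<and> \<not> clash u q} - Z" "{fst q, snd q} \<inter> set (x4 # w') \<noteq> {}"
    then have "q \<in> steps w" by (intro Suc.prems(4)) (auto simp: w)
    \<comment> \<open>The edge from \<open>x3\<close> to \<open>x4\<close> also touches the
      shortened path, but it clashes with \<open>u\<close> and is absent from the link.\<close>
    then show "q \<in> steps (x4 # w')" using q by (cases q) (auto simp: w clash_def)
  qed
  moreover have "(x1, x2) \<in> X" using Suc.prems(3) by (auto simp: w)
  ultimately show ?case by (simp del: subset_iff) blast
qed

subsection \<open>Modules over a commutative ring\<close>

lemma module_homI:
  assumes "\<And>x. x \<in> carrier M \<Longrightarrow> h x \<in> carrier N"
    "\<And>x y. x \<in> carrier M \<Longrightarrow> y \<in> carrier M \<Longrightarrow> h (x \<oplus>\<^bsub>M\<^esub> y) = h x \<oplus>\<^bsub>N\<^esub> h y"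
    "\<And>r x. r \<in> carrier R \<Longrightarrow> x \<in> carrier M \<Longrightarrow> h (r \<odot>\<^bsub>M\<^esub> x) = r \<odot>\<^bsub>N\<^esub> h x"
  shows "h \<in> module_hom R M N"
  using assms by (auto simp: module_hom_def)

lemma module_hom_closed: "h \<in> module_hom R M N \<Longrightarrow> x \<in> carrier M \<Longrightarrow> h x \<in> carrier N"
  by (auto simp: module_hom_def)

lemma module_hom_add: "h \<in> module_hom R M N \<Longrightarrow> x \<in> carrier M \<Longrightarrow> y \<in> carrier M \<Longrightarrow>
    h (x \<oplus>\<^bsub>M\<^esub> y) = h x \<oplus>\<^bsub>N\<^esub> h y"
  by (auto simp: module_hom_def)

lemma module_hom_smult: "h \<in> module_hom R M N \<Longrightarrow> r \<in> carrier R \<Longrightarrow> x \<in> carrier M \<Longrightarrow>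
    h (r \<odot>\<^bsub>M\<^esub> x) = r \<odot>\<^bsub>N\<^esub> h x"
  by (auto simp: module_hom_def)

lemma module_hom_compose: "h \<in> module_hom R M N \<Longrightarrow> k \<in> module_hom R N L \<Longrightarrow> (\<lambda>x. k (h x)) \<in> module_hom R M L"
  by (intro module_homI) (auto simp: module_hom_closed module_hom_add module_hom_smult)

lemma module_hom_zero:
  assumes "module R M" "module R N" "h \<in> module_hom R M N"
  shows "h \<zero>\<^bsub>M\<^esub> = \<zero>\<^bsub>N\<^esub>"
proof -
  interpret M: module R M by fact
  interpret N: module R N by fact
  have "h (\<zero>\<^bsub>R\<^esub> \<odot>\<^bsub>M\<^esub> \<zero>\<^bsub>M\<^esub>) = \<zero>\<^bsub>R\<^esub> \<odot>\<^bsub>N\<^esub> h \<zero>\<^bsub>M\<^esub>"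
    using assms(3) by (intro module_hom_smult) auto
  then show ?thesis using module_hom_closed[OF assms(3)] by simp
qed

lemma module_hom_minus:
  assumes "module R M" "module R N" "h \<in> module_hom R M N" "x \<in> carrier M"
  shows "h (\<ominus>\<^bsub>M\<^esub> x) = \<ominus>\<^bsub>N\<^esub> h x"
proof -
  interpret M: module R M by fact
  interpret N: module R N by fact
  have c: "h x \<in> carrier N" "h (\<ominus>\<^bsub>M\<^esub> x) \<in> carrier N"
    using assms module_hom_closed[OF assms(3)] by auto
  have "h (\<ominus>\<^bsub>M\<^esub> x) \<oplus>\<^bsub>N\<^esub> h x = h (\<ominus>\<^bsub>M\<^esub> x \<oplus>\<^bsub>M\<^esub> x)"
    using assms(4) by (intro module_hom_add[OF assms(3), symmetric]) auto
  also have "\<dots> = \<zero>\<^bsub>N\<^esub>"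
    using module_hom_zero[OF assms(1-3)] assms(4) by (simp add: M.M.l_neg)
  finally show ?thesis using c N.M.minus_equality by auto
qed

lemma module_hom_finsum:
  assumes "module R M" "module R N" "h \<in> module_hom R M N" "finite I" "f \<in> I \<rightarrow> carrier M"
  shows "h (\<Oplus>\<^bsub>M\<^esub>i\<in>I. f i) = (\<Oplus>\<^bsub>N\<^esub>i\<in>I. h (f i))"
  using assms(4,5)
proof (induction I rule: finite_induct)
  interpret M: module R M by fact
  interpret N: module R N by fact
  {
    case empty
    show ?case using module_hom_zero[OF assms(1-3)] by simp
  next
    case (insert i I)
    then show ?case
      using module_hom_closed[OF assms(3)] by (simp add: Pi_iff module_hom_add[OF assms(3)])
  }
qed

lemma const_functor_module: "cring R \<Longrightarrow> module R (obj (const_functor R) n)"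
proof -
  assume "cring R"
  then interpret cring R .
  have "\<exists>y\<in>carrier R. y \<oplus>\<^bsub>R\<^esub> x = \<zero>\<^bsub>R\<^esub>" if "x \<in> carrier R" for x
    using that l_neg by blast
  then show ?thesis
    unfolding const_functor_def
    by (intro moduleI abelian_groupI) (auto simp: is_cring a_ac l_distr r_distr m_assoc)
qed

subsection \<open>Spans and quotients\<close>

text \<open>Scalar multiplication of cosets and \<open>presented_map\<close> are defined as unions
  over all representatives; such a union is a single coset as soon as the representatives
  agree.\<close>

lemma UN_const_eq: "A \<noteq> {} \<Longrightarrow> (\<And>x. x \<in> A \<Longrightarrow> f x = c) \<Longrightarrow> (\<Union>x\<in>A. f x) = c"
  by auto

context module
begin

text \<open>Negatives are multiples by -1 and zero is the null multiple of any element, so the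
  subgroup conditions reduce to closure under sums and multiples together with zero.\<close>

lemma submodule_iff: "submodule H R M \<longleftrightarrow> H \<subseteq> carrier M \<and> \<zero>\<^bsub>M\<^esub> \<in> H \<and>
    (\<forall>x\<in>H. \<forall>y\<in>H. x \<oplus>\<^bsub>M\<^esub> y \<in> H) \<and> (\<forall>r\<in>carrier R. \<forall>x\<in>H. r \<odot>\<^bsub>M\<^esub> x \<in> H)"
proof
  assume H: "submodule H R M"
  show "H \<subseteq> carrier M \<and> \<zero>\<^bsub>M\<^esub> \<in> H \<and>
    (\<forall>x\<in>H. \<forall>y\<in>H. x \<oplus>\<^bsub>M\<^esub> y \<in> H) \<and> (\<forall>r\<in>carrier R. \<forall>x\<in>H. r \<odot>\<^bsub>M\<^esub> x \<in> H)"
  proof (intro conjI)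
    obtain h where "h \<in> H" using submoduleE(2)[OF H] by blast
    then show "\<zero>\<^bsub>M\<^esub> \<in> H"
      using submoduleE(1,4)[OF H] smult_l_null[of h] by (metis R.zero_closed subsetD)
  qed (use submoduleE[OF H] in auto)
next
  assume H: "H \<subseteq> carrier M \<and> \<zero>\<^bsub>M\<^esub> \<in> H \<and>
    (\<forall>x\<in>H. \<forall>y\<in>H. x \<oplus>\<^bsub>M\<^esub> y \<in> H) \<and> (\<forall>r\<in>carrier R. \<forall>x\<in>H. r \<odot>\<^bsub>M\<^esub> x \<in> H)"
  have "\<ominus>\<^bsub>M\<^esub> a = (\<ominus> \<one>) \<odot>\<^bsub>M\<^esub> a" if "a \<in> H" for a
    using that H by (auto simp: smult_l_minus subset_iff)
  then show "submodule H R M" using H by (intro submoduleI) auto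
qed

lemma submodule_span_submodule:
  assumes "S \<subseteq> carrier M"
  shows "submodule (submodule_span R M S) R M"
proof -
  have "submodule (carrier M) R M" by (rule carrier_is_submodule)
  then show ?thesis
    using assms unfolding submodule_span_def submodule_iff by auto
qed

lemma submodule_span_incl: "S \<subseteq> submodule_span R M S"
  by (auto simp: submodule_span_def)

lemma submodule_span_least: "submodule N R M \<Longrightarrow> S \<subseteq> N \<Longrightarrow> submodule_span R M S \<subseteq> N"
  by (auto simp: submodule_span_def)

lemma submodule_span_subset: "S \<subseteq> carrier M \<Longrightarrow> submodule_span R M S \<subseteq> carrier M"
  by (rule submodule_span_least[OF carrier_is_submodule])

lemma finsum_in_submodule:
  assumes "submodule N R M" "finite I" "f \<in> I \<rightarrow> N"
  shows "(\<Oplus>\<^bsub>M\<^esub>i\<in>I. f i) \<in> N"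
  using assms(2,3)
proof (induction I rule: finite_induct)
  case (insert i I)
  then show ?case using assms(1) unfolding submodule_iff
    by (subst finsum_insert) auto
qed (use assms(1) in \<open>auto simp: submodule_iff\<close>)

lemma abelian_subgroup_submodule: "submodule N R M \<Longrightarrow> abelian_subgroup N M"
  by (intro abelian_subgroupI3 additive_subgroup.intro submodule.axioms(1)) (auto intro: abelian_group_axioms)

lemma coset_eq_iff:
  assumes "submodule N R M" "x \<in> carrier M" "y \<in> carrier M"
  shows "N +>\<^bsub>M\<^esub> x = N +>\<^bsub>M\<^esub> y \<longleftrightarrow> x \<ominus>\<^bsub>M\<^esub> y \<in> N"
proof -
  interpret N: abelian_subgroup N M using assms(1) by (rule abelian_subgroup_submodule)
  have sub: "subgroup N (add_monoid M)" using assms(1) by (rule submodule.axioms(1))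
  have d: "x \<ominus>\<^bsub>M\<^esub> y \<in> carrier M" using assms by simp
  show ?thesis
  proof
    assume "N +>\<^bsub>M\<^esub> x = N +>\<^bsub>M\<^esub> y"
    then have "N +>\<^bsub>M\<^esub> (x \<oplus>\<^bsub>M\<^esub> \<ominus>\<^bsub>M\<^esub> y) = N"
      by (rule a_coset_add_inv2[OF _ assms(2,3) N.a_subset])
    then show "x \<ominus>\<^bsub>M\<^esub> y \<in> N"
      using a_coset_join1[OF _ d sub] by (simp add: a_minus_def)
  next
    assume "x \<ominus>\<^bsub>M\<^esub> y \<in> N"
    then have "N +>\<^bsub>M\<^esub> (x \<oplus>\<^bsub>M\<^esub> \<ominus>\<^bsub>M\<^esub> y) = N"
      using a_coset_join2[OF d sub] by (simp add: a_minus_def)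
    then show "N +>\<^bsub>M\<^esub> x = N +>\<^bsub>M\<^esub> y"
      by (rule a_coset_add_inv1[OF _ assms(2,3) N.a_subset])
  qed
qed

lemma mem_coset_iff:
  assumes "submodule N R M" "x \<in> carrier M"
  shows "y \<in> N +>\<^bsub>M\<^esub> x \<longleftrightarrow> y \<in> carrier M \<and> N +>\<^bsub>M\<^esub> y = N +>\<^bsub>M\<^esub> x"
proof -
  interpret N: abelian_subgroup N M using assms(1) by (rule abelian_subgroup_submodule)
  have sub: "subgroup N (add_monoid M)" using assms(1) by (rule submodule.axioms(1))
  show ?thesis
    using a_repr_independence[OF _ assms(2) sub] a_r_coset_subset_G[OF N.a_subset assms(2)] N.a_rcos_self
    by blast
qed

lemma quot_carrier: "carrier (quot_module M N) = (\<lambda>x. N +>\<^bsub>M\<^esub> x) ` carrier M"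
  by (auto simp: quot_module_def A_RCOSETS_def RCOSETS_def a_r_coset_def)

lemma quot_add:
  assumes "submodule N R M" "x \<in> carrier M" "y \<in> carrier M"
  shows "(N +>\<^bsub>M\<^esub> x) \<oplus>\<^bsub>quot_module M N\<^esub> (N +>\<^bsub>M\<^esub> y) = N +>\<^bsub>M\<^esub> (x \<oplus>\<^bsub>M\<^esub> y)"
proof -
  interpret N: abelian_subgroup N M using assms(1) by (rule abelian_subgroup_submodule)
  show ?thesis using assms by (simp add: quot_module_def N.a_rcos_sum)
qed

lemma quot_zero: "submodule N R M \<Longrightarrow> \<zero>\<^bsub>quot_module M N\<^esub> = N +>\<^bsub>M\<^esub> \<zero>\<^bsub>M\<^esub>"
  by (simp add: quot_module_def submodule_iff)

lemma quot_smult: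
  assumes "submodule N R M" "x \<in> carrier M" "r \<in> carrier R"
  shows "r \<odot>\<^bsub>quot_module M N\<^esub> (N +>\<^bsub>M\<^esub> x) = N +>\<^bsub>M\<^esub> (r \<odot>\<^bsub>M\<^esub> x)"
proof -
  have "(\<Union>y\<in>N +>\<^bsub>M\<^esub> x. N +>\<^bsub>M\<^esub> (r \<odot>\<^bsub>M\<^esub> y)) = N +>\<^bsub>M\<^esub> (r \<odot>\<^bsub>M\<^esub> x)"
  proof (rule UN_const_eq)
    show "N +>\<^bsub>M\<^esub> x \<noteq> {}" using mem_coset_iff[OF assms(1,2), of x] assms(2) by auto
    fix y assume "y \<in> N +>\<^bsub>M\<^esub> x"
    then have y: "y \<in> carrier M" "y \<ominus>\<^bsub>M\<^esub> x \<in> N"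
      using mem_coset_iff[OF assms(1,2), of y] coset_eq_iff[OF assms(1) _ assms(2), of y] by auto
    then have "r \<odot>\<^bsub>M\<^esub> (y \<ominus>\<^bsub>M\<^esub> x) \<in> N" using assms by (simp add: submodule_iff)
    then have "r \<odot>\<^bsub>M\<^esub> y \<ominus>\<^bsub>M\<^esub> r \<odot>\<^bsub>M\<^esub> x \<in> N"
      using y assms by (simp add: a_minus_def smult_r_distr smult_r_minus)
    then show "N +>\<^bsub>M\<^esub> (r \<odot>\<^bsub>M\<^esub> y) = N +>\<^bsub>M\<^esub> (r \<odot>\<^bsub>M\<^esub> x)"
      using y assms by (simp add: coset_eq_iff)
  qed
  then show ?thesis by (simp add: quot_module_def)
qed

lemma quot_is_module:
  assumes N: "submodule N R M"
  shows "module R (quot_module M N)"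
proof -
  note s = quot_carrier quot_add[OF N] quot_zero[OF N] quot_smult[OF N]
  show ?thesis
  proof (intro moduleI abelian_groupI)
    fix X assume "X \<in> carrier (quot_module M N)"
    then obtain x where x: "x \<in> carrier M" "X = N +>\<^bsub>M\<^esub> x" by (auto simp: s)
    then have "(N +>\<^bsub>M\<^esub> (\<ominus>\<^bsub>M\<^esub> x)) \<oplus>\<^bsub>quot_module M N\<^esub> X = \<zero>\<^bsub>quot_module M N\<^esub>"
      by (simp add: s l_neg)
    then show "\<exists>Y\<in>carrier (quot_module M N). Y \<oplus>\<^bsub>quot_module M N\<^esub> X = \<zero>\<^bsub>quot_module M N\<^esub>"
      using x by (intro bexI[of _ "N +>\<^bsub>M\<^esub> (\<ominus>\<^bsub>M\<^esub> x)"]) (auto simp: s(1))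
  qed (auto simp: s M.a_ac smult_l_distr smult_r_distr smult_assoc1 is_cring)
qed

lemma quot_hom: "submodule N R M \<Longrightarrow> (\<lambda>x. N +>\<^bsub>M\<^esub> x) \<in> module_hom R M (quot_module M N)"
  by (intro module_homI) (auto simp: quot_carrier quot_add quot_smult)

end

text \<open>Serves as an induction principle: a condition of the form \<open>h x \<in> L\<close>
  that holds on generators holds on their whole span.\<close>

lemma hom_preimage_submodule:
  assumes "module R M" "module R N" "h \<in> module_hom R M N" "submodule L R N"
  shows "submodule {x \<in> carrier M. h x \<in> L} R M"
proof -
  interpret M: module R M by fact
  interpret N: module R N by fact
  show ?thesis
    using assms(4) module_hom_zero[OF assms(1-3)]
    unfolding M.submodule_iff N.submodule_iff
    by (auto simp: module_hom_add[OF assms(3)] module_hom_smult[OF assms(3)])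
qed

lemma hom_image_submodule:
  assumes "module R M" "module R N" "h \<in> module_hom R M N" "submodule L R M"
  shows "submodule (h ` L) R N"
proof -
  interpret M: module R M by fact
  interpret N: module R N by fact
  have L: "L \<subseteq> carrier M" "\<zero>\<^bsub>M\<^esub> \<in> L" "\<And>x y. x \<in> L \<Longrightarrow> y \<in> L \<Longrightarrow> x \<oplus>\<^bsub>M\<^esub> y \<in> L"
    "\<And>r x. r \<in> carrier R \<Longrightarrow> x \<in> L \<Longrightarrow> r \<odot>\<^bsub>M\<^esub> x \<in> L"
    using assms(4) unfolding M.submodule_iff by auto
  show ?thesis
    unfolding N.submodule_iff
  proof (intro conjI ballI)
    show "h ` L \<subseteq> carrier N" using L module_hom_closed[OF assms(3)] by auto
    show "\<zero>\<^bsub>N\<^esub> \<in> h ` L" using L module_hom_zero[OF assms(1-3)] by (metis imageI)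
  next
    fix x y assume "x \<in> h ` L" "y \<in> h ` L"
    then obtain a b where "x = h a" "y = h b" "a \<in> L" "b \<in> L" by auto
    moreover have "h (a \<oplus>\<^bsub>M\<^esub> b) = h a \<oplus>\<^bsub>N\<^esub> h b"
      using calculation L by (intro module_hom_add[OF assms(3)]) auto
    ultimately show "x \<oplus>\<^bsub>N\<^esub> y \<in> h ` L" using L by (metis imageI)
  next
    fix r x assume r: "r \<in> carrier R" "x \<in> h ` L"
    then obtain a where "x = h a" "a \<in> L" by auto
    moreover have "h (r \<odot>\<^bsub>M\<^esub> a) = r \<odot>\<^bsub>N\<^esub> h a"
      using calculation L r by (intro module_hom_smult[OF assms(3)]) auto
    ultimately show "r \<odot>\<^bsub>N\<^esub> x \<in> h ` L" using L r by (metis imageI)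
  qed
qed

subsection \<open>Free modules\<close>

definition free_ext :: "('r, 'm, 'c) module_scheme \<Rightarrow> ('r, 'b) ring_scheme \<Rightarrow> ('s \<Rightarrow> 'm) \<Rightarrow> ('s \<Rightarrow> 'r) \<Rightarrow> 'm"
  where "free_ext M R \<psi> f = (\<Oplus>\<^bsub>M\<^esub>s\<in>{s. f s \<noteq> \<zero>\<^bsub>R\<^esub>}. f s \<odot>\<^bsub>M\<^esub> \<psi> s)"

context cring
begin

lemma free_carrier: "f \<in> carrier (free_module R S) \<longleftrightarrow>
    (\<forall>x. f x \<in> carrier R) \<and> (\<forall>x. f x \<noteq> \<zero> \<longrightarrow> x \<in> S) \<and> finite {x. f x \<noteq> \<zero>}"
proof -
  have "(\<forall>x. x \<notin> S \<longrightarrow> f x = \<zero>) \<Longrightarrow> f ` S \<subseteq> carrier R \<longleftrightarrow> (\<forall>x. f x \<in> carrier R)"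
    by (auto simp: image_subset_iff)
  then show ?thesis by (auto simp: free_module_def)
qed

lemma free_simps [simp]:
  "\<zero>\<^bsub>free_module R S\<^esub> = (\<lambda>_. \<zero>)"
  "f \<oplus>\<^bsub>free_module R S\<^esub> g = (\<lambda>x. f x \<oplus> g x)"
  "r \<odot>\<^bsub>free_module R S\<^esub> f = (\<lambda>x. r \<otimes> f x)"
  by (simp_all add: free_module_def)

lemma free_is_module: "module R (free_module R S)"
proof (intro moduleI abelian_groupI)
  show "cring R" by (rule is_cring)
next
  fix f g assume fg: "f \<in> carrier (free_module R S)" "g \<in> carrier (free_module R S)"
  have sub: "{x. f x \<oplus> g x \<noteq> \<zero>} \<subseteq> {x. f x \<noteq> \<zero>} \<union> {x. g x \<noteq> \<zero>}" by auto
  moreover have "finite ({x. f x \<noteq> \<zero>} \<union> {x. g x \<noteq> \<zero>})" "{x. f x \<noteq> \<zero>} \<union> {x. g x \<noteq> \<zero>} \<subseteq> S"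
    using fg by (auto simp: free_carrier)
  ultimately have "finite {x. f x \<oplus> g x \<noteq> \<zero>}" "{x. f x \<oplus> g x \<noteq> \<zero>} \<subseteq> S"
    using finite_subset by blast+
  then show "f \<oplus>\<^bsub>free_module R S\<^esub> g \<in> carrier (free_module R S)"
    using fg unfolding free_carrier free_simps by auto
next
  fix f assume f: "f \<in> carrier (free_module R S)"
  moreover have "{x. \<ominus> f x \<noteq> \<zero>} \<subseteq> {x. f x \<noteq> \<zero>}" by auto
  ultimately have "(\<lambda>x. \<ominus> f x) \<in> carrier (free_module R S)"
    unfolding free_carrier by (auto intro: finite_subset)
  then show "\<exists>g\<in>carrier (free_module R S). g \<oplus>\<^bsub>free_module R S\<^esub> f = \<zero>\<^bsub>free_module R S\<^esub>"
    using f by (intro bexI[of _ "\<lambda>x. \<ominus> f x"]) (auto simp: free_carrier l_neg)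
next
  fix r f assume f: "r \<in> carrier R" "f \<in> carrier (free_module R S)"
  then have sub: "{x. r \<otimes> f x \<noteq> \<zero>} \<subseteq> {x. f x \<noteq> \<zero>}" by auto
  moreover have "finite {x. f x \<noteq> \<zero>}" "{x. f x \<noteq> \<zero>} \<subseteq> S"
    using f by (auto simp: free_carrier)
  ultimately have "finite {x. r \<otimes> f x \<noteq> \<zero>}" "{x. r \<otimes> f x \<noteq> \<zero>} \<subseteq> S"
    using finite_subset by blast+
  then show "r \<odot>\<^bsub>free_module R S\<^esub> f \<in> carrier (free_module R S)"
    using f unfolding free_carrier free_simps by auto
qed (auto simp: free_carrier a_ac l_distr r_distr m_assoc)

lemma free_minus: "f \<in> carrier (free_module R S) \<Longrightarrow> \<ominus>\<^bsub>free_module R S\<^esub> f = (\<lambda>x. \<ominus> f x)"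
proof -
  assume f: "f \<in> carrier (free_module R S)"
  interpret F: module R "free_module R S" by (rule free_is_module)
  have "\<ominus>\<^bsub>free_module R S\<^esub> f = (\<ominus> \<one>) \<odot>\<^bsub>free_module R S\<^esub> f"
    using f F.smult_l_minus[of \<one> f] F.smult_one[OF f] by (simp del: free_simps)
  also have "\<dots> = (\<lambda>x. \<ominus> f x)" using f by (auto simp: free_carrier l_minus)
  finally show ?thesis .
qed

lemma basis_in_free: "s \<in> S \<Longrightarrow> basis R s \<in> carrier (free_module R S)"
proof -
  assume "s \<in> S"
  moreover have "{x. basis R s x \<noteq> \<zero>} \<subseteq> {s}" by (auto simp: basis_def)
  ultimately show ?thesis by (auto simp: free_carrier basis_def intro: finite_subset split: if_splits)
qed

lemma free_induct [consumes 1, case_names zero add]: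
  assumes "f \<in> carrier (free_module R S)" "P (\<lambda>_. \<zero>)"
    "\<And>r s g. r \<in> carrier R \<Longrightarrow> s \<in> S \<Longrightarrow> g \<in> carrier (free_module R S) \<Longrightarrow> P g \<Longrightarrow>
      P ((r \<odot>\<^bsub>free_module R S\<^esub> basis R s) \<oplus>\<^bsub>free_module R S\<^esub> g)"
  shows "P f"
proof -
  have "finite {x. f x \<noteq> \<zero>}" using assms by (simp add: free_carrier)
  then show ?thesis
    using assms(1)
  proof (induction "{x. f x \<noteq> \<zero>}" arbitrary: f rule: finite_induct)
    case empty
    then have "f = (\<lambda>_. \<zero>)" by auto
    then show ?case using assms(2) by simp
  next
    case (insert s F)
    let ?g = "f(s := \<zero>)"
    have F: "F = {x. ?g x \<noteq> \<zero>}" using insert(2,4) by auto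
    have s: "f s \<in> carrier R" "s \<in> S" using insert by (auto simp: free_carrier)
    have g: "?g \<in> carrier (free_module R S)"
      using insert.prems F insert.hyps(1) by (auto simp: free_carrier)
    have "f = (f s \<odot>\<^bsub>free_module R S\<^esub> basis R s) \<oplus>\<^bsub>free_module R S\<^esub> ?g"
      using insert.prems by (auto simp: basis_def free_carrier fun_eq_iff)
    then show ?case using assms(3)[OF s g insert.hyps(3)[OF F g]] by simp
  qed
qed

text \<open>The support of a sum or of a multiple can shrink, so linearity of
  \<open>free_ext\<close> is verified over a common finite set that contains all the supports
  involved.\<close>

lemma free_ext_superset:
  assumes "module R M" "\<psi> \<in> S \<rightarrow> carrier M" "f \<in> carrier (free_module R S)"
    "finite B" "{s. f s \<noteq> \<zero>} \<subseteq> B" "B \<subseteq> S"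
  shows "free_ext M R \<psi> f = (\<Oplus>\<^bsub>M\<^esub>s\<in>B. f s \<odot>\<^bsub>M\<^esub> \<psi> s)"
proof -
  interpret M: module R M by fact
  show ?thesis
    unfolding free_ext_def using assms(2-)
    by (intro M.M.add.finprod_mono_neutral_cong_left) (auto simp: free_carrier Pi_iff subset_iff)
qed

lemma free_ext_hom:
  assumes "module R M" "\<psi> \<in> S \<rightarrow> carrier M"
  shows "free_ext M R \<psi> \<in> module_hom R (free_module R S) M"
proof (rule module_homI)
  interpret M: module R M by fact
  interpret F: module R "free_module R S" by (rule free_is_module)
  fix f assume f: "f \<in> carrier (free_module R S)"
  have sf: "{s. f s \<noteq> \<zero>} \<subseteq> S" "finite {s. f s \<noteq> \<zero>}" using f by (auto simp: free_carrier)
  show "free_ext M R \<psi> f \<in> carrier M"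
    unfolding free_ext_def using f sf assms(2)
    by (intro M.M.finsum_closed) (auto simp: free_carrier Pi_iff)
  {
    fix r assume r: "r \<in> carrier R"
    have rf: "r \<odot>\<^bsub>free_module R S\<^esub> f \<in> carrier (free_module R S)"
      using f r by (rule F.smult_closed[rotated])
    have "free_ext M R \<psi> (r \<odot>\<^bsub>free_module R S\<^esub> f) = (\<Oplus>\<^bsub>M\<^esub>s\<in>{s. f s \<noteq> \<zero>}. (r \<odot>\<^bsub>free_module R S\<^esub> f) s \<odot>\<^bsub>M\<^esub> \<psi> s)"
      using r sf f by (intro free_ext_superset[OF assms rf]) (auto simp: free_carrier)
    also have "\<dots> = (\<Oplus>\<^bsub>M\<^esub>s\<in>{s. f s \<noteq> \<zero>}. r \<odot>\<^bsub>M\<^esub> (f s \<odot>\<^bsub>M\<^esub> \<psi> s))"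
      using r sf f assms(2) by (intro M.M.finsum_cong') (auto simp: free_carrier M.smult_assoc1 Pi_iff)
    also have "\<dots> = r \<odot>\<^bsub>M\<^esub> free_ext M R \<psi> f"
      unfolding free_ext_def using r sf f assms(2)
      by (intro M.finsum_smult_ldistr[symmetric]) (auto simp: free_carrier Pi_iff)
    finally show "free_ext M R \<psi> (r \<odot>\<^bsub>free_module R S\<^esub> f) = r \<odot>\<^bsub>M\<^esub> free_ext M R \<psi> f" .
  }
  fix g assume g: "g \<in> carrier (free_module R S)"
  let ?B = "{s. f s \<noteq> \<zero>} \<union> {s. g s \<noteq> \<zero>}"
  have B: "finite ?B" "?B \<subseteq> S" using f g by (auto simp: free_carrier)
  have fg: "f \<oplus>\<^bsub>free_module R S\<^esub> g \<in> carrier (free_module R S)" using f g by (rule F.a_closed)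
  have "free_ext M R \<psi> (f \<oplus>\<^bsub>free_module R S\<^esub> g) = (\<Oplus>\<^bsub>M\<^esub>s\<in>?B. (f \<oplus>\<^bsub>free_module R S\<^esub> g) s \<odot>\<^bsub>M\<^esub> \<psi> s)"
    using B by (intro free_ext_superset[OF assms fg]) auto
  also have "\<dots> = (\<Oplus>\<^bsub>M\<^esub>s\<in>?B. f s \<odot>\<^bsub>M\<^esub> \<psi> s \<oplus>\<^bsub>M\<^esub> g s \<odot>\<^bsub>M\<^esub> \<psi> s)"
    using f g B assms(2) by (intro M.M.finsum_cong') (auto simp: free_carrier M.smult_l_distr Pi_iff)
  also have "\<dots> = (\<Oplus>\<^bsub>M\<^esub>s\<in>?B. f s \<odot>\<^bsub>M\<^esub> \<psi> s) \<oplus>\<^bsub>M\<^esub> (\<Oplus>\<^bsub>M\<^esub>s\<in>?B. g s \<odot>\<^bsub>M\<^esub> \<psi> s)"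
    using f g B assms(2) by (intro M.M.finsum_addf) (auto simp: free_carrier Pi_iff)
  also have "\<dots> = free_ext M R \<psi> f \<oplus>\<^bsub>M\<^esub> free_ext M R \<psi> g"
    using B free_ext_superset[OF assms f, of ?B] free_ext_superset[OF assms g, of ?B] by auto
  finally show "free_ext M R \<psi> (f \<oplus>\<^bsub>free_module R S\<^esub> g) = free_ext M R \<psi> f \<oplus>\<^bsub>M\<^esub> free_ext M R \<psi> g" .
qed

lemma free_ext_basis:
  assumes "module R M" "\<psi> s \<in> carrier M"
  shows "free_ext M R \<psi> (basis R s) = \<psi> s"
proof -
  interpret M: module R M by fact
  have "free_ext M R \<psi> (basis R s) = (\<Oplus>\<^bsub>M\<^esub>t\<in>{s}. basis R s t \<odot>\<^bsub>M\<^esub> \<psi> t)"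
    using assms by (intro free_ext_superset[where S = "{s}"] basis_in_free) (auto simp: basis_def)
  also have "\<dots> = \<psi> s" using assms by (simp add: basis_def)
  finally show ?thesis .
qed

lemma free_hom_eqI:
  assumes "module R M" "h \<in> module_hom R (free_module R S) M" "k \<in> module_hom R (free_module R S) M"
    "\<And>s. s \<in> S \<Longrightarrow> h (basis R s) = k (basis R s)" "f \<in> carrier (free_module R S)"
  shows "h f = k f"
  using assms(5)
proof (induction rule: free_induct)
  case zero
  show ?case
    using module_hom_zero[OF free_is_module assms(1,2)] module_hom_zero[OF free_is_module assms(1,3)] by simp
next
  case (add r s g)
  interpret F: module R "free_module R S" by (rule free_is_module)
  have "r \<odot>\<^bsub>free_module R S\<^esub> basis R s \<in> carrier (free_module R S)"
    using add basis_in_free by (intro F.smult_closed) auto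
  then show ?case
    using add assms(4) basis_in_free[OF add(2)]
    by (simp add: module_hom_add[OF assms(2)] module_hom_add[OF assms(3)]
        module_hom_smult[OF assms(2)] module_hom_smult[OF assms(3)] del: free_simps)
qed

lemma free_map_superset:
  assumes "f \<in> carrier (free_module R S)" "finite B" "{x. f x \<noteq> \<zero>} \<subseteq> B"
  shows "free_map R \<phi> f y = (\<Oplus>x\<in>{x \<in> B. \<phi> x = y}. f x)"
  unfolding free_map_def using assms
  by (intro add.finprod_mono_neutral_cong_left) (auto simp: free_carrier)

lemma free_map_hom:
  assumes "\<phi> \<in> S \<rightarrow> S'"
  shows "free_map R \<phi> \<in> module_hom R (free_module R S) (free_module R S')"
proof (rule module_homI)
  interpret F: module R "free_module R S" by (rule free_is_module)
  fix f assume f: "f \<in> carrier (free_module R S)"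
  have sf: "{s. f s \<noteq> \<zero>} \<subseteq> S" "finite {s. f s \<noteq> \<zero>}" using f by (auto simp: free_carrier)
  have im: "y \<in> \<phi> ` {s. f s \<noteq> \<zero>}" if "free_map R \<phi> f y \<noteq> \<zero>" for y
  proof (rule ccontr)
    assume "y \<notin> \<phi> ` {s. f s \<noteq> \<zero>}"
    then have e: "{x. f x \<noteq> \<zero> \<and> \<phi> x = y} = {}" by auto
    show False using that unfolding free_map_def e by simp
  qed
  then have "{y. free_map R \<phi> f y \<noteq> \<zero>} \<subseteq> \<phi> ` {s. f s \<noteq> \<zero>}" by auto
  then have "finite {y. free_map R \<phi> f y \<noteq> \<zero>}" using sf finite_subset by blast
  moreover have "free_map R \<phi> f y \<in> carrier R" for y
    unfolding free_map_def using f by (intro finsum_closed) (auto simp: free_carrier)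
  ultimately show "free_map R \<phi> f \<in> carrier (free_module R S')"
    using im sf assms unfolding free_carrier by blast
  {
    fix r assume r: "r \<in> carrier R"
    have rf: "r \<odot>\<^bsub>free_module R S\<^esub> f \<in> carrier (free_module R S)"
      using f r by (rule F.smult_closed[rotated])
    show "free_map R \<phi> (r \<odot>\<^bsub>free_module R S\<^esub> f) = r \<odot>\<^bsub>free_module R S'\<^esub> free_map R \<phi> f"
    proof
      fix y
      have "free_map R \<phi> (r \<odot>\<^bsub>free_module R S\<^esub> f) y = (\<Oplus>x\<in>{x \<in> {s. f s \<noteq> \<zero>}. \<phi> x = y}. r \<otimes> f x)"
        using sf f r by (subst free_map_superset[OF rf, of "{s. f s \<noteq> \<zero>}"]) (auto simp: free_carrier)
      also have "\<dots> = r \<otimes> (\<Oplus>x\<in>{x \<in> {s. f s \<noteq> \<zero>}. \<phi> x = y}. f x)"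
        using sf f r by (intro finsum_rdistr[symmetric]) (auto simp: free_carrier)
      finally show "free_map R \<phi> (r \<odot>\<^bsub>free_module R S\<^esub> f) y = (r \<odot>\<^bsub>free_module R S'\<^esub> free_map R \<phi> f) y"
        by (simp add: free_map_def)
    qed
  }
  fix g assume g: "g \<in> carrier (free_module R S)"
  let ?B = "{s. f s \<noteq> \<zero>} \<union> {s. g s \<noteq> \<zero>}"
  have B: "finite ?B" using f g by (auto simp: free_carrier)
  have fg: "f \<oplus>\<^bsub>free_module R S\<^esub> g \<in> carrier (free_module R S)" using f g by (rule F.a_closed)
  show "free_map R \<phi> (f \<oplus>\<^bsub>free_module R S\<^esub> g) = free_map R \<phi> f \<oplus>\<^bsub>free_module R S'\<^esub> free_map R \<phi> g"
  proof
    fix y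
    have "free_map R \<phi> (f \<oplus>\<^bsub>free_module R S\<^esub> g) y = (\<Oplus>x\<in>{x \<in> ?B. \<phi> x = y}. f x \<oplus> g x)"
      by (subst free_map_superset[OF fg B]) auto
    also have "\<dots> = (\<Oplus>x\<in>{x \<in> ?B. \<phi> x = y}. f x) \<oplus> (\<Oplus>x\<in>{x \<in> ?B. \<phi> x = y}. g x)"
      using f g by (intro finsum_addf) (auto simp: free_carrier)
    also have "\<dots> = free_map R \<phi> f y \<oplus> free_map R \<phi> g y"
      using free_map_superset[OF f B, of \<phi> y] free_map_superset[OF g B, of \<phi> y] by simp
    finally show "free_map R \<phi> (f \<oplus>\<^bsub>free_module R S\<^esub> g) y
        = (free_map R \<phi> f \<oplus>\<^bsub>free_module R S'\<^esub> free_map R \<phi> g) y" by simp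
  qed
qed

lemma free_map_basis: "free_map R \<phi> (basis R s) = basis R (\<phi> s)"
proof
  fix y
  have "free_map R \<phi> (basis R s) y = (\<Oplus>x\<in>{x \<in> {s}. \<phi> x = y}. basis R s x)"
    by (rule free_map_superset[OF basis_in_free[of s "{s}"]]) (auto simp: basis_def)
  also have "{x \<in> {s}. \<phi> x = y} = (if \<phi> s = y then {s} else {})" by auto
  finally show "free_map R \<phi> (basis R s) y = basis R (\<phi> s) y"
    by (auto simp: basis_def)
qed

end

subsection \<open>Presented modules\<close>

abbreviation presented_class :: "('r, 'b) ring_scheme \<Rightarrow> 's set \<Rightarrow> ('s \<Rightarrow> 'r) set \<Rightarrow> ('s \<Rightarrow> 'r) \<Rightarrow> ('s \<Rightarrow> 'r) set"
  where "presented_class R S T f \<equiv> submodule_span R (free_module R S) T +>\<^bsub>free_module R S\<^esub> f"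

context cring
begin

lemma free_span_submodule:
  assumes "T \<subseteq> carrier (free_module R S)"
  shows "submodule (submodule_span R (free_module R S) T) R (free_module R S)"
proof -
  interpret F: module R "free_module R S" by (rule free_is_module)
  show ?thesis using assms by (rule F.submodule_span_submodule)
qed

lemma presented_is_module:
  assumes "T \<subseteq> carrier (free_module R S)"
  shows "module R (presented_module R S T)"
proof -
  interpret F: module R "free_module R S" by (rule free_is_module)
  show ?thesis unfolding presented_module_def by (rule F.quot_is_module[OF free_span_submodule[OF assms]])
qed

lemma presented_class_hom:
  assumes "T \<subseteq> carrier (free_module R S)"
  shows "presented_class R S T \<in> module_hom R (free_module R S) (presented_module R S T)"
proof -
  interpret F: module R "free_module R S" by (rule free_is_module)
  show ?thesis unfolding presented_module_def by (rule F.quot_hom[OF free_span_submodule[OF assms]])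
qed

lemma presented_carrier: "carrier (presented_module R S T) = presented_class R S T ` carrier (free_module R S)"
proof -
  interpret F: module R "free_module R S" by (rule free_is_module)
  show ?thesis unfolding presented_module_def by (rule F.quot_carrier)
qed

lemma presented_class_eq:
  assumes "T \<subseteq> carrier (free_module R S)" "f \<ominus>\<^bsub>free_module R S\<^esub> g \<in> submodule_span R (free_module R S) T"
    "f \<in> carrier (free_module R S)" "g \<in> carrier (free_module R S)"
  shows "presented_class R S T f = presented_class R S T g"
proof -
  interpret F: module R "free_module R S" by (rule free_is_module)
  show ?thesis using F.coset_eq_iff[OF free_span_submodule[OF assms(1)]] assms by auto
qed

text \<open>Since \<open>\<phi>\<close> carries relators into the span of the relators, the images
  of all representatives of a class lie in one coset, and the union in \<open>presented_map\<close>
  is that coset.\<close>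

lemma presented_map_class:
  assumes T: "T \<subseteq> carrier (free_module R S)" and T': "T' \<subseteq> carrier (free_module R S')"
    and \<phi>: "\<phi> \<in> S \<rightarrow> S'"
    and rel: "\<And>t. t \<in> T \<Longrightarrow> free_map R \<phi> t \<in> submodule_span R (free_module R S') T'"
    and f: "f \<in> carrier (free_module R S)"
  shows "presented_map R S' T' \<phi> (presented_class R S T f) = presented_class R S' T' (free_map R \<phi> f)"
proof -
  interpret F: module R "free_module R S" by (rule free_is_module)
  interpret F': module R "free_module R S'" by (rule free_is_module)
  note N = free_span_submodule[OF T] and N' = free_span_submodule[OF T']
  note h = free_map_hom[OF \<phi>]
  have "submodule_span R (free_module R S) T \<subseteq>
    {x \<in> carrier (free_module R S). free_map R \<phi> x \<in> submodule_span R (free_module R S') T'}"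
    using T rel by (intro F.submodule_span_least hom_preimage_submodule[OF F.module_axioms F'.module_axioms h N']) auto
  then have sub: "free_map R \<phi> x \<in> submodule_span R (free_module R S') T'"
    if "x \<in> submodule_span R (free_module R S) T" for x using that by auto
  show ?thesis
    unfolding presented_map_def
  proof (rule UN_const_eq)
    show "presented_class R S T f \<noteq> {}" using F.mem_coset_iff[OF N f, of f] f by auto
    fix g assume "g \<in> presented_class R S T f"
    then have g: "g \<in> carrier (free_module R S)"
      and gf: "g \<ominus>\<^bsub>free_module R S\<^esub> f \<in> submodule_span R (free_module R S) T"
      using F.mem_coset_iff[OF N f, of g] F.coset_eq_iff[OF N _ f, of g] by auto
    have "free_map R \<phi> (g \<ominus>\<^bsub>free_module R S\<^esub> f) = free_map R \<phi> g \<ominus>\<^bsub>free_module R S'\<^esub> free_map R \<phi> f"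
      using g f unfolding a_minus_def
      by (simp only: module_hom_add[OF h] F.M.a_inv_closed module_hom_minus[OF F.module_axioms F'.module_axioms h])
    then show "presented_class R S' T' (free_map R \<phi> g) = presented_class R S' T' (free_map R \<phi> f)"
      using sub[OF gf] g f module_hom_closed[OF h] by (intro presented_class_eq[OF T']) auto
  qed
qed

lemma presented_map_hom:
  assumes T: "T \<subseteq> carrier (free_module R S)" and T': "T' \<subseteq> carrier (free_module R S')"
    and \<phi>: "\<phi> \<in> S \<rightarrow> S'"
    and rel: "\<And>t. t \<in> T \<Longrightarrow> free_map R \<phi> t \<in> submodule_span R (free_module R S') T'"
  shows "presented_map R S' T' \<phi> \<in> module_hom R (presented_module R S T) (presented_module R S' T')"
proof (rule module_homI)
  interpret F: module R "free_module R S" by (rule free_is_module)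
  note p = presented_class_hom[OF T] and p' = presented_class_hom[OF T'] and h = free_map_hom[OF \<phi>]
  note ev = presented_map_class[OF T T' \<phi> rel]
  fix x assume "x \<in> carrier (presented_module R S T)"
  then obtain f where f: "x = presented_class R S T f" "f \<in> carrier (free_module R S)" by (auto simp: presented_carrier)
  show "presented_map R S' T' \<phi> x \<in> carrier (presented_module R S' T')"
    using f ev module_hom_closed[OF h] module_hom_closed[OF p'] by simp
  {
    fix r assume "r \<in> carrier R"
    then show "presented_map R S' T' \<phi> (r \<odot>\<^bsub>presented_module R S T\<^esub> x)
        = r \<odot>\<^bsub>presented_module R S' T'\<^esub> presented_map R S' T' \<phi> x"
      using f ev module_hom_closed[OF h] F.smult_closed
      by (simp add: module_hom_smult[OF p, symmetric] module_hom_smult[OF h] module_hom_smult[OF p', symmetric] del: free_simps)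
  }
  fix y assume "y \<in> carrier (presented_module R S T)"
  then obtain g where g: "y = presented_class R S T g" "g \<in> carrier (free_module R S)" by (auto simp: presented_carrier)
  show "presented_map R S' T' \<phi> (x \<oplus>\<^bsub>presented_module R S T\<^esub> y)
      = presented_map R S' T' \<phi> x \<oplus>\<^bsub>presented_module R S' T'\<^esub> presented_map R S' T' \<phi> y"
    using f g ev module_hom_closed[OF h] F.M.a_closed
    by (simp add: module_hom_add[OF p, symmetric] module_hom_add[OF h] module_hom_add[OF p', symmetric] del: free_simps)
qed

lemma presented_hom_eqI:
  assumes T: "T \<subseteq> carrier (free_module R S)" and M: "module R M"
    and h: "h \<in> module_hom R (presented_module R S T) M" "k \<in> module_hom R (presented_module R S T) M"
    and eq: "\<And>s. s \<in> S \<Longrightarrow> h (presented_class R S T (basis R s)) = k (presented_class R S T (basis R s))"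
    and x: "x \<in> carrier (presented_module R S T)"
  shows "h x = k x"
proof -
  obtain f where f: "x = presented_class R S T f" "f \<in> carrier (free_module R S)"
    using x by (auto simp: presented_carrier)
  show ?thesis unfolding f(1)
    using M module_hom_compose[OF presented_class_hom[OF T] h(1)] module_hom_compose[OF presented_class_hom[OF T] h(2)] eq f(2)
    by (rule free_hom_eqI)
qed

lemma presented_spanI:
  assumes T: "T \<subseteq> carrier (free_module R S)"
    and N: "submodule N R (presented_module R S T)" "\<And>s. s \<in> S \<Longrightarrow> presented_class R S T (basis R s) \<in> N"
  shows "carrier (presented_module R S T) \<subseteq> N"
proof -
  interpret F: module R "free_module R S" by (rule free_is_module)
  interpret P: module R "presented_module R S T" by (rule presented_is_module[OF T])
  note p = presented_class_hom[OF T]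
  have "presented_class R S T f \<in> N" if "f \<in> carrier (free_module R S)" for f
    using that
  proof (induction rule: free_induct)
    case zero
    then show ?case
      using N(1) module_hom_zero[OF F.module_axioms P.module_axioms p] by (simp add: P.submodule_iff)
  next
    case (add r s g)
    note b = basis_in_free[OF add(2)]
    show ?case
      using add N F.smult_closed[OF add(1) b] b
      by (simp add: module_hom_add[OF p] module_hom_smult[OF p] P.submodule_iff del: free_simps)
  qed
  then show ?thesis by (auto simp: presented_carrier)
qed

lemma ideal_iff: "ideal I R \<longleftrightarrow> I \<subseteq> carrier R \<and> \<zero> \<in> I \<and> (\<forall>x\<in>I. \<forall>y\<in>I. x \<oplus> y \<in> I) \<and>
    (\<forall>r\<in>carrier R. \<forall>x\<in>I. r \<otimes> x \<in> I)"
proof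
  assume "ideal I R"
  then interpret ideal I R .
  show "I \<subseteq> carrier R \<and> \<zero> \<in> I \<and> (\<forall>x\<in>I. \<forall>y\<in>I. x \<oplus> y \<in> I) \<and> (\<forall>r\<in>carrier R. \<forall>x\<in>I. r \<otimes> x \<in> I)"
    using a_subset I_l_closed by auto
next
  assume I: "I \<subseteq> carrier R \<and> \<zero> \<in> I \<and> (\<forall>x\<in>I. \<forall>y\<in>I. x \<oplus> y \<in> I) \<and> (\<forall>r\<in>carrier R. \<forall>x\<in>I. r \<otimes> x \<in> I)"
  have "\<ominus> x \<in> I" if "x \<in> I" for x
  proof -
    have "(\<ominus> \<one>) \<otimes> x \<in> I" "x \<in> carrier R" using I that by auto
    then show ?thesis by (simp add: l_minus)
  qed
  then have "subgroup I (add_monoid R)"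
    using I by (intro add.subgroupI) (auto simp: a_inv_def)
  moreover have "x \<otimes> r \<in> I" if "x \<in> I" "r \<in> carrier R" for x r
    using that I m_comm[of x r] by auto
  ultimately show "ideal I R" using I by (intro idealI ring_axioms) auto
qed

end

subsection \<open>Noetherian modules\<close>

text \<open>Induction on the generators by leading coefficients. For a new generator
  \<open>s\<close> and the span V of the old ones, the scalars r for which some r s + m with m in V
  lies in \<open>N\<close> form an ideal, which is finitely generated. Lifts of its generators,
  together with generators of the intersection of \<open>N\<close> and V, span \<open>N\<close>.
  Bounding \<open>N\<close> by the span of \<open>S\<close> makes the result applicable inside a
  tensor product over the category, where finite generation of the ambient module is not
  known.\<close>

lemma submodule_of_fin_gen:
  assumes R: "cring R" "noetherian_ring R" and M: "module R M"
    and S: "finite S" "S \<subseteq> carrier M" and N: "submodule N R M" "N \<subseteq> submodule_span R M S"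
  shows "\<exists>F. finite F \<and> F \<subseteq> N \<and> submodule_span R M F = N"
  using S N
proof (induction S arbitrary: N rule: finite_induct)
  interpret M: module R M by fact
  case empty
  have "submodule {\<zero>\<^bsub>M\<^esub>} R M" by (auto simp: M.submodule_iff)
  then have "N \<subseteq> {\<zero>\<^bsub>M\<^esub>}"
    using empty M.submodule_span_least[of "{\<zero>\<^bsub>M\<^esub>}" "{}"] by auto
  moreover have "N \<subseteq> submodule_span R M {}"
    using empty by auto
  moreover have "submodule_span R M {} \<subseteq> N"
    using empty by (intro M.submodule_span_least) auto
  ultimately show ?case by (intro exI[of _ "{}"]) auto
next
  interpret M: module R M by fact
  interpret NR: noetherian_ring R by fact
  case (insert s S)
  have s: "s \<in> carrier M" "S \<subseteq> carrier M" using insert by auto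
  let ?V = "submodule_span R M S"
  have V: "submodule ?V R M" using s by (intro M.submodule_span_submodule)
  note V' = V[unfolded M.submodule_iff] and N' = insert.prems(2)[unfolded M.submodule_iff]
  \<comment> \<open>Stated for every submodule \<open>L\<close> because it is used for
    \<open>N\<close> and again for the span of the chosen elements.\<close>
  have aux: "ideal {r \<in> carrier R. \<exists>m\<in>?V. r \<odot>\<^bsub>M\<^esub> s \<oplus>\<^bsub>M\<^esub> m \<in> L} R" if L: "submodule L R M" for L
    unfolding M.ideal_iff
  proof (intro conjI ballI)
    note L' = L[unfolded M.submodule_iff]
    show "\<zero>\<^bsub>R\<^esub> \<in> {r \<in> carrier R. \<exists>m\<in>?V. r \<odot>\<^bsub>M\<^esub> s \<oplus>\<^bsub>M\<^esub> m \<in> L}"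
      using L' V' s by (auto intro!: bexI[of _ "\<zero>\<^bsub>M\<^esub>"])
  next
    note L' = L[unfolded M.submodule_iff]
    fix x y assume "x \<in> {r \<in> carrier R. \<exists>m\<in>?V. r \<odot>\<^bsub>M\<^esub> s \<oplus>\<^bsub>M\<^esub> m \<in> L}"
      "y \<in> {r \<in> carrier R. \<exists>m\<in>?V. r \<odot>\<^bsub>M\<^esub> s \<oplus>\<^bsub>M\<^esub> m \<in> L}"
    then obtain m m' where x: "x \<in> carrier R" "y \<in> carrier R" "m \<in> ?V" "m' \<in> ?V"
      "x \<odot>\<^bsub>M\<^esub> s \<oplus>\<^bsub>M\<^esub> m \<in> L" "y \<odot>\<^bsub>M\<^esub> s \<oplus>\<^bsub>M\<^esub> m' \<in> L" by auto
    have "m \<in> carrier M" "m' \<in> carrier M" using x V' by auto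
    then have "(x \<oplus>\<^bsub>R\<^esub> y) \<odot>\<^bsub>M\<^esub> s \<oplus>\<^bsub>M\<^esub> (m \<oplus>\<^bsub>M\<^esub> m') = (x \<odot>\<^bsub>M\<^esub> s \<oplus>\<^bsub>M\<^esub> m) \<oplus>\<^bsub>M\<^esub> (y \<odot>\<^bsub>M\<^esub> s \<oplus>\<^bsub>M\<^esub> m')"
      using x s by (simp add: M.smult_l_distr M.M.a_ac)
    moreover have "(x \<odot>\<^bsub>M\<^esub> s \<oplus>\<^bsub>M\<^esub> m) \<oplus>\<^bsub>M\<^esub> (y \<odot>\<^bsub>M\<^esub> s \<oplus>\<^bsub>M\<^esub> m') \<in> L" using x L' by blast
    moreover have "m \<oplus>\<^bsub>M\<^esub> m' \<in> ?V" using x V' by blast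
    ultimately show "x \<oplus>\<^bsub>R\<^esub> y \<in> {r \<in> carrier R. \<exists>m\<in>?V. r \<odot>\<^bsub>M\<^esub> s \<oplus>\<^bsub>M\<^esub> m \<in> L}"
      using x(1,2) by (auto intro!: bexI[of _ "m \<oplus>\<^bsub>M\<^esub> m'"])
  next
    note L' = L[unfolded M.submodule_iff]
    fix r x assume r: "r \<in> carrier R" "x \<in> {r \<in> carrier R. \<exists>m\<in>?V. r \<odot>\<^bsub>M\<^esub> s \<oplus>\<^bsub>M\<^esub> m \<in> L}"
    then obtain m where x: "x \<in> carrier R" "m \<in> ?V" "x \<odot>\<^bsub>M\<^esub> s \<oplus>\<^bsub>M\<^esub> m \<in> L" by auto
    have "m \<in> carrier M" using x V' by auto
    then have "(r \<otimes>\<^bsub>R\<^esub> x) \<odot>\<^bsub>M\<^esub> s \<oplus>\<^bsub>M\<^esub> r \<odot>\<^bsub>M\<^esub> m = r \<odot>\<^bsub>M\<^esub> (x \<odot>\<^bsub>M\<^esub> s \<oplus>\<^bsub>M\<^esub> m)"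
      using x s r by (simp add: M.smult_r_distr M.smult_assoc1)
    moreover have "r \<odot>\<^bsub>M\<^esub> (x \<odot>\<^bsub>M\<^esub> s \<oplus>\<^bsub>M\<^esub> m) \<in> L" using x r L' by blast
    moreover have "r \<odot>\<^bsub>M\<^esub> m \<in> ?V" using x r V' by blast
    ultimately show "r \<otimes>\<^bsub>R\<^esub> x \<in> {r \<in> carrier R. \<exists>m\<in>?V. r \<odot>\<^bsub>M\<^esub> s \<oplus>\<^bsub>M\<^esub> m \<in> L}"
      using x(1) r(1) by (auto intro!: bexI[of _ "r \<odot>\<^bsub>M\<^esub> m"])
  qed auto
  have "submodule (N \<inter> ?V) R M" using N' V' by (auto simp: M.submodule_iff)
  from insert.IH[OF s(2) this] obtain F0 where F0: "finite F0" "F0 \<subseteq> N \<inter> ?V" "submodule_span R M F0 = N \<inter> ?V" by auto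
  obtain A where A: "A \<subseteq> carrier R" "finite A"
    "{r \<in> carrier R. \<exists>m\<in>?V. r \<odot>\<^bsub>M\<^esub> s \<oplus>\<^bsub>M\<^esub> m \<in> N} = Idl\<^bsub>R\<^esub> A"
    using NR.finetely_gen[OF aux[OF insert.prems(2)]] by auto
  have "\<exists>n\<in>N. \<exists>m\<in>?V. n = a \<odot>\<^bsub>M\<^esub> s \<oplus>\<^bsub>M\<^esub> m" if "a \<in> A" for a
  proof -
    have "a \<in> Idl\<^bsub>R\<^esub> A" using M.R.genideal_self[OF A(1)] that by auto
    then show ?thesis unfolding A(3)[symmetric] by blast
  qed
  then obtain n where n: "\<And>a. a \<in> A \<Longrightarrow> n a \<in> N \<and> (\<exists>m\<in>?V. n a = a \<odot>\<^bsub>M\<^esub> s \<oplus>\<^bsub>M\<^esub> m)" by metis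
  define F where "F = F0 \<union> n ` A"
  have FN: "F \<subseteq> N" using F0 n by (auto simp: F_def)
  let ?L = "submodule_span R M F"
  have L: "submodule ?L R M" using FN N' by (intro M.submodule_span_submodule) auto
  have LN: "?L \<subseteq> N" using FN insert.prems by (intro M.submodule_span_least) auto
  have "A \<subseteq> {r \<in> carrier R. \<exists>m\<in>?V. r \<odot>\<^bsub>M\<^esub> s \<oplus>\<^bsub>M\<^esub> m \<in> ?L}"
  proof
    fix a assume a: "a \<in> A"
    then obtain m where m: "m \<in> ?V" "n a = a \<odot>\<^bsub>M\<^esub> s \<oplus>\<^bsub>M\<^esub> m" using n by blast
    have "n a \<in> ?L" using M.submodule_span_incl[of F] a by (auto simp: F_def)
    with m show "a \<in> {r \<in> carrier R. \<exists>m\<in>?V. r \<odot>\<^bsub>M\<^esub> s \<oplus>\<^bsub>M\<^esub> m \<in> ?L}" using a A(1) by auto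
  qed
  then have I: "Idl\<^bsub>R\<^esub> A \<subseteq> {r \<in> carrier R. \<exists>m\<in>?V. r \<odot>\<^bsub>M\<^esub> s \<oplus>\<^bsub>M\<^esub> m \<in> ?L}"
    by (rule M.R.genideal_minimal[OF aux[OF L]])
  have W: "submodule {x \<in> carrier M. \<exists>r\<in>carrier R. \<exists>m\<in>?V. x = r \<odot>\<^bsub>M\<^esub> s \<oplus>\<^bsub>M\<^esub> m} R M" (is "submodule ?W R M")
    unfolding M.submodule_iff
  proof (intro conjI ballI)
    show "\<zero>\<^bsub>M\<^esub> \<in> ?W" using s V' by (auto intro!: bexI[of _ "\<zero>\<^bsub>R\<^esub>"] bexI[of _ "\<zero>\<^bsub>M\<^esub>"])
  next
    fix x y assume "x \<in> ?W" "y \<in> ?W"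
    then obtain p m q m' where x: "x = p \<odot>\<^bsub>M\<^esub> s \<oplus>\<^bsub>M\<^esub> m" "y = q \<odot>\<^bsub>M\<^esub> s \<oplus>\<^bsub>M\<^esub> m'"
      "p \<in> carrier R" "q \<in> carrier R" "m \<in> ?V" "m' \<in> ?V" by auto
    have m: "m \<in> carrier M" "m' \<in> carrier M" using x V' by auto
    then have "x \<oplus>\<^bsub>M\<^esub> y = (p \<oplus>\<^bsub>R\<^esub> q) \<odot>\<^bsub>M\<^esub> s \<oplus>\<^bsub>M\<^esub> (m \<oplus>\<^bsub>M\<^esub> m')"
      using x s by (simp add: M.smult_l_distr M.M.a_ac)
    moreover have "m \<oplus>\<^bsub>M\<^esub> m' \<in> ?V" using x V' by blast
    ultimately show "x \<oplus>\<^bsub>M\<^esub> y \<in> ?W" using x(3,4) m s by (auto intro!: bexI[of _ "p \<oplus>\<^bsub>R\<^esub> q"] bexI[of _ "m \<oplus>\<^bsub>M\<^esub> m'"])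
  next
    fix r x assume r: "r \<in> carrier R" "x \<in> ?W"
    then obtain p m where x: "x = p \<odot>\<^bsub>M\<^esub> s \<oplus>\<^bsub>M\<^esub> m" "p \<in> carrier R" "m \<in> ?V" by auto
    have m: "m \<in> carrier M" using x V' by auto
    then have "r \<odot>\<^bsub>M\<^esub> x = (r \<otimes>\<^bsub>R\<^esub> p) \<odot>\<^bsub>M\<^esub> s \<oplus>\<^bsub>M\<^esub> r \<odot>\<^bsub>M\<^esub> m"
      using x s r by (simp add: M.smult_r_distr M.smult_assoc1)
    moreover have "r \<odot>\<^bsub>M\<^esub> m \<in> ?V" using x r V' by blast
    ultimately show "r \<odot>\<^bsub>M\<^esub> x \<in> ?W"
      using x(2) r(1) m s by (auto intro!: bexI[of _ "r \<otimes>\<^bsub>R\<^esub> p"] bexI[of _ "r \<odot>\<^bsub>M\<^esub> m"])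
  qed auto
  have "insert s S \<subseteq> ?W"
  proof
    fix x assume "x \<in> insert s S"
    then consider "x = s" | "x \<in> S" by auto
    then show "x \<in> ?W"
    proof cases
      case 1
      then show ?thesis using s V' by (auto intro!: bexI[of _ "\<one>\<^bsub>R\<^esub>"] bexI[of _ "\<zero>\<^bsub>M\<^esub>"])
    next
      case 2
      then have "x \<in> ?V" "x \<in> carrier M" using M.submodule_span_incl[of S] s by auto
      then show ?thesis using s by (auto intro!: bexI[of _ "\<zero>\<^bsub>R\<^esub>"] bexI[of _ x])
    qed
  qed
  then have spW: "submodule_span R M (insert s S) \<subseteq> ?W" by (rule M.submodule_span_least[OF W])
  have "x \<in> ?L" if x: "x \<in> N" for x
  proof -
    obtain r m where rm: "r \<in> carrier R" "m \<in> ?V" "x = r \<odot>\<^bsub>M\<^esub> s \<oplus>\<^bsub>M\<^esub> m"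
      using x insert.prems(3) spW by blast
    then have "r \<in> Idl\<^bsub>R\<^esub> A" using A(3) x by blast
    then obtain m' where "m' \<in> ?V" "r \<odot>\<^bsub>M\<^esub> s \<oplus>\<^bsub>M\<^esub> m' \<in> ?L" using I by blast
    then obtain n where n: "n \<in> ?L" "m' \<in> ?V" "n = r \<odot>\<^bsub>M\<^esub> s \<oplus>\<^bsub>M\<^esub> m'" by blast
    have c: "m \<in> carrier M" "m' \<in> carrier M" "n \<in> carrier M" "x \<in> carrier M"
      using rm n V' N' x LN by auto
    have V2: "\<ominus>\<^bsub>M\<^esub> m' \<in> ?V" using n M.submoduleE(3)[OF V] by auto
    have L2: "\<ominus>\<^bsub>M\<^esub> n \<in> N" using n LN M.submoduleE(3)[OF insert.prems(2)] by auto
    \<comment> \<open>The elements \<open>x\<close> and \<open>n\<close> have the same coefficient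
      at \<open>s\<close>, so their difference lies in the span of the old generators, where the
      induction hypothesis applies.\<close>
    have "x \<ominus>\<^bsub>M\<^esub> n = m \<oplus>\<^bsub>M\<^esub> \<ominus>\<^bsub>M\<^esub> m'"
      using rm n c s by (simp add: a_minus_def M.M.minus_add M.M.a_ac M.M.r_neg M.M.r_neg1 M.M.r_neg2)
    moreover have "m \<oplus>\<^bsub>M\<^esub> \<ominus>\<^bsub>M\<^esub> m' \<in> ?V" using rm(2) V' V2 by blast
    moreover have "x \<ominus>\<^bsub>M\<^esub> n \<in> N" using x N' L2 unfolding a_minus_def by blast
    ultimately have "x \<ominus>\<^bsub>M\<^esub> n \<in> N \<inter> ?V" by simp
    then have "x \<ominus>\<^bsub>M\<^esub> n \<in> ?L"
      using F0(3) M.submodule_span_least[OF L, of F0] M.submodule_span_incl[of F] by (auto simp: F_def)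
    then have "(x \<ominus>\<^bsub>M\<^esub> n) \<oplus>\<^bsub>M\<^esub> n \<in> ?L" using n L by (auto simp: M.submodule_iff)
    moreover have "(x \<ominus>\<^bsub>M\<^esub> n) \<oplus>\<^bsub>M\<^esub> n = x" using c by (simp add: a_minus_def M.M.a_assoc M.M.l_neg)
    ultimately show ?thesis by simp
  qed
  then have "?L = N" using LN by auto
  moreover have "finite F" using F0 A by (auto simp: F_def)
  ultimately show ?case using FN by auto
qed

lemma (in module) fin_gen_quotI:
  assumes N: "submodule N R M" and S: "finite S" "S \<subseteq> carrier M"
    and gen: "\<And>x. x \<in> carrier M \<Longrightarrow> \<exists>b\<in>N. \<exists>y\<in>submodule_span R M S. x = b \<oplus>\<^bsub>M\<^esub> y"
  shows "fin_gen_module R (quot_module M N)"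
proof -
  interpret Q: module R "quot_module M N" by (rule quot_is_module[OF N])
  note h = quot_hom[OF N]
  let ?S = "(\<lambda>x. N +>\<^bsub>M\<^esub> x) ` S"
  have S': "?S \<subseteq> carrier (quot_module M N)" using S by (auto simp: quot_carrier)
  note sub = Q.submodule_span_submodule[OF S']
  have "submodule_span R M S \<subseteq> {x \<in> carrier M. N +>\<^bsub>M\<^esub> x \<in> submodule_span R (quot_module M N) ?S}"
    using S Q.submodule_span_incl[of ?S]
    by (intro submodule_span_least hom_preimage_submodule[OF module_axioms Q.module_axioms h sub]) auto
  moreover have "\<exists>y\<in>submodule_span R M S. X = N +>\<^bsub>M\<^esub> y" if X: "X \<in> carrier (quot_module M N)" for X
  proof -
    obtain x where x: "x \<in> carrier M" "X = N +>\<^bsub>M\<^esub> x" using X unfolding quot_carrier by blast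
    obtain b y where byy: "b \<in> N" "y \<in> submodule_span R M S" "x = b \<oplus>\<^bsub>M\<^esub> y" using gen[OF x(1)] by blast
    have "y \<in> carrier M" using byy submodule_span_subset[OF S(2)] by auto
    moreover have "x \<in> N +>\<^bsub>M\<^esub> y" using byy by (auto simp: a_r_coset_def')
    ultimately show ?thesis using mem_coset_iff[OF N, of y x] byy x by auto
  qed
  ultimately have "carrier (quot_module M N) \<subseteq> submodule_span R (quot_module M N) ?S" by auto
  moreover have "submodule_span R (quot_module M N) ?S \<subseteq> carrier (quot_module M N)"
    by (rule Q.submodule_span_subset[OF S'])
  ultimately show ?thesis unfolding fin_gen_module_def
    using S S' by (intro exI[of _ ?S]) auto
qed

text \<open>Fitted to \<open>homology\<close>, which replaces the carrier by the cycles before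
  dividing. Spans may be formed in the ambient module, since the generators already lie in
  \<open>Z\<close>.\<close>

lemma (in module) fin_gen_subquotI:
  assumes Z: "submodule Z R M" and B: "submodule B R M" "B \<subseteq> Z" and S: "finite S" "S \<subseteq> Z"
    and gen: "\<And>x. x \<in> Z \<Longrightarrow> \<exists>b\<in>B. \<exists>y\<in>submodule_span R M S. x = b \<oplus>\<^bsub>M\<^esub> y"
  shows "fin_gen_module R (quot_module (M\<lparr>carrier := Z\<rparr>) B)"
proof -
  interpret Z: module R "M\<lparr>carrier := Z\<rparr>" using submodule.submodule_is_module[OF Z module_axioms] .
  have Zc: "Z \<subseteq> carrier M" using Z by (simp add: submodule_iff)
  have iff: "submodule N R (M\<lparr>carrier := Z\<rparr>) \<longleftrightarrow> submodule N R M \<and> N \<subseteq> Z" for N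
    using Zc by (auto simp: submodule_iff Z.submodule_iff)
  have "submodule_span R M S \<subseteq> submodule_span R (M\<lparr>carrier := Z\<rparr>) S"
    using S Z.submodule_span_submodule[of S] Z.submodule_span_incl[of S]
    by (intro submodule_span_least) (auto simp: iff)
  then show ?thesis
    using gen S B by (intro Z.fin_gen_quotI) (fastforce simp: iff)+
qed

subsection \<open>Merging two letters\<close>

definition edges :: "nat \<Rightarrow> (nat \<times> nat) set"
  where "edges n = {(a, b). a \<le> n \<and> b \<le> n \<and> a \<noteq> b}"

text \<open>The fibre over \<open>fst p\<close> lists \<open>snd p\<close> right behind
  \<open>fst p\<close>, and the fibre over \<open>snd p\<close> is empty. Precomposition therefore
  rewrites a fibre by erasing \<open>snd p\<close> and reinserting it directly behind
  \<open>fst p\<close>. Beyond \<open>n\<close> the fibres must be empty, because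
  \<open>ds_hom\<close> constrains them at every index.\<close>

definition merge :: "nat \<Rightarrow> nat \<times> nat \<Rightarrow> ds_mor"
  where "merge n p = \<lparr>src = n, tgt = n, fn = (\<lambda>i\<in>{0..n}. if i = snd p then fst p else i),
    fib = (\<lambda>j. if j > n then [] else if j = fst p then [fst p, snd p] else if j = snd p then [] else [j])\<rparr>"

text \<open>For a morphism this is a disjoint union of directed paths, one along each ordered
  fibre.\<close>

definition adj :: "ds_mor \<Rightarrow> (nat \<times> nat) set"
  where "adj \<alpha> = {p. \<exists>j us vs. fib \<alpha> j = us @ [fst p, snd p] @ vs}"

lemma finite_edges [simp]: "finite (edges n)"
  by (rule finite_subset[of _ "{0..n} \<times> {0..n}"]) (auto simp: edges_def)

lemma ds_homD:
  assumes "\<alpha> \<in> ds_hom n m"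
  shows "src \<alpha> = n" "tgt \<alpha> = m" "fn \<alpha> \<in> {0..n} \<rightarrow>\<^sub>E {0..m}" "distinct (fib \<alpha> j)"
    "set (fib \<alpha> j) = {i \<in> {0..n}. fn \<alpha> i = j}"
  using assms by (auto simp: ds_hom_def)

lemma merge_hom: "p \<in> edges n \<Longrightarrow> merge n p \<in> ds_hom n n"
  by (cases p) (auto simp: merge_def ds_hom_def edges_def)

lemma concat_map_merge:
  assumes "set xs \<subseteq> {0..n}" "fst p \<notin> set xs" "snd p \<notin> set xs"
  shows "concat (map (fib (merge n p)) xs) = xs"
  using assms by (induction xs) (auto simp: merge_def)

text \<open>Together with \<open>merge_comp_adj\<close> this shows that precomposition with the
  merge of \<open>p\<close> is a projection of the morphisms out of [n] onto those in which
  \<open>p\<close> is adjacent.\<close>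

lemma adj_merge_comp:
  assumes "\<alpha> \<in> ds_hom n m" "p \<in> edges n"
  shows "p \<in> adj (ds_comp \<alpha> (merge n p))"
proof -
  obtain a b where p: "p = (a, b)" "a \<le> n" "b \<le> n" "a \<noteq> b" using assms(2) by (auto simp: edges_def)
  have "a \<in> set (fib \<alpha> (fn \<alpha> a))" using ds_homD(5)[OF assms(1)] p by auto
  then obtain us vs where "fib \<alpha> (fn \<alpha> a) = us @ a # vs" by (meson split_list)
  then have "fib (ds_comp \<alpha> (merge n p)) (fn \<alpha> a) =
      concat (map (fib (merge n p)) us) @ [a, b] @ concat (map (fib (merge n p)) vs)"
    using p by (simp add: ds_comp_def) (simp add: merge_def)
  then show ?thesis unfolding adj_def p(1) by auto
qed

lemma merge_comp_adj:
  assumes \<alpha>: "\<alpha> \<in> ds_hom n m" and p: "p \<in> edges n" "p \<in> adj \<alpha>"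
  shows "ds_comp \<alpha> (merge n p) = \<alpha>"
proof -
  note h = ds_homD[OF \<alpha>]
  obtain j us vs where w: "fib \<alpha> j = us @ [fst p, snd p] @ vs" using p(2) by (auto simp: adj_def)
  have fst: "fn \<alpha> (fst p) = j" "fn \<alpha> (snd p) = j" using h(5)[of j] w by auto
  have le: "fst p \<le> n" "snd p \<le> n" "fst p \<noteq> snd p" using p by (auto simp: edges_def)
  have "concat (map (fib (merge n p)) (fib \<alpha> i)) = fib \<alpha> i" for i
  proof (cases "i = j")
    case True
    have "set us \<subseteq> {0..n}" "set vs \<subseteq> {0..n}" "fst p \<notin> set us" "fst p \<notin> set vs"
      "snd p \<notin> set us" "snd p \<notin> set vs"
      using h(4)[of j] h(5)[of j] unfolding w by auto
    then show ?thesis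
      using le unfolding True w by (simp add: concat_map_merge) (simp add: merge_def)
  next
    case False
    then show ?thesis using h(5)[of i] fst by (intro concat_map_merge) auto
  qed
  moreover have "compose {0..n} (fn \<alpha>) (fn (merge n p)) = fn \<alpha>"
    using h(3) fst by (auto simp: compose_def merge_def fun_eq_iff PiE_iff extensional_def)
  ultimately show ?thesis
    using h(1) by (intro ds_mor.equality) (auto simp: ds_comp_def merge_def)
qed

lemma merge_idem: "p \<in> edges n \<Longrightarrow> ds_comp (merge n p) (merge n p) = merge n p"
proof (rule merge_comp_adj[OF merge_hom])
  assume "p \<in> edges n"
  then have "fib (merge n p) (fst p) = [] @ [fst p, snd p] @ []" by (auto simp: merge_def edges_def)
  then show "p \<in> adj (merge n p)" unfolding adj_def by blast
qed

lemma merge_commute: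
  assumes "p \<in> edges n" "q \<in> edges n" "\<not> clash p q"
  shows "ds_comp (merge n p) (merge n q) = ds_comp (merge n q) (merge n p)"
proof -
  obtain a b c d where pq: "p = (a, b)" "q = (c, d)" by (cases p, cases q)
  then have ne: "a \<noteq> b" "c \<noteq> d" "a \<noteq> c" "a \<noteq> d" "b \<noteq> c" "b \<noteq> d" "a \<le> n" "b \<le> n" "c \<le> n" "d \<le> n"
    using assms by (auto simp: edges_def clash_def)
  show ?thesis
    using ne unfolding pq
    by (intro ds_mor.equality) (auto simp: ds_comp_def merge_def compose_def fun_eq_iff)
qed

text \<open>Here an invariant element loses a letter. The map \<open>\<rho>\<close> closes the gap
  at \<open>b\<close> and \<open>\<iota>\<close> reopens it; \<open>q\<close> puts \<open>b\<close>
  in the place of \<open>a\<close>, and \<open>s\<close> misses \<open>b\<close>. The two letters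
  are distinct, so \<open>n\<close> is positive and \<open>n - 1\<close> is a true
  predecessor.\<close>

lemma merge_factor:
  assumes "p \<in> edges n"
  shows "\<exists>q\<in>ds_hom n (n - 1). \<exists>s\<in>ds_hom (n - 1) n. merge n p = ds_comp s q"
proof -
  obtain a b where p: "p = (a, b)" and ab: "a \<le> n" "b \<le> n" "a \<noteq> b"
    using assms by (auto simp: edges_def)
  define \<rho> where "\<rho> i = (if i < b then i else i - 1)" for i
  define \<iota> where "\<iota> k = (if k < b then k else Suc k)" for k
  have ri: "\<iota> (\<rho> i) = i" if "i \<noteq> b" for i using that by (auto simp: \<rho>_def \<iota>_def)
  have ir: "\<rho> (\<iota> k) = k" "\<iota> k \<noteq> b" for k by (auto simp: \<rho>_def \<iota>_def)
  have rn: "\<rho> i \<le> n - 1" if "i \<le> n" "i \<noteq> b" for i using that ab by (auto simp: \<rho>_def)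
  have inn: "\<iota> k \<le> n \<longleftrightarrow> k \<le> n - 1" for k using ab by (auto simp: \<iota>_def)
  have ninn: "n < \<iota> k \<longleftrightarrow> n - 1 < k" for k using inn[of k] by linarith
  have nrn: "n - 1 < \<rho> i \<longleftrightarrow> n < i" if "i \<noteq> b" for i using ninn[of "\<rho> i"] ri[OF that] by simp
  have req: "\<rho> i = k \<longleftrightarrow> i = \<iota> k" if "i \<noteq> b" for i k using ri[OF that] ir by auto
  define q where "q = \<lparr>src = n, tgt = n - 1, fn = (\<lambda>i\<in>{0..n}. if i = b then \<rho> a else \<rho> i),
    fib = (\<lambda>k. if k > n - 1 then [] else if \<iota> k = a then [a, b] else [\<iota> k])\<rparr>"
  define s where "s = \<lparr>src = n - 1, tgt = n, fn = (\<lambda>k\<in>{0..n-1}. \<iota> k),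
    fib = (\<lambda>i. if i > n \<or> i = b then [] else [\<rho> i])\<rparr>"
  have "q \<in> ds_hom n (n - 1)"
    using ab ir inn req rn by (auto simp: q_def ds_hom_def split: if_splits)
  moreover have "s \<in> ds_hom (n - 1) n"
    using ab rn by (auto simp: s_def ds_hom_def ir inn ninn ri split: if_splits)
  moreover have "merge n p = ds_comp s q"
    using ab ir ri rn nrn
    by (intro ds_mor.equality) (auto simp: merge_def ds_comp_def s_def q_def p compose_def fun_eq_iff)
  ultimately show ?thesis by blast
qed

subsection \<open>Functors\<close>

lemma contravariantD:
  assumes "contravariant R G"
  shows "module R (obj G n)" "\<alpha> \<in> ds_hom n m \<Longrightarrow> arr G \<alpha> \<in> module_hom R (obj G m) (obj G n)"
    "x \<in> carrier (obj G n) \<Longrightarrow> arr G (ds_id n) x = x"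
    "\<alpha> \<in> ds_hom n m \<Longrightarrow> \<beta> \<in> ds_hom m l \<Longrightarrow> x \<in> carrier (obj G l) \<Longrightarrow>
      arr G (ds_comp \<beta> \<alpha>) x = arr G \<alpha> (arr G \<beta> x)"
  using assms by (auto simp: contravariant_def)

lemma nat_transD:
  assumes "nat_trans R G H \<eta>"
  shows "\<eta> n \<in> module_hom R (obj G n) (obj H n)"
    "\<alpha> \<in> ds_hom n m \<Longrightarrow> x \<in> carrier (obj G m) \<Longrightarrow> \<eta> n (arr G \<alpha> x) = arr H \<alpha> (\<eta> m x)"
    "x \<in> carrier (obj G n) \<Longrightarrow> \<eta> n x \<in> carrier (obj H n)"
  using assms by (auto simp: nat_trans_def module_hom_def)

lemma arr_closed: "contravariant R G \<Longrightarrow> \<alpha> \<in> ds_hom n m \<Longrightarrow> x \<in> carrier (obj G m) \<Longrightarrow> arr G \<alpha> x \<in> carrier (obj G n)"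
  using contravariantD(2) module_hom_closed by metis

lemma nat_trans_comp:
  assumes "nat_trans R G H \<eta>" "nat_trans R H L \<theta>"
  shows "nat_trans R G L (\<lambda>n x. \<theta> n (\<eta> n x))"
  unfolding nat_trans_def
proof (intro conjI allI ballI)
  show "(\<lambda>x. \<theta> n (\<eta> n x)) \<in> module_hom R (obj G n) (obj L n)" for n
    using nat_transD(1)[OF assms(1)] nat_transD(1)[OF assms(2)] by (rule module_hom_compose)
  show "\<theta> n (\<eta> n (arr G \<alpha> x)) = arr L \<alpha> (\<theta> m (\<eta> m x))"
    if "\<alpha> \<in> ds_hom n m" "x \<in> carrier (obj G m)" for n m \<alpha> x
    using that assms by (simp add: nat_transD(2)[OF assms(1)] nat_transD(2)[OF assms(2)] nat_transD(3)[OF assms(1)])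
qed

lemma nat_trans_id: "contravariant R G \<Longrightarrow> nat_trans R G G (\<lambda>n x. x)"
  by (auto simp: nat_trans_def module_hom_def)

lemma nat_trans_zero:
  assumes G: "contravariant R G" and H: "contravariant R H"
  shows "nat_trans R G H (\<lambda>n x. \<zero>\<^bsub>obj H n\<^esub>)"
  unfolding nat_trans_def
proof (intro conjI allI ballI)
  fix n m \<alpha> assume a: "\<alpha> \<in> ds_hom n m"
  show "\<zero>\<^bsub>obj H n\<^esub> = arr H \<alpha> \<zero>\<^bsub>obj H m\<^esub>"
    by (rule module_hom_zero[OF contravariantD(1)[OF H] contravariantD(1)[OF H] contravariantD(2)[OF H a], symmetric])
next
  fix n
  interpret H: module R "obj H n" by (rule contravariantD(1)[OF H])
  show "(\<lambda>x. \<zero>\<^bsub>obj H n\<^esub>) \<in> module_hom R (obj G n) (obj H n)" by (intro module_homI) auto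
qed

lemma nat_trans_diff:
  assumes H: "contravariant R H" and \<eta>: "nat_trans R G H \<eta>" and \<theta>: "nat_trans R G H \<theta>"
  shows "nat_trans R G H (\<lambda>n x. \<eta> n x \<ominus>\<^bsub>obj H n\<^esub> \<theta> n x)"
  unfolding nat_trans_def
proof (intro conjI allI ballI)
  fix n m \<alpha> x assume a: "\<alpha> \<in> ds_hom n m" and x: "x \<in> carrier (obj G m)"
  interpret H: module R "obj H m" by (rule contravariantD(1)[OF H])
  note h = contravariantD(2)[OF H a]
  note c = nat_transD(3)[OF \<eta> x] nat_transD(3)[OF \<theta> x]
  show "\<eta> n (arr G \<alpha> x) \<ominus>\<^bsub>obj H n\<^esub> \<theta> n (arr G \<alpha> x) = arr H \<alpha> (\<eta> m x \<ominus>\<^bsub>obj H m\<^esub> \<theta> m x)"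
    using c by (simp add: nat_transD(2)[OF \<eta> a x] nat_transD(2)[OF \<theta> a x] a_minus_def module_hom_add[OF h]
        module_hom_minus[OF contravariantD(1)[OF H] contravariantD(1)[OF H] h])
next
  fix n
  interpret H: module R "obj H n" by (rule contravariantD(1)[OF H])
  note c = nat_transD(3)[OF \<eta>] nat_transD(3)[OF \<theta>]
  note h = nat_transD(1)[OF \<eta>] nat_transD(1)[OF \<theta>]
  show "(\<lambda>x. \<eta> n x \<ominus>\<^bsub>obj H n\<^esub> \<theta> n x) \<in> module_hom R (obj G n) (obj H n)"
    by (intro module_homI)
      (auto simp: c module_hom_add[OF h(1)] module_hom_add[OF h(2)] module_hom_smult[OF h(1)]
        module_hom_smult[OF h(2)] a_minus_def H.smult_r_distr H.smult_r_minus H.M.minus_add H.M.a_ac)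
qed

lemma const_functor_contravariant: "cring R \<Longrightarrow> contravariant R (const_functor R)"
  using const_functor_module[of R] unfolding contravariant_def
  by (auto simp: module_hom_def const_functor_def)

subsection \<open>Free functors\<close>

definition free_gens :: "(nat \<Rightarrow> 'l set) \<Rightarrow> nat \<Rightarrow> (ds_mor \<times> 'l) set"
  where "free_gens \<Gamma> n = {(\<alpha>, l). \<alpha> \<in> ds_hom n (tgt \<alpha>) \<and> l \<in> \<Gamma> (tgt \<alpha>)}"

text \<open>The direct sum of one representable R[Hom(-, [m])] for each label in
  \<open>\<Gamma> m\<close>. When the labels are elements of a functor \<open>P\<close>, this has
  exactly the type over which the test functor \<open>M\<close> in
  \<open>projective_functor P\<close> ranges.\<close>

definition free_functor :: "('r, 'b) ring_scheme \<Rightarrow> (nat \<Rightarrow> 'l set) \<Rightarrow> ('r, ds_mor \<times> 'l \<Rightarrow> 'r) ds_functor"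
  where "free_functor R \<Gamma> = \<lparr>obj = (\<lambda>n. free_module R (free_gens \<Gamma> n)),
    arr = (\<lambda>\<beta>. free_map R (\<lambda>(\<alpha>, l). (ds_comp \<alpha> \<beta>, l)))\<rparr>"

text \<open>The natural transformation out of a free functor that sends the generator
  \<open>(ds_id m, l)\<close> to \<open>y m l\<close>.\<close>

definition yoneda :: "('r, 'b) ring_scheme \<Rightarrow> ('r, 'm) ds_functor \<Rightarrow> (nat \<Rightarrow> 'l \<Rightarrow> 'm) \<Rightarrow>
    nat \<Rightarrow> (ds_mor \<times> 'l \<Rightarrow> 'r) \<Rightarrow> 'm"
  where "yoneda R G y n = free_ext (obj G n) R (\<lambda>(\<alpha>, l). arr G \<alpha> (y (tgt \<alpha>) l))"

lemma free_functor_simps [simp]: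
  "obj (free_functor R \<Gamma>) n = free_module R (free_gens \<Gamma> n)"
  "arr (free_functor R \<Gamma>) \<beta> = free_map R (\<lambda>(\<alpha>, l). (ds_comp \<alpha> \<beta>, l))"
  by (simp_all add: free_functor_def)

lemma tgt_ds_comp [simp]: "tgt (ds_comp \<beta> \<alpha>) = tgt \<beta>"
  by (simp add: ds_comp_def)

lemma free_gens_comp:
  "\<beta> \<in> ds_hom n m \<Longrightarrow> (\<lambda>(\<alpha>, l). (ds_comp \<alpha> \<beta>, l)) \<in> free_gens \<Gamma> m \<rightarrow> free_gens \<Gamma> n"
  by (auto simp: free_gens_def intro: ds_comp_in_hom)

lemma free_gens_id: "l \<in> \<Gamma> m \<Longrightarrow> (ds_id m, l) \<in> free_gens \<Gamma> m"
  using ds_id_in_hom[of m] by (auto simp: free_gens_def ds_id_def)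

lemma (in cring) free_functor_contravariant: "contravariant R (free_functor R \<Gamma>)"
  unfolding contravariant_def
proof (intro conjI allI ballI)
  show "module R (obj (free_functor R \<Gamma>) n)" for n by (simp add: free_is_module)
  show h: "arr (free_functor R \<Gamma>) \<alpha> \<in> module_hom R (obj (free_functor R \<Gamma>) m) (obj (free_functor R \<Gamma>) n)"
    if "\<alpha> \<in> ds_hom n m" for n m \<alpha>
    using that by (simp add: free_map_hom free_gens_comp)
  fix n f assume f: "f \<in> carrier (obj (free_functor R \<Gamma>) n)"
  have "arr (free_functor R \<Gamma>) (ds_id n) f = (\<lambda>x. x) f"
  proof (rule free_hom_eqI[where k = "\<lambda>x. x", OF free_is_module])
    show "arr (free_functor R \<Gamma>) (ds_id n) \<in> module_hom R (free_module R (free_gens \<Gamma> n)) (free_module R (free_gens \<Gamma> n))"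
      using h[OF ds_id_in_hom] by simp
    show "(\<lambda>x. x) \<in> module_hom R (free_module R (free_gens \<Gamma> n)) (free_module R (free_gens \<Gamma> n))"
      by (simp add: module_hom_def)
    show "arr (free_functor R \<Gamma>) (ds_id n) (basis R s) = basis R s" if "s \<in> free_gens \<Gamma> n" for s
      using that ds_comp_id_right by (cases s) (auto simp: free_map_basis free_gens_def)
  qed (use f in simp)
  then show "arr (free_functor R \<Gamma>) (ds_id n) f = f" .
next
  have h: "arr (free_functor R \<Gamma>) \<alpha> \<in> module_hom R (free_module R (free_gens \<Gamma> m)) (free_module R (free_gens \<Gamma> n))"
    if "\<alpha> \<in> ds_hom n m" for n m \<alpha>
    using that by (simp add: free_map_hom free_gens_comp)
  fix n m l \<alpha> \<beta> f
  assume a: "\<alpha> \<in> ds_hom n m" "\<beta> \<in> ds_hom m l" and f: "f \<in> carrier (obj (free_functor R \<Gamma>) l)"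
  show "arr (free_functor R \<Gamma>) (ds_comp \<beta> \<alpha>) f = arr (free_functor R \<Gamma>) \<alpha> (arr (free_functor R \<Gamma>) \<beta> f)"
  proof (rule free_hom_eqI[OF free_is_module h[OF ds_comp_in_hom[OF a]] module_hom_compose[OF h[OF a(2)] h[OF a(1)]]])
    show "arr (free_functor R \<Gamma>) (ds_comp \<beta> \<alpha>) (basis R s) = arr (free_functor R \<Gamma>) \<alpha> (arr (free_functor R \<Gamma>) \<beta> (basis R s))"
      if "s \<in> free_gens \<Gamma> l" for s
      using that ds_comp_assoc[OF a, of "fst s" "tgt (fst s)"]
      by (cases s) (auto simp: free_map_basis free_gens_def)
  qed (use f in simp)
qed

lemma (in cring) yoneda_hom:
  assumes G: "contravariant R G" and y: "\<And>m l. l \<in> \<Gamma> m \<Longrightarrow> y m l \<in> carrier (obj G m)"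
  shows "yoneda R G y n \<in> module_hom R (free_module R (free_gens \<Gamma> n)) (obj G n)"
  unfolding yoneda_def using y
  by (intro free_ext_hom contravariantD(1)[OF G]) (auto simp: free_gens_def intro: arr_closed[OF G])

lemma (in cring) yoneda_basis:
  assumes G: "contravariant R G" and y: "\<And>m l. l \<in> \<Gamma> m \<Longrightarrow> y m l \<in> carrier (obj G m)"
    and s: "(\<alpha>, l) \<in> free_gens \<Gamma> n"
  shows "yoneda R G y n (basis R (\<alpha>, l)) = arr G \<alpha> (y (tgt \<alpha>) l)"
  unfolding yoneda_def using y s
  by (subst free_ext_basis[OF contravariantD(1)[OF G]]) (auto simp: free_gens_def intro: arr_closed[OF G])

lemma (in cring) yoneda_nat_trans:
  assumes G: "contravariant R G" and y: "\<And>m l. l \<in> \<Gamma> m \<Longrightarrow> y m l \<in> carrier (obj G m)"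
  shows "nat_trans R (free_functor R \<Gamma>) G (yoneda R G y)"
  unfolding nat_trans_def
proof (intro conjI allI ballI)
  show "yoneda R G y n \<in> module_hom R (obj (free_functor R \<Gamma>) n) (obj G n)" for n
    using yoneda_hom[OF G, of \<Gamma>] y by simp
  fix n m \<alpha> f assume a: "\<alpha> \<in> ds_hom n m" and f: "f \<in> carrier (obj (free_functor R \<Gamma>) m)"
  show "yoneda R G y n (arr (free_functor R \<Gamma>) \<alpha> f) = arr G \<alpha> (yoneda R G y m f)"
  proof (rule free_hom_eqI[where h = "\<lambda>x. yoneda R G y n (arr (free_functor R \<Gamma>) \<alpha> x)"
        and k = "\<lambda>x. arr G \<alpha> (yoneda R G y m x)", OF contravariantD(1)[OF G]])
    show "(\<lambda>x. yoneda R G y n (arr (free_functor R \<Gamma>) \<alpha> x)) \<in> module_hom R (free_module R (free_gens \<Gamma> m)) (obj G n)"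
      using contravariantD(2)[OF free_functor_contravariant a, of \<Gamma>] yoneda_hom[where \<Gamma> = \<Gamma> and y = y and n = n, OF G y]
      unfolding free_functor_simps(1) by (rule module_hom_compose)
    show "(\<lambda>x. arr G \<alpha> (yoneda R G y m x)) \<in> module_hom R (free_module R (free_gens \<Gamma> m)) (obj G n)"
      using yoneda_hom[where \<Gamma> = \<Gamma> and y = y and n = m, OF G y] contravariantD(2)[OF G a] by (rule module_hom_compose)
    fix s assume "s \<in> free_gens \<Gamma> m"
    then obtain \<beta> l where s: "s = (\<beta>, l)" "(\<beta>, l) \<in> free_gens \<Gamma> m" by (cases s) auto
    have s': "(ds_comp \<beta> \<alpha>, l) \<in> free_gens \<Gamma> n" using funcset_mem[OF free_gens_comp[OF a, of \<Gamma>] s(2)] by simp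
    have b: "\<beta> \<in> ds_hom m (tgt \<beta>)" "y (tgt \<beta>) l \<in> carrier (obj G (tgt \<beta>))" "tgt (ds_comp \<beta> \<alpha>) = tgt \<beta>"
      using s y by (auto simp: free_gens_def ds_comp_def)
    show "yoneda R G y n (arr (free_functor R \<Gamma>) \<alpha> (basis R s)) = arr G \<alpha> (yoneda R G y m (basis R s))"
      using yoneda_basis[OF G, of \<Gamma> y] y s s' b contravariantD(4)[OF G a b(1)]
      by (simp add: free_map_basis)
  qed (use f in simp)
qed

lemma (in cring) yoneda_natural:
  assumes G: "contravariant R G" and H: "contravariant R H" and \<psi>: "nat_trans R G H \<psi>"
    and y: "\<And>m l. l \<in> \<Gamma> m \<Longrightarrow> y m l \<in> carrier (obj G m)"
    and f: "f \<in> carrier (free_module R (free_gens \<Gamma> n))"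
    and y': "\<And>m l. l \<in> \<Gamma> m \<Longrightarrow> \<psi> m (y m l) = y' m l"
  shows "\<psi> n (yoneda R G y n f) = yoneda R H y' n f"
proof (rule free_hom_eqI[where h = "\<lambda>x. \<psi> n (yoneda R G y n x)" and k = "yoneda R H y' n",
      OF contravariantD(1)[OF H] _ _ _ f])
  have c: "y' m l \<in> carrier (obj H m)" if "l \<in> \<Gamma> m" for m l
    using nat_transD(3)[OF \<psi> y[OF that]] y'[OF that] by simp
  show "(\<lambda>x. \<psi> n (yoneda R G y n x)) \<in> module_hom R (free_module R (free_gens \<Gamma> n)) (obj H n)"
    using yoneda_hom[where \<Gamma> = \<Gamma> and y = y and n = n, OF G y] nat_transD(1)[OF \<psi>] by (rule module_hom_compose)
  show "yoneda R H y' n \<in> module_hom R (free_module R (free_gens \<Gamma> n)) (obj H n)"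
    using yoneda_hom[OF H, of \<Gamma> y' n] c by auto
  fix s assume "s \<in> free_gens \<Gamma> n"
  then obtain \<beta> l where s: "s = (\<beta>, l)" "(\<beta>, l) \<in> free_gens \<Gamma> n" by (cases s) auto
  then have b: "\<beta> \<in> ds_hom n (tgt \<beta>)" "l \<in> \<Gamma> (tgt \<beta>)" by (auto simp: free_gens_def)
  show "\<psi> n (yoneda R G y n (basis R s)) = yoneda R H y' n (basis R s)"
    using yoneda_basis[OF G, of \<Gamma> y \<beta> l n] yoneda_basis[OF H, of \<Gamma> y' \<beta> l n] y c s b y'[OF b(2)]
      nat_transD(2)[OF \<psi> b(1)]
    by simp
qed

subsection \<open>The complex of a functor\<close>

text \<open>\<open>K\<close> is a family of subsets instead of a functor, so that kernels and images
  can be treated inside \<open>G\<close>. The zero value at clashing sets restricts the complex to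
  matchings.\<close>

definition invariants :: "('r, 'm) ds_functor \<Rightarrow> (nat \<Rightarrow> 'm set) \<Rightarrow> nat \<Rightarrow> (nat \<times> nat) set \<Rightarrow> 'm set"
  where "invariants G K n \<mu> = (if indep clash \<mu> then {x \<in> K n. \<forall>p\<in>\<mu>. arr G (merge n p) x = x} else {\<zero>\<^bsub>obj G n\<^esub>})"

definition acyclic_at :: "('r, 'm) ds_functor \<Rightarrow> (nat \<Rightarrow> 'm set) \<Rightarrow> nat \<Rightarrow> nat \<Rightarrow> bool"
  where "acyclic_at G K n j \<longleftrightarrow> acyclic_in (obj G n) (edges n) (invariants G K n) j"

definition subfunctor :: "('r, 'b) ring_scheme \<Rightarrow> ('r, 'm) ds_functor \<Rightarrow> (nat \<Rightarrow> 'm set) \<Rightarrow> bool"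
  where "subfunctor R G K \<longleftrightarrow> (\<forall>n. submodule (K n) R (obj G n)) \<and>
    (\<forall>n m. \<forall>\<alpha>\<in>ds_hom n m. \<forall>x\<in>K m. arr G \<alpha> x \<in> K n)"

lemma subfunctorD:
  assumes "subfunctor R G K"
  shows "submodule (K n) R (obj G n)" "\<alpha> \<in> ds_hom n m \<Longrightarrow> x \<in> K m \<Longrightarrow> arr G \<alpha> x \<in> K n"
  using assms by (auto simp: subfunctor_def)

lemma subfunctor_carrier: "contravariant R G \<Longrightarrow> subfunctor R G (\<lambda>n. carrier (obj G n))"
  by (auto simp: subfunctor_def contravariantD(1) module.carrier_is_submodule arr_closed)

lemma subfunctor_kernel:
  assumes G: "contravariant R G" and H: "contravariant R H" and \<psi>: "nat_trans R G H \<psi>"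
  shows "subfunctor R G (\<lambda>n. {x \<in> carrier (obj G n). \<psi> n x = \<zero>\<^bsub>obj H n\<^esub>})"
  unfolding subfunctor_def
proof (intro conjI allI ballI)
  fix n
  interpret H: module R "obj H n" by (rule contravariantD(1)[OF H])
  have "submodule {\<zero>\<^bsub>obj H n\<^esub>} R (obj H n)" by (auto simp: H.submodule_iff)
  from hom_preimage_submodule[OF contravariantD(1)[OF G] H.module_axioms nat_transD(1)[OF \<psi>] this]
  show "submodule {x \<in> carrier (obj G n). \<psi> n x = \<zero>\<^bsub>obj H n\<^esub>} R (obj G n)" by simp
next
  fix n m \<alpha> x assume a: "\<alpha> \<in> ds_hom n m" and x: "x \<in> {x \<in> carrier (obj G m). \<psi> m x = \<zero>\<^bsub>obj H m\<^esub>}"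
  then have "\<psi> n (arr G \<alpha> x) = arr H \<alpha> \<zero>\<^bsub>obj H m\<^esub>" using nat_transD(2)[OF \<psi> a, of x] by auto
  then show "arr G \<alpha> x \<in> {x \<in> carrier (obj G n). \<psi> n x = \<zero>\<^bsub>obj H n\<^esub>}"
    using x a arr_closed[OF G a] module_hom_zero[OF contravariantD(1)[OF H] contravariantD(1)[OF H] contravariantD(2)[OF H a]]
    by auto
qed

lemma invariants_submodule:
  assumes G: "contravariant R G" and K: "subfunctor R G K" and \<mu>: "\<mu> \<subseteq> edges n"
  shows "submodule (invariants G K n \<mu>) R (obj G n)"
proof -
  interpret M: module R "obj G n" by (rule contravariantD(1)[OF G])
  have Kn: "K n \<subseteq> carrier (obj G n)" "\<zero>\<^bsub>obj G n\<^esub> \<in> K n" "\<And>x y. x \<in> K n \<Longrightarrow> y \<in> K n \<Longrightarrow> x \<oplus>\<^bsub>obj G n\<^esub> y \<in> K n"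
    "\<And>r x. r \<in> carrier R \<Longrightarrow> x \<in> K n \<Longrightarrow> r \<odot>\<^bsub>obj G n\<^esub> x \<in> K n"
    using subfunctorD(1)[OF K, of n] unfolding M.submodule_iff by auto
  have h: "arr G (merge n p) \<in> module_hom R (obj G n) (obj G n)" if "p \<in> \<mu>" for p
    using that \<mu> by (intro contravariantD(2)[OF G] merge_hom) auto
  have "submodule {x \<in> K n. \<forall>p\<in>\<mu>. arr G (merge n p) x = x} R (obj G n)"
    unfolding M.submodule_iff
    using Kn module_hom_add[OF h] module_hom_smult[OF h] module_hom_zero[OF M.module_axioms M.module_axioms h]
    by (auto simp: subset_iff)
  moreover have "submodule {\<zero>\<^bsub>obj G n\<^esub>} R (obj G n)" by (auto simp: M.submodule_iff)
  ultimately show ?thesis by (simp add: invariants_def)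
qed

lemma indep_insertD: "indep cf (insert p \<mu>) \<Longrightarrow> indep cf \<mu>"
  by (auto simp: indep_def)

text \<open>Invariance under more pairs is the stronger condition, so taking a boundary does not
  leave the system of invariants.\<close>

lemma invariants_insert:
  assumes "subfunctor R G K" "contravariant R G" "\<mu> \<subseteq> edges n" "x \<in> invariants G K n (insert p \<mu>)"
  shows "x \<in> invariants G K n \<mu>"
proof (cases "indep clash (insert p \<mu>)")
  case True
  then show ?thesis using assms(4) indep_insertD[OF True] by (auto simp: invariants_def)
next
  case False
  interpret M: module R "obj G n" by (rule contravariantD(1)[OF assms(2)])
  show ?thesis
    using False assms(4) invariants_submodule[OF assms(2,1,3)] by (simp add: invariants_def M.submodule_iff split: if_splits)
qed

text \<open>All arrows act as the identity, so every element is invariant and the complex is the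
  matching complex of all ordered pairs of distinct letters. \<open>Suc n\<close> is the number of
  letters of [n].\<close>

lemma const_functor_acyclic:
  assumes R: "cring R" and n: "3 * j + 2 \<le> Suc n"
  shows "acyclic_at (const_functor R) (\<lambda>_. carrier R) n j"
proof -
  interpret M: module R "obj (const_functor R) n" by (rule const_functor_module[OF R])
  have "reducible clash j (edges n)"
    using n by (intro reducible_complete[of "{0..n}"]) (auto simp: edges_def)
  then have "independence_acyclic (obj (const_functor R) n) clash (edges n) j"
    using clash_sym by (intro M.M.reducible_imp_acyclic) auto
  moreover have "invariants (const_functor R) (\<lambda>_. carrier R) n =
      (\<lambda>\<mu>. if indep clash \<mu> then carrier (obj (const_functor R) n) else {\<zero>\<^bsub>obj (const_functor R) n\<^esub>})"
    by (auto simp: invariants_def const_functor_def fun_eq_iff)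
  ultimately show ?thesis by (simp add: acyclic_at_def independence_acyclic_def)
qed

lemma signed_hom:
  assumes "module R M" "module R N" "h \<in> module_hom R M N" "x \<in> carrier M"
  shows "h (signed M p \<mu> x) = signed N p \<mu> (h x)"
  using module_hom_minus[OF assms] by (simp add: signed_def)

lemma bd_hom:
  assumes "module R M" "module R N" "h \<in> module_hom R M N" "finite E" "\<And>\<mu>. z \<mu> \<in> carrier M"
  shows "h (bd M E z \<mu>) = bd N E (\<lambda>\<mu>. h (z \<mu>)) \<mu>"
proof -
  interpret M: module R M by fact
  interpret N: module R N by fact
  have "h (bd M E z \<mu>) = (\<Oplus>\<^bsub>N\<^esub>p\<in>E - \<mu>. h (signed M p \<mu> (z (insert p \<mu>))))"
    unfolding bd_def using assms by (intro module_hom_finsum) auto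
  also have "\<dots> = bd N E (\<lambda>\<mu>. h (z \<mu>)) \<mu>"
    unfolding bd_def using assms module_hom_closed[OF assms(3)]
    by (intro N.M.finsum_cong') (auto simp: signed_hom[OF assms(1-3)])
  finally show ?thesis .
qed

text \<open>Merging along \<open>p\<close> projects onto the invariants, and these projections commute for disjoint pairs,
  so passing to invariants is exact.\<close>

lemma invariants_lift:
  assumes G: "contravariant R G" and H: "contravariant R H" and \<psi>: "nat_trans R G H \<psi>"
    and \<mu>: "finite \<mu>" "\<mu> \<subseteq> edges n" "indep clash \<mu>"
    and x: "x \<in> \<psi> n ` carrier (obj G n)" "\<And>p. p \<in> \<mu> \<Longrightarrow> arr H (merge n p) x = x"
  shows "\<exists>v\<in>carrier (obj G n). \<psi> n v = x \<and> (\<forall>p\<in>\<mu>. arr G (merge n p) v = v)"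
  using \<mu> x(2)
proof (induction \<mu> rule: finite_induct)
  case empty
  then show ?case using x(1) by auto
next
  case (insert q \<mu>)
  have "\<exists>v\<in>carrier (obj G n). \<psi> n v = x \<and> (\<forall>p\<in>\<mu>. arr G (merge n p) v = v)"
    using insert.prems by (intro insert.IH) (auto dest: indep_insertD)
  then obtain v where v: "v \<in> carrier (obj G n)" "\<psi> n v = x" "\<And>p. p \<in> \<mu> \<Longrightarrow> arr G (merge n p) v = v" by auto
  have q: "merge n q \<in> ds_hom n n" using insert.prems by (auto intro: merge_hom)
  \<comment> \<open>Projecting \<open>v\<close> by the merge of \<open>q\<close> does not change its
    image, because \<open>x\<close> is already invariant under \<open>q\<close>.\<close>
  let ?w = "arr G (merge n q) v"
  have "arr G (merge n p) ?w = ?w" if p: "p \<in> insert q \<mu>" for p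
  proof -
    have ph: "merge n p \<in> ds_hom n n" using p insert.prems by (auto intro: merge_hom)
    have "arr G (merge n p) ?w = arr G (ds_comp (merge n q) (merge n p)) v"
      using contravariantD(4)[OF G ph q v(1)] by simp
    also have "\<dots> = ?w"
    proof (cases "p = q")
      case True
      then show ?thesis using merge_idem[of q n] insert.prems by auto
    next
      case False
      then have "\<not> clash q p" "p \<in> \<mu>" using p insert.prems by (auto simp: indep_def)
      then have "ds_comp (merge n q) (merge n p) = ds_comp (merge n p) (merge n q)"
        using p insert.prems by (intro merge_commute) auto
      then show ?thesis using contravariantD(4)[OF G q ph v(1)] v(3)[OF \<open>p \<in> \<mu>\<close>] by simp
    qed
    finally show ?thesis .
  qed
  moreover have "\<psi> n ?w = x" using nat_transD(2)[OF \<psi> q v(1)] v(2) insert.prems by simp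
  moreover have "?w \<in> carrier (obj G n)" using arr_closed[OF G q v(1)] .
  ultimately show ?case by blast
qed

text \<open>This is one step of the long exact homology sequence.\<close>

lemma acyclic_at_kernel:
  assumes G: "contravariant R G" and H: "contravariant R H" and \<psi>: "nat_trans R G H \<psi>"
    and aG: "acyclic_at G (\<lambda>n. carrier (obj G n)) n j"
    and aH: "acyclic_at H (\<lambda>n. \<psi> n ` carrier (obj G n)) n (Suc j)"
  shows "acyclic_at G (\<lambda>n. {x \<in> carrier (obj G n). \<psi> n x = \<zero>\<^bsub>obj H n\<^esub>}) n j"
  unfolding acyclic_at_def acyclic_in_def
proof (intro ballI impI)
  let ?K = "\<lambda>n. {x \<in> carrier (obj G n). \<psi> n x = \<zero>\<^bsub>obj H n\<^esub>}"
  let ?C = "\<lambda>n. carrier (obj G n)"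
  let ?I = "\<lambda>n. \<psi> n ` carrier (obj G n)"
  let ?E = "edges n"
  interpret M: module R "obj G n" by (rule contravariantD(1)[OF G])
  interpret N: module R "obj H n" by (rule contravariantD(1)[OF H])
  note h = nat_transD(1)[OF \<psi>, of n]
  note mods = M.module_axioms N.module_axioms h
  note sC = subfunctor_carrier[OF G]
  fix z assume z: "z \<in> chains (obj G n) ?E (invariants G ?K n) j" and bz: "\<forall>\<mu>\<subseteq>?E. bd (obj G n) ?E z \<mu> = \<zero>\<^bsub>obj G n\<^esub>"
  have famKC: "invariants G ?K n \<mu> \<subseteq> invariants G ?C n \<mu>" for \<mu> by (auto simp: invariants_def)
  have famC: "invariants G ?C n \<mu> \<subseteq> ?C n" for \<mu> by (auto simp: invariants_def)
  have "z \<in> chains (obj G n) ?E (invariants G ?C n) j"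
    using z famKC unfolding chains_def by (auto split: if_splits)
  then obtain y where y: "y \<in> chains (obj G n) ?E (invariants G ?C n) (Suc j)"
      "\<And>\<mu>. \<mu> \<subseteq> ?E \<Longrightarrow> bd (obj G n) ?E y \<mu> = z \<mu>"
    using aG bz unfolding acyclic_at_def acyclic_in_def by blast
  have yc: "y \<mu> \<in> ?C n" for \<mu>
    using y(1) famC[of \<mu>] unfolding chains_def by (auto split: if_splits dest!: spec[of _ \<mu>])
  \<comment> \<open>The chain \<open>y\<close> bounds \<open>z\<close> in \<open>G\<close> but need
    not lie in the kernel. Its image is the obstruction, and it is a cycle because \<open>z\<close>
    maps to zero.\<close>
  define w0 where "w0 \<mu> = \<psi> n (y \<mu>)" for \<mu>
  have w0c: "w0 \<mu> \<in> carrier (obj H n)" for \<mu> using yc h by (auto simp: w0_def module_hom_closed)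
  have psi0: "\<psi> n \<zero>\<^bsub>obj G n\<^esub> = \<zero>\<^bsub>obj H n\<^esub>" by (rule module_hom_zero[OF mods])
  have "w0 \<mu> \<in> invariants H ?I n \<mu>" if "\<mu> \<subseteq> ?E" "card \<mu> = Suc j" for \<mu>
  proof -
    have "y \<mu> \<in> invariants G ?C n \<mu>" using y(1) that by (auto simp: chains_def)
    moreover have "arr H (merge n p) (\<psi> n (y \<mu>)) = \<psi> n (arr G (merge n p) (y \<mu>))" if "p \<in> \<mu>" for p
      using that \<open>\<mu> \<subseteq> ?E\<close> yc by (intro nat_transD(2)[OF \<psi>, symmetric] merge_hom) auto
    ultimately show ?thesis using psi0 by (auto simp: invariants_def w0_def split: if_splits)
  qed
  moreover have "w0 \<mu> = \<zero>\<^bsub>obj H n\<^esub>" if "\<not> (\<mu> \<subseteq> ?E \<and> card \<mu> = Suc j)" for \<mu>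
  proof -
    have "y \<mu> = \<zero>\<^bsub>obj G n\<^esub>" using y(1) that unfolding chains_def by (auto dest!: spec[of _ \<mu>] split: if_splits)
    then show ?thesis using psi0 by (simp add: w0_def)
  qed
  ultimately have w0: "w0 \<in> chains (obj H n) ?E (invariants H ?I n) (Suc j)" by (auto simp: chains_def)
  have bdy: "\<psi> n (bd (obj G n) ?E y \<mu>) = bd (obj H n) ?E (\<lambda>\<mu>. \<psi> n (y \<mu>)) \<mu>" for \<mu>
    by (rule bd_hom[OF mods]) (auto intro: yc)
  have "bd (obj H n) ?E w0 \<mu> = \<zero>\<^bsub>obj H n\<^esub>" if "\<mu> \<subseteq> ?E" for \<mu>
  proof -
    have "bd (obj H n) ?E w0 \<mu> = \<psi> n (z \<mu>)"
      unfolding w0_def using bdy[of \<mu>] y(2)[OF that] by simp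
    also have "\<dots> = \<zero>\<^bsub>obj H n\<^esub>"
      using z psi0 unfolding chains_def by (auto dest!: spec[of _ \<mu>] split: if_splits simp: invariants_def)
    finally show ?thesis .
  qed
  then obtain w where w: "w \<in> chains (obj H n) ?E (invariants H ?I n) (Suc (Suc j))"
      "\<And>\<mu>. \<mu> \<subseteq> ?E \<Longrightarrow> bd (obj H n) ?E w \<mu> = w0 \<mu>"
    using aH w0 unfolding acyclic_at_def acyclic_in_def by blast
  \<comment> \<open>The bounding chain is lifted coefficient by coefficient to invariant elements;
    this is where exactness of passing to invariants enters.\<close>
  have "\<exists>v. v \<in> invariants G ?C n \<mu> \<and> \<psi> n v = w \<mu>" if mu: "\<mu> \<subseteq> ?E" "card \<mu> = Suc (Suc j)" for \<mu>
  proof -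
    have wm: "w \<mu> \<in> invariants H ?I n \<mu>" using w(1) mu by (auto simp: chains_def)
    show ?thesis
    proof (cases "indep clash \<mu>")
      case True
      have "\<exists>v\<in>?C n. \<psi> n v = w \<mu> \<and> (\<forall>p\<in>\<mu>. arr G (merge n p) v = v)"
        using wm True finite_subset[OF mu(1) finite_edges]
        by (intro invariants_lift[OF G H \<psi> _ mu(1) True]) (auto simp: invariants_def)
      then show ?thesis using True by (auto simp: invariants_def)
    next
      case False
      then show ?thesis using wm psi0 by (intro exI[of _ "\<zero>\<^bsub>obj G n\<^esub>"]) (auto simp: invariants_def)
    qed
  qed
  then obtain v0 where v0: "\<And>\<mu>. \<mu> \<subseteq> ?E \<Longrightarrow> card \<mu> = Suc (Suc j) \<Longrightarrow> v0 \<mu> \<in> invariants G ?C n \<mu> \<and> \<psi> n (v0 \<mu>) = w \<mu>"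
    by metis
  define v where "v \<mu> = (if \<mu> \<subseteq> ?E \<and> card \<mu> = Suc (Suc j) then v0 \<mu> else \<zero>\<^bsub>obj G n\<^esub>)" for \<mu>
  have vc: "v \<mu> \<in> ?C n" for \<mu> using v0[of \<mu>] famC[of \<mu>] by (auto simp: v_def)
  have vw: "\<psi> n (v \<mu>) = w \<mu>" for \<mu>
    using v0[of \<mu>] psi0 w(1) by (auto simp: v_def chains_def)
  have bdv: "\<psi> n (bd (obj G n) ?E v \<mu>) = bd (obj H n) ?E (\<lambda>\<mu>. \<psi> n (v \<mu>)) \<mu>" for \<mu>
    by (rule bd_hom[OF mods]) (auto intro: vc)
  have bbv: "bd (obj G n) ?E (bd (obj G n) ?E v) \<mu> = \<zero>\<^bsub>obj G n\<^esub>" if "\<mu> \<subseteq> ?E" for \<mu>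
    by (intro M.M.bd_bd) (use vc that in auto)
  have bvc: "bd (obj G n) ?E v \<mu> \<in> ?C n" for \<mu> using vc by auto
  \<comment> \<open>Subtracting the boundary of the lift kills the obstruction, and it does not
    affect the boundary of \<open>y\<close> since the boundary squares to zero.\<close>
  define y' where "y' \<mu> = y \<mu> \<oplus>\<^bsub>obj G n\<^esub> \<ominus>\<^bsub>obj G n\<^esub> bd (obj G n) ?E v \<mu>" for \<mu>
  have psiy': "\<psi> n (y' \<mu>) = \<zero>\<^bsub>obj H n\<^esub>" if "\<mu> \<subseteq> ?E" for \<mu>
  proof -
    have "\<psi> n (y' \<mu>) = w0 \<mu> \<oplus>\<^bsub>obj H n\<^esub> \<ominus>\<^bsub>obj H n\<^esub> bd (obj H n) ?E (\<lambda>\<mu>. \<psi> n (v \<mu>)) \<mu>"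
      unfolding y'_def w0_def using yc bvc bdv[of \<mu>]
      by (simp add: module_hom_add[OF h] module_hom_minus[OF mods])
    also have "\<dots> = \<zero>\<^bsub>obj H n\<^esub>" using w(2)[OF that] w0c by (simp add: vw N.M.r_neg)
    finally show ?thesis .
  qed
  have "y' \<mu> \<in> invariants G ?K n \<mu>" if mu: "\<mu> \<subseteq> ?E" "card \<mu> = Suc j" for \<mu>
  proof -
    have fm: "submodule (invariants G ?C n \<mu>) R (obj G n)" by (rule invariants_submodule[OF G sC mu(1)])
    have sgn: "signed (obj G n) p \<mu> x \<in> invariants G ?C n \<mu>" if "x \<in> invariants G ?C n \<mu>" for p x
      using that M.submoduleE(3)[OF fm] by (simp add: signed_def)
    have "v (insert p \<mu>) \<in> invariants G ?C n \<mu>" if p: "p \<in> ?E - \<mu>" for p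
    proof -
      have "insert p \<mu> \<subseteq> ?E" "card (insert p \<mu>) = Suc (Suc j)"
        using p mu finite_subset[OF mu(1) finite_edges] by auto
      then have "v (insert p \<mu>) \<in> invariants G ?C n (insert p \<mu>)" using v0 by (simp add: v_def)
      then show ?thesis by (rule invariants_insert[OF sC G mu(1)])
    qed
    then have "bd (obj G n) ?E v \<mu> \<in> invariants G ?C n \<mu>"
      unfolding bd_def using sgn by (intro M.finsum_in_submodule[OF fm]) auto
    moreover have "y \<mu> \<in> invariants G ?C n \<mu>" using y(1) mu by (auto simp: chains_def)
    ultimately have "y' \<mu> \<in> invariants G ?C n \<mu>"
      unfolding y'_def using M.submoduleE(3,5)[OF fm] by blast
    then show ?thesis using psiy'[OF mu(1)] by (auto simp: invariants_def split: if_splits)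
  qed
  moreover have "y' \<mu> = \<zero>\<^bsub>obj G n\<^esub>" if mu: "\<not> (\<mu> \<subseteq> ?E \<and> card \<mu> = Suc j)" for \<mu>
  proof -
    have "v (insert p \<mu>) = \<zero>\<^bsub>obj G n\<^esub>" if "p \<in> ?E - \<mu>" for p
    proof (cases "\<mu> \<subseteq> ?E")
      case True
      then show ?thesis using that mu finite_subset[OF True finite_edges] by (simp add: v_def)
    qed (simp add: v_def)
    then have "bd (obj G n) ?E v \<mu> = (\<Oplus>\<^bsub>obj G n\<^esub>p\<in>?E - \<mu>. \<zero>\<^bsub>obj G n\<^esub>)"
      unfolding bd_def by (intro M.M.finsum_cong') auto
    moreover have "y \<mu> = \<zero>\<^bsub>obj G n\<^esub>" using y(1) mu unfolding chains_def by (auto dest!: spec[of _ \<mu>] split: if_splits)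
    ultimately show ?thesis by (simp add: y'_def)
  qed
  ultimately have "y' \<in> chains (obj G n) ?E (invariants G ?K n) (Suc j)" by (auto simp: chains_def)
  moreover have "bd (obj G n) ?E y' \<mu> = z \<mu>" if "\<mu> \<subseteq> ?E" for \<mu>
  proof -
    have "bd (obj G n) ?E y' \<mu> = bd (obj G n) ?E y \<mu> \<oplus>\<^bsub>obj G n\<^esub> \<ominus>\<^bsub>obj G n\<^esub> bd (obj G n) ?E (bd (obj G n) ?E v) \<mu>"
      unfolding y'_def using yc bvc by (simp add: M.M.bd_add M.M.bd_minus)
    also have "\<dots> = z \<mu>"
      using bbv[OF that] y(2)[OF that] M.M.bd_closed[of y ?E \<mu>] yc by simp
    finally show ?thesis .
  qed
  ultimately show "\<exists>y\<in>chains (obj G n) ?E (invariants G ?K n) (Suc j). \<forall>\<mu>\<subseteq>?E. bd (obj G n) ?E y \<mu> = z \<mu>" by blast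
qed

text \<open>Placed at the empty set, any \<open>x\<close> is a cycle, hence a signed sum of elements
  each invariant under one merge. Such an element equals its own merge, which factors through
  [n - 1]: it is the pullback along \<open>q\<close> of its pullback along \<open>s\<close>, and the
  latter lies in \<open>K (n - 1)\<close>.\<close>

lemma acyclic_at_0_generates:
  assumes G: "contravariant R G" and K: "subfunctor R G K" and ac: "acyclic_at G K n 0"
    and L: "submodule L R (obj G n)" "\<And>q y. q \<in> ds_hom n (n - 1) \<Longrightarrow> y \<in> K (n - 1) \<Longrightarrow> arr G q y \<in> L"
  shows "K n \<subseteq> L"
proof
  interpret M: module R "obj G n" by (rule contravariantD(1)[OF G])
  have sub: "K n \<subseteq> carrier (obj G n)" using subfunctorD(1)[OF K, of n] unfolding M.submodule_iff by auto
  fix x assume x: "x \<in> K n"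
  let ?E = "edges n" and ?z = "\<lambda>\<mu>. if \<mu> = {} then x else \<zero>\<^bsub>obj G n\<^esub>"
  have "?z \<in> chains (obj G n) ?E (invariants G K n) 0"
    using x finite_subset[OF _ finite_edges] by (auto simp: chains_def invariants_def indep_def)
  moreover have "bd (obj G n) ?E ?z \<mu> = \<zero>\<^bsub>obj G n\<^esub>" for \<mu> by (simp add: bd_def)
  ultimately obtain y where y: "y \<in> chains (obj G n) ?E (invariants G K n) (Suc 0)" "bd (obj G n) ?E y {} = x"
    using ac unfolding acyclic_at_def acyclic_in_def by force
  have "signed (obj G n) p {} (y {p}) \<in> L" if p: "p \<in> ?E" for p
  proof -
    have "y {p} \<in> invariants G K n {p}" using y(1) p by (auto simp: chains_def)
    then have yp: "y {p} \<in> K n" "arr G (merge n p) (y {p}) = y {p}" by (auto simp: invariants_def indep_def)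
    obtain q s where qs: "q \<in> ds_hom n (n - 1)" "s \<in> ds_hom (n - 1) n" "merge n p = ds_comp s q"
      using merge_factor[OF p] by blast
    have "y {p} = arr G q (arr G s (y {p}))"
      using contravariantD(4)[OF G qs(1,2), of "y {p}"] yp qs(3) sub by auto
    moreover have "arr G s (y {p}) \<in> K (n - 1)" using K qs(2) yp(1) by (auto simp: subfunctor_def)
    ultimately have "y {p} \<in> L" using L(2)[OF qs(1)] by metis
    then show ?thesis by (simp add: signed_def)
  qed
  then have "bd (obj G n) ?E y {} \<in> L"
    unfolding bd_def by (intro M.finsum_in_submodule[OF L(1)]) auto
  then show "x \<in> L" using y(2) by simp
qed

subsection \<open>The complex of a free functor\<close>

lemma steps_iff: "q \<in> steps w \<longleftrightarrow> (\<exists>us vs. w = us @ [fst q, snd q] @ vs)"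
proof
  assume "q \<in> steps w"
  then show "\<exists>us vs. w = us @ [fst q, snd q] @ vs"
  proof (induction w rule: induct_list012)
    case (3 x y w)
    then consider "q = (x, y)" | "q \<in> steps (y # w)" by auto
    then show ?case
    proof cases
      case 1
      then have "x # y # w = [] @ [fst q, snd q] @ w" by simp
      then show ?thesis by blast
    next
      case 2
      then obtain us vs where "y # w = us @ [fst q, snd q] @ vs" using "3.IH" by auto
      then have "x # y # w = (x # us) @ [fst q, snd q] @ vs" by simp
      then show ?thesis by blast
    qed
  qed auto
next
  assume "\<exists>us vs. w = us @ [fst q, snd q] @ vs"
  then obtain us vs where w: "w = us @ [fst q, snd q] @ vs" by blast
  show "q \<in> steps w" unfolding w
  proof (induction us)
    case Nil
    then show ?case by (cases vs) auto
  next
    case (Cons u us)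
    then show ?case by (cases us) auto
  qed
qed

lemma adj_iff: "q \<in> adj \<alpha> \<longleftrightarrow> (\<exists>i. q \<in> steps (fib \<alpha> i))"
  by (auto simp: adj_def steps_iff)

text \<open>Pigeonhole: m + 1 fibres of at most k letters cannot accommodate the n + 1 letters of
  [n].\<close>

lemma long_fibre:
  assumes \<alpha>: "\<alpha> \<in> ds_hom n m" and k: "Suc m * k < Suc n"
  shows "\<exists>i. k < length (fib \<alpha> i)"
proof (rule ccontr)
  assume "\<nexists>i. k < length (fib \<alpha> i)"
  then have le: "length (fib \<alpha> i) \<le> k" for i by (simp add: not_less)
  note h = ds_homD[OF \<alpha>]
  have "{0..n} \<subseteq> (\<Union>i\<in>{0..m}. set (fib \<alpha> i))"
    using h(3) by (auto simp: h(5) PiE_iff)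
  then have "card {0..n} \<le> card (\<Union>i\<in>{0..m}. set (fib \<alpha> i))" by (intro card_mono) auto
  also have "\<dots> \<le> (\<Sum>i\<in>{0..m}. card (set (fib \<alpha> i)))" by (intro card_UN_le) auto
  also have "\<dots> \<le> (\<Sum>i\<in>{0..m}. k)"
    using le card_length order_trans by (intro sum_mono) blast
  finally show False using k by simp
qed

text \<open>Distinct fibres are disjoint, so an adjacent pair that meets the long fibre is a step of
  that fibre. The fibre is thus a path cut off from the rest of the graph, and the shape of the
  other fibres is immaterial.\<close>

lemma reducible_adj:
  assumes \<alpha>: "\<alpha> \<in> ds_hom n m" and i: "3 * j + 2 \<le> length (fib \<alpha> i)"
  shows "reducible clash j (adj \<alpha> \<inter> edges n)"
proof (rule reducible_path)
  note h = ds_homD[OF \<alpha>]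
  have st: "q \<in> edges n" if q: "q \<in> steps (fib \<alpha> l)" for q l
  proof -
    obtain us vs where w: "fib \<alpha> l = us @ [fst q, snd q] @ vs" using q[unfolded steps_iff] by blast
    have "fst q \<noteq> snd q" using h(4)[of l] unfolding w by auto
    moreover have "fst q \<in> set (fib \<alpha> l)" "snd q \<in> set (fib \<alpha> l)" unfolding w by auto
    ultimately show ?thesis using h(5)[of l] by (cases q) (auto simp: edges_def)
  qed
  show "distinct (fib \<alpha> i)" by (rule h(4))
  show "steps (fib \<alpha> i) \<subseteq> adj \<alpha> \<inter> edges n" using st by (auto simp: adj_iff)
  fix q assume q: "q \<in> adj \<alpha> \<inter> edges n" "{fst q, snd q} \<inter> set (fib \<alpha> i) \<noteq> {}"
  then obtain l where l: "q \<in> steps (fib \<alpha> l)" by (auto simp: adj_iff)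
  then obtain x where "x \<in> set (fib \<alpha> l)" "x \<in> set (fib \<alpha> i)"
    using steps_in_set[OF l] q(2) by blast
  then have "l = i" unfolding h(5) by simp
  then show "q \<in> steps (fib \<alpha> i)" using l by simp
qed (rule i)

context cring
begin

lemma free_coeff: "f \<in> carrier (free_module R S) \<Longrightarrow> f s \<in> carrier R"
  by (simp add: free_carrier)

lemma free_supp: "f \<in> carrier (free_module R S) \<Longrightarrow> f s \<noteq> \<zero> \<Longrightarrow> s \<in> S"
  unfolding free_carrier by blast

lemma free_zero: "(\<lambda>_. \<zero>) \<in> carrier (free_module R S)"
  by (simp add: free_carrier)

lemma free_finsum_apply:
  assumes "finite I" "f \<in> I \<rightarrow> carrier (free_module R S)"
  shows "(\<Oplus>\<^bsub>free_module R S\<^esub>i\<in>I. f i) s = (\<Oplus>i\<in>I. f i s)"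
  using assms
proof (induction I rule: finite_induct)
  interpret F: module R "free_module R S" by (rule free_is_module)
  {
    case empty
    show ?case by simp
  next
    case (insert i I)
    have c: "f i \<in> carrier (free_module R S)" "f \<in> I \<rightarrow> carrier (free_module R S)" using insert.prems by auto
    have c': "f i s \<in> carrier R" "(\<lambda>i. f i s) \<in> I \<rightarrow> carrier R" using c by (auto simp: free_carrier Pi_iff)
    have "(\<Oplus>\<^bsub>free_module R S\<^esub>i\<in>insert i I. f i) = f i \<oplus>\<^bsub>free_module R S\<^esub> (\<Oplus>\<^bsub>free_module R S\<^esub>i\<in>I. f i)"
      by (rule F.M.finsum_insert[OF insert.hyps c(2,1)])
    then show ?case
      using insert.IH[OF c(2)] finsum_insert[OF insert.hyps c'(2,1)] by simp
  }
qed

text \<open>Boundaries are computed separately at each basis element \<open>s\<close>. With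
  \<open>free_invariant_iff\<close> this decomposes the complex of a free functor into complexes
  with coefficients in the ground ring, one for each \<open>s\<close>.\<close>

lemma bd_free_apply:
  assumes "finite E" "\<And>\<mu>. z \<mu> \<in> carrier (free_module R S)"
  shows "bd (free_module R S) E z \<mu> s = bd R E (\<lambda>\<mu>. z \<mu> s) \<mu>"
proof -
  interpret F: module R "free_module R S" by (rule free_is_module)
  have "signed (free_module R S) p \<mu> x s = signed R p \<mu> (x s)" if "x \<in> carrier (free_module R S)" for p x
    using that by (simp add: signed_def free_minus)
  moreover have "z \<mu> s \<in> carrier R" for \<mu> using assms(2)[of \<mu>] by (simp add: free_carrier)
  ultimately show ?thesis
    unfolding bd_def using assms by (subst free_finsum_apply) (auto intro!: finsum_cong')
qed

text \<open>Pullback along the merge sends every basis element to one in which \<open>p\<close> is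
  adjacent, and it fixes those. Invariance is therefore a condition on the support alone, and the
  sets of pairs that can occur at a fixed \<open>s\<close> are the matchings of the paths of
  \<open>fst s\<close>.\<close>

lemma free_invariant_iff:
  assumes x: "x \<in> carrier (free_module R (free_gens \<Gamma> n))" and p: "p \<in> edges n"
  shows "arr (free_functor R \<Gamma>) (merge n p) x = x \<longleftrightarrow> (\<forall>s. x s \<noteq> \<zero> \<longrightarrow> p \<in> adj (fst s))"
proof
  let ?\<phi> = "\<lambda>(\<alpha>, l). (ds_comp \<alpha> (merge n p), l)"
  assume eq: "arr (free_functor R \<Gamma>) (merge n p) x = x"
  show "\<forall>s. x s \<noteq> \<zero> \<longrightarrow> p \<in> adj (fst s)"
  proof (intro allI impI)
    fix s assume "x s \<noteq> \<zero>"
    then have nz: "(\<Oplus>t\<in>{t. x t \<noteq> \<zero> \<and> ?\<phi> t = s}. x t) \<noteq> \<zero>" using fun_cong[OF eq, of s] by (simp add: free_map_def)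
    have "{t. x t \<noteq> \<zero> \<and> ?\<phi> t = s} \<noteq> {}"
    proof
      assume e: "{t. x t \<noteq> \<zero> \<and> ?\<phi> t = s} = {}"
      show False using nz unfolding e by simp
    qed
    then obtain t where t: "x t \<noteq> \<zero>" "?\<phi> t = s" by blast
    then have "t \<in> free_gens \<Gamma> n" using x unfolding free_carrier by blast
    then show "p \<in> adj (fst s)"
      using t adj_merge_comp[OF _ p] by (cases t) (auto simp: free_gens_def)
  qed
next
  let ?\<phi> = "\<lambda>(\<alpha>, l). (ds_comp \<alpha> (merge n p), l)"
  assume adj: "\<forall>s. x s \<noteq> \<zero> \<longrightarrow> p \<in> adj (fst s)"
  have fix': "?\<phi> t = t" if "x t \<noteq> \<zero>" for t
  proof -
    have "t \<in> free_gens \<Gamma> n" using that x unfolding free_carrier by blast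
    then show ?thesis using adj that merge_comp_adj[OF _ p] by (cases t) (auto simp: free_gens_def)
  qed
  show "arr (free_functor R \<Gamma>) (merge n p) x = x"
  proof
    fix y
    have "{t. x t \<noteq> \<zero> \<and> ?\<phi> t = y} = (if x y \<noteq> \<zero> then {y} else {})" using fix' by auto
    moreover have "x y \<in> carrier R" using x by (rule free_coeff)
    ultimately show "arr (free_functor R \<Gamma>) (merge n p) x y = x y"
      by (simp add: free_map_def)
  qed
qed

text \<open>At each basis element \<open>s\<close> the coefficients of a cycle form a cycle of the
  matching complex of the graph \<open>X s\<close>. The target of \<open>s\<close> has at most B + 1
  elements, so among more than (B + 1)(3j + 1) letters some fibre has at least 3j + 2, and the path
  along it makes that complex acyclic in degree \<open>j\<close>.\<close>

lemma free_functor_acyclic_at: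
  assumes \<Gamma>: "\<And>m. B < m \<Longrightarrow> \<Gamma> m = {}" and n: "Suc B * (3 * j + 1) < Suc n"
  shows "acyclic_at (free_functor R \<Gamma>) (\<lambda>n. carrier (obj (free_functor R \<Gamma>) n)) n j"
  unfolding acyclic_at_def acyclic_in_def
proof (intro ballI impI)
  let ?F = "free_functor R \<Gamma>" and ?E = "edges n"
  let ?M = "free_module R (free_gens \<Gamma> n)"
  let ?V = "invariants ?F (\<lambda>n. carrier (obj ?F n)) n"
  interpret M: module R ?M by (rule free_is_module)
  define X where "X s = adj (fst s) \<inter> ?E" for s :: "ds_mor \<times> 'c"
  fix z assume "z \<in> chains (obj ?F n) ?E ?V j"
    and "\<forall>\<mu>\<subseteq>?E. bd (obj ?F n) ?E z \<mu> = \<zero>\<^bsub>obj ?F n\<^esub>"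
  then have z: "z \<in> chains ?M ?E ?V j" and bz: "\<And>\<mu>. \<mu> \<subseteq> ?E \<Longrightarrow> bd ?M ?E z \<mu> = (\<lambda>_. \<zero>)" by auto
  have zsupp: "\<mu> \<subseteq> X s \<and> card \<mu> = j \<and> indep clash \<mu>" if nz: "z \<mu> s \<noteq> \<zero>" for \<mu> s
  proof -
    have 1: "\<mu> \<subseteq> ?E \<and> card \<mu> = j" using z nz unfolding chains_def by (auto dest!: spec[of _ \<mu>] split: if_splits)
    then have "z \<mu> \<in> ?V \<mu>" using z by (auto simp: chains_def)
    then have 2: "indep clash \<mu>" "z \<mu> \<in> carrier ?M" "\<And>p. p \<in> \<mu> \<Longrightarrow> arr ?F (merge n p) (z \<mu>) = z \<mu>"
      using nz by (auto simp: invariants_def split: if_splits)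
    have "p \<in> adj (fst s)" if "p \<in> \<mu>" for p
      using free_invariant_iff[OF 2(2), of p] 2(3)[OF that] that 1 nz by blast
    then show ?thesis using 1 2 by (auto simp: X_def)
  qed
  have zc: "z \<mu> \<in> carrier ?M" for \<mu>
  proof (cases "\<mu> \<subseteq> ?E \<and> card \<mu> = j")
    case True
    then have "z \<mu> \<in> ?V \<mu>" using z by (auto simp: chains_def)
    then show ?thesis using free_zero by (auto simp: invariants_def split: if_splits)
  next
    case False
    then have "z \<mu> = (\<lambda>_. \<zero>)" using z by (auto simp: chains_def)
    then show ?thesis using free_zero by simp
  qed
  have zR: "z \<mu> s \<in> carrier R" for \<mu> s using zc[of \<mu>] by (rule free_coeff)
  have Xfin: "finite (X s)" "X s \<subseteq> ?E" for s by (auto simp: X_def)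
  have zs: "(\<lambda>\<mu>. z \<mu> s) \<in> schains clash (X s) j" for s
    unfolding schains_iff using zsupp zR by blast
  have ex: "\<exists>y. y \<in> schains clash (X s) (Suc j) \<and> (\<forall>\<mu>. bd R ?E y \<mu> = z \<mu> s)" if s: "s \<in> free_gens \<Gamma> n" for s
  proof -
    obtain \<alpha> l where sl: "s = (\<alpha>, l)" "\<alpha> \<in> ds_hom n (tgt \<alpha>)" "l \<in> \<Gamma> (tgt \<alpha>)"
      using s by (auto simp: free_gens_def)
    then have "tgt \<alpha> \<le> B" using \<Gamma> by (metis empty_iff not_le)
    then have "Suc (tgt \<alpha>) * (3 * j + 1) \<le> Suc B * (3 * j + 1)" by (intro mult_le_mono1) simp
    then have "Suc (tgt \<alpha>) * (3 * j + 1) < Suc n" using n by linarith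
    then obtain i where "3 * j + 1 < length (fib \<alpha> i)" using long_fibre[OF sl(2)] by blast
    then have "reducible clash j (X s)" using reducible_adj[OF sl(2), of j i] sl(1) by (simp add: X_def)
    then have ac: "independence_acyclic R clash (X s) j" using Xfin clash_sym by (intro reducible_imp_acyclic) auto
    have "bd R (X s) (\<lambda>\<mu>. z \<mu> s) \<mu> = \<zero>" if "\<mu> \<subseteq> X s" for \<mu>
    proof -
      have "bd R (X s) (\<lambda>\<mu>. z \<mu> s) \<mu> = bd R ?E (\<lambda>\<mu>. z \<mu> s) \<mu>"
        using bd_schains[OF finite_edges[of n] Xfin(2)[of s] zs[of s], of \<mu>] that by simp
      also have "\<dots> = bd ?M ?E z \<mu> s" by (rule bd_free_apply[OF finite_edges zc, symmetric])
      also have "\<dots> = \<zero>" using bz[of \<mu>] that Xfin(2)[of s] by auto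
      finally show ?thesis .
    qed
    then obtain y where y: "y \<in> schains clash (X s) (Suc j)" "\<And>\<mu>. \<mu> \<subseteq> X s \<Longrightarrow> bd R (X s) y \<mu> = z \<mu> s"
      using independence_acyclicD[OF ac zs] by blast
    have "bd R ?E y \<mu> = z \<mu> s" for \<mu>
      using bd_schains[OF finite_edges[of n] Xfin(2)[of s] y(1), of \<mu>] y(2)[of \<mu>] schains_zero[OF zs[of s], of \<mu>] by auto
    then show ?thesis using y(1) by blast
  qed
  then obtain ys where ys: "\<And>s. s \<in> free_gens \<Gamma> n \<Longrightarrow> ys s \<in> schains clash (X s) (Suc j)"
      "\<And>s \<mu>. s \<in> free_gens \<Gamma> n \<Longrightarrow> bd R ?E (ys s) \<mu> = z \<mu> s" by metis
  \<comment> \<open>Bounding chains are inserted only at the finitely many basis elements that occur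
    in \<open>z\<close>. The sets \<open>\<Gamma> m\<close> may be infinite, so this is what gives
    \<open>y\<close> finite support.\<close>
  define S where "S = (\<Union>\<nu>\<in>Pow ?E. {s. z \<nu> s \<noteq> \<zero>})"
  have Sfin: "finite S" unfolding S_def using zc by (intro finite_UN_I) (auto simp: free_carrier)
  have SG: "S \<subseteq> free_gens \<Gamma> n" using free_supp[OF zc] by (auto simp: S_def simp del: split_paired_All)
  have zS: "z \<mu> s = \<zero>" if "s \<notin> S" for \<mu> s using that zsupp[of \<mu> s] Xfin(2)[of s] by (auto simp: S_def)
  define y where "y \<mu> s = (if s \<in> S then ys s \<mu> else \<zero>)" for \<mu> s
  have ysupp: "\<mu> \<subseteq> X s \<and> card \<mu> = Suc j \<and> indep clash \<mu>" if "y \<mu> s \<noteq> \<zero>" for \<mu> s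
  proof -
    have "s \<in> S" "ys s \<mu> \<noteq> \<zero>" using that by (auto simp: y_def split: if_splits)
    then show ?thesis using ys(1)[of s] SG unfolding schains_iff by blast
  qed
  have yR: "y \<mu> s \<in> carrier R" for \<mu> s
    using ys(1)[of s] SG schains_closed[of "ys s"] by (auto simp: y_def)
  have ysub: "{s. y \<mu> s \<noteq> \<zero>} \<subseteq> S" for \<mu> by (auto simp: y_def)
  have yc: "y \<mu> \<in> carrier ?M" for \<mu>
    unfolding free_carrier using yR SG ysub[of \<mu>] finite_subset[OF ysub Sfin, of \<mu>] by blast
  have "y \<in> chains ?M ?E ?V (Suc j)"
    unfolding chains_def
  proof (intro CollectI allI)
    fix \<mu>
    consider "\<mu> \<subseteq> ?E" "card \<mu> = Suc j" "indep clash \<mu>" | "\<not> (\<mu> \<subseteq> ?E \<and> card \<mu> = Suc j \<and> indep clash \<mu>)" by blast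
    then show "if \<mu> \<subseteq> ?E \<and> card \<mu> = Suc j then y \<mu> \<in> ?V \<mu> else y \<mu> = \<zero>\<^bsub>?M\<^esub>"
    proof cases
      case 1
      have "arr ?F (merge n p) (y \<mu>) = y \<mu>" if "p \<in> \<mu>" for p
        using free_invariant_iff[OF yc, of p \<mu>] 1 that ysupp[of \<mu>] by (fastforce simp: X_def)
      then show ?thesis using 1 yc by (simp add: invariants_def)
    next
      case 2
      then have "y \<mu> s = \<zero>" for s using ysupp[of \<mu> s] Xfin(2)[of s] by blast
      then have "y \<mu> = (\<lambda>_. \<zero>)" by auto
      then show ?thesis using 2 by (auto simp: invariants_def)
    qed
  qed
  moreover have "bd ?M ?E y \<mu> = z \<mu>" for \<mu>
  proof
    fix s
    have "bd ?M ?E y \<mu> s = bd R ?E (\<lambda>\<mu>. y \<mu> s) \<mu>" by (rule bd_free_apply[OF finite_edges yc])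
    also have "\<dots> = z \<mu> s"
    proof (cases "s \<in> S")
      case True
      then show ?thesis using ys(2)[of s \<mu>] SG by (auto simp: y_def)
    next
      case False
      then show ?thesis using zS[of s \<mu>] by (simp add: y_def bd_def)
    qed
    finally show "bd ?M ?E y \<mu> s = z \<mu> s" .
  qed
  ultimately show "\<exists>y\<in>chains (obj ?F n) ?E ?V (Suc j). \<forall>\<mu>\<subseteq>?E. bd (obj ?F n) ?E y \<mu> = z \<mu>"
    by auto
qed

end

subsection \<open>Generation in bounded degrees\<close>

definition finite_gens :: "(nat \<Rightarrow> 'l set) \<Rightarrow> bool"
  where "finite_gens \<Gamma> \<longleftrightarrow> (\<forall>m. finite (\<Gamma> m)) \<and> (\<exists>B. \<forall>m>B. \<Gamma> m = {})"

text \<open>A morphism is determined by its map and its fibres over 0, ..., m, since all later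
  fibres are empty; each fibre is a repetition-free list over a finite set.\<close>

lemma finite_ds_hom: "finite (ds_hom n m)"
proof -
  let ?c = "\<lambda>\<alpha>. (fn \<alpha>, map (fib \<alpha>) [0..<Suc m])"
  let ?L = "{xs. set xs \<subseteq> {0..n} \<and> distinct xs}"
  have "?c ` ds_hom n m \<subseteq> ({0..n} \<rightarrow>\<^sub>E {0..m}) \<times> {xss. set xss \<subseteq> ?L \<and> length xss = Suc m}"
    by (auto simp: ds_hom_def)
  moreover have "finite (({0..n} \<rightarrow>\<^sub>E {0..m}) \<times> {xss. set xss \<subseteq> ?L \<and> length xss = Suc m})"
    by (intro finite_cartesian_product finite_PiE finite_lists_length_eq finite_subset_distinct) auto
  ultimately have "finite (?c ` ds_hom n m)" by (rule finite_subset)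
  moreover have "inj_on ?c (ds_hom n m)"
  proof (rule inj_onI)
    fix \<alpha> \<beta> assume a: "\<alpha> \<in> ds_hom n m" and b: "\<beta> \<in> ds_hom n m" and eq: "?c \<alpha> = ?c \<beta>"
    have "fib \<alpha> j = fib \<beta> j" for j
    proof (cases "j \<le> m")
      case True
      then have "j \<in> set [0..<Suc m]" by auto
      then show ?thesis using eq by (simp del: upt_Suc)
    next
      case False
      have "set (fib \<gamma> j) = {}" if "\<gamma> \<in> ds_hom n m" for \<gamma>
        using ds_homD(3)[OF that] ds_homD(5)[OF that, of j] False by (auto simp: PiE_iff)
      then have "fib \<alpha> j = []" "fib \<beta> j = []" using a b by (simp_all only: set_empty)
      then show ?thesis by simp
    qed
    then show "\<alpha> = \<beta>" using a b eq by (intro ds_mor.equality) (auto simp: ds_hom_def)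
  qed
  ultimately show ?thesis by (rule finite_imageD)
qed

lemma finite_free_gens:
  assumes "finite_gens \<Gamma>"
  shows "finite (free_gens \<Gamma> n)"
proof -
  obtain B where B: "\<And>m. B < m \<Longrightarrow> \<Gamma> m = {}" using assms by (auto simp: finite_gens_def)
  have "free_gens \<Gamma> n \<subseteq> (\<Union>m\<in>{..B}. ds_hom n m \<times> \<Gamma> m)"
    using B by (fastforce simp: free_gens_def not_less[symmetric])
  moreover have "finite (\<Union>m\<in>{..B}. ds_hom n m \<times> \<Gamma> m)"
    using assms finite_ds_hom by (auto simp: finite_gens_def)
  ultimately show ?thesis by (rule finite_subset)
qed

lemma (in cring) free_spanI:
  assumes "submodule L R (free_module R S)" "\<And>s. s \<in> S \<Longrightarrow> basis R s \<in> L"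
  shows "carrier (free_module R S) \<subseteq> L"
proof
  interpret F: module R "free_module R S" by (rule free_is_module)
  fix f assume "f \<in> carrier (free_module R S)"
  then show "f \<in> L"
  proof (induction rule: free_induct)
    case zero
    then show ?case using assms(1) by (simp add: F.submodule_iff)
  next
    case (add r s g)
    then show ?case using assms(1) assms(2)[OF add(2)] unfolding F.submodule_iff by blast
  qed
qed

text \<open>Hom sets are finite, so the free functor has a finite basis in each degree and the
  Noetherian property applies there. This works one degree at a time and gives nothing uniform in
  \<open>n\<close>.\<close>

lemma free_functor_sub_fin_gen:
  assumes R: "cring R" "noetherian_ring R" and \<Gamma>: "finite_gens \<Gamma>" and K: "subfunctor R (free_functor R \<Gamma>) K"
  shows "\<exists>F. finite F \<and> F \<subseteq> K n \<and> submodule_span R (obj (free_functor R \<Gamma>) n) F = K n"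
proof -
  interpret cring R by fact
  let ?M = "free_module R (free_gens \<Gamma> n)"
  interpret M: module R ?M by (rule free_is_module)
  let ?S = "basis R ` free_gens \<Gamma> n"
  have S: "?S \<subseteq> carrier ?M" by (auto intro: basis_in_free)
  have "carrier ?M \<subseteq> submodule_span R ?M ?S"
    using M.submodule_span_incl[of ?S] by (intro free_spanI M.submodule_span_submodule[OF S]) auto
  then have "K n \<subseteq> submodule_span R ?M ?S"
    using subfunctorD(1)[OF K, of n] by (auto simp: M.submodule_iff)
  then have "\<exists>F. finite F \<and> F \<subseteq> K n \<and> submodule_span R ?M F = K n"
    using subfunctorD(1)[OF K, of n] finite_free_gens[OF \<Gamma>, of n] S
    by (intro submodule_of_fin_gen[OF R M.module_axioms, of ?S]) auto
  then show ?thesis by simp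
qed

lemma subfunctor_subset:
  assumes "contravariant R G" "subfunctor R G K"
  shows "K n \<subseteq> carrier (obj G n)"
proof -
  interpret M: module R "obj G n" using assms(1) by (rule contravariantD(1))
  show ?thesis using subfunctorD(1)[OF assms(2), of n] unfolding M.submodule_iff by simp
qed

text \<open>Finite generating sets of \<open>K n\<close> for n up to \<open>N\<close> suffice,
  because above \<open>N\<close> everything is pulled back from the preceding object. The generators
  are enumerated by natural numbers, so that all stages of the resolution share one element type and
  can be produced by an induction.\<close>

lemma generated_in_bounded_degrees:
  fixes G :: "('r, 'm) ds_functor"
  assumes R: "cring R" and G: "contravariant R G" and K: "subfunctor R G K"
    and fg: "\<And>n. \<exists>F. finite F \<and> F \<subseteq> K n \<and> submodule_span R (obj G n) F = K n"
    and ac: "\<And>n. N \<le> n \<Longrightarrow> acyclic_at G K n 0"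
  shows "\<exists>(\<Gamma> :: nat \<Rightarrow> nat set) y. finite_gens \<Gamma> \<and> (\<forall>m. \<forall>l\<in>\<Gamma> m. y m l \<in> K m) \<and>
    (\<forall>n. yoneda R G y n ` carrier (free_module R (free_gens \<Gamma> n)) = K n)"
proof -
  interpret cring R by fact
  have "\<forall>n. \<exists>F. finite F \<and> F \<subseteq> K n \<and> submodule_span R (obj G n) F = K n" using fg by blast
  then obtain F where F: "\<And>n. finite (F n)" "\<And>n. F n \<subseteq> K n" "\<And>n. submodule_span R (obj G n) (F n) = K n"
    by metis
  have "\<forall>n. \<exists>h. bij_betw h {0..<card (F n)} (F n)" using ex_bij_betw_nat_finite[OF F(1)] by blast
  then obtain y where y: "\<And>n. bij_betw (y n) {0..<card (F n)} (F n)" by metis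
  define \<Gamma> where "\<Gamma> m = (if m \<le> N then {0..<card (F m)} else {})" for m
  have fin: "finite_gens \<Gamma>" by (auto simp: finite_gens_def \<Gamma>_def intro!: exI[of _ N])
  have yF: "y m l \<in> F m" if "l \<in> \<Gamma> m" for m l
    using y[of m] that by (auto simp: \<Gamma>_def bij_betw_def split: if_splits)
  have KC: "K m \<subseteq> carrier (obj G m)" for m
    by (rule subfunctor_subset[OF G K])
  have yK: "y m l \<in> K m" if "l \<in> \<Gamma> m" for m l using yF[OF that] F(2)[of m] by blast
  have yC: "y m l \<in> carrier (obj G m)" if "l \<in> \<Gamma> m" for m l using yK[OF that] KC[of m] by blast
  let ?img = "\<lambda>n. yoneda R G y n ` carrier (free_module R (free_gens \<Gamma> n))"
  have hom: "yoneda R G y n \<in> module_hom R (free_module R (free_gens \<Gamma> n)) (obj G n)" for n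
    using yC by (rule yoneda_hom[OF G])
  have img: "submodule (?img n) R (obj G n)" for n
    by (rule hom_image_submodule[OF free_is_module contravariantD(1)[OF G] hom
          module.carrier_is_submodule[OF free_is_module]])
  have "?img n \<subseteq> K n" for n
  proof -
    have "carrier (free_module R (free_gens \<Gamma> n)) \<subseteq>
        {f \<in> carrier (free_module R (free_gens \<Gamma> n)). yoneda R G y n f \<in> K n}"
    proof (rule free_spanI[OF hom_preimage_submodule[OF free_is_module contravariantD(1)[OF G] hom subfunctorD(1)[OF K]]])
      fix s assume s: "s \<in> free_gens \<Gamma> n"
      obtain \<alpha> l where sl: "s = (\<alpha>, l)" by (cases s)
      then have "\<alpha> \<in> ds_hom n (tgt \<alpha>)" "l \<in> \<Gamma> (tgt \<alpha>)" using s by (auto simp: free_gens_def)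
      then have "arr G \<alpha> (y (tgt \<alpha>) l) \<in> K n" using yK subfunctorD(2)[OF K] by blast
      moreover have "yoneda R G y n (basis R (\<alpha>, l)) = arr G \<alpha> (y (tgt \<alpha>) l)"
        using yC s unfolding sl by (rule yoneda_basis[OF G])
      ultimately show "basis R s \<in> {f \<in> carrier (free_module R (free_gens \<Gamma> n)). yoneda R G y n f \<in> K n}"
        using basis_in_free[OF s] by (simp add: sl)
    qed
    then show ?thesis by blast
  qed
  moreover have "K n \<subseteq> ?img n" for n
  proof (induction n rule: less_induct)
    case (less n)
    show ?case
    proof (cases "n \<le> N")
      case True
      have "F n \<subseteq> ?img n"
      proof
        fix x assume "x \<in> F n"
        moreover have "y n ` \<Gamma> n = F n" using y[of n] True by (simp add: \<Gamma>_def bij_betw_def)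
        ultimately obtain l where l: "x = y n l" "l \<in> \<Gamma> n" by blast
        have g: "(ds_id n, l) \<in> free_gens \<Gamma> n" using l(2) by (rule free_gens_id)
        have "yoneda R G y n (basis R (ds_id n, l)) = arr G (ds_id n) (y (tgt (ds_id n)) l)"
          using yC g by (rule yoneda_basis[OF G])
        also have "\<dots> = x" using contravariantD(3)[OF G] yC[OF l(2)] l(1) by (simp add: ds_id_def)
        finally show "x \<in> ?img n" using basis_in_free[OF g] by (metis imageI)
      qed
      then show ?thesis
        using module.submodule_span_least[OF contravariantD(1)[OF G] img] F(3)[of n] by blast
    next
      case False
      \<comment> \<open>Here \<open>n\<close> exceeds \<open>N\<close> and is positive, so the
        induction hypothesis covers \<open>n - 1\<close>.\<close>
      show ?thesis
      proof (rule acyclic_at_0_generates[OF G K ac img])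
        show "N \<le> n" using False by simp
        fix q z assume q: "q \<in> ds_hom n (n - 1)" and z: "z \<in> K (n - 1)"
        have "z \<in> ?img (n - 1)" using less[of "n - 1"] False z by auto
        then obtain f where f: "z = yoneda R G y (n - 1) f" "f \<in> carrier (free_module R (free_gens \<Gamma> (n - 1)))" by auto
        have nt: "nat_trans R (free_functor R \<Gamma>) G (yoneda R G y)" using yC by (rule yoneda_nat_trans[OF G])
        have "arr G q z = yoneda R G y n (arr (free_functor R \<Gamma>) q f)"
          using nat_transD(2)[OF nt q] f by simp
        moreover have "arr (free_functor R \<Gamma>) q f \<in> carrier (free_module R (free_gens \<Gamma> n))"
          using arr_closed[OF free_functor_contravariant q, of f \<Gamma>] f by simp
        ultimately show "arr G q z \<in> ?img n" by blast
      qed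
    qed
  qed
  ultimately have "?img n = K n" for n by blast
  then show ?thesis using fin yK by blast
qed

subsection \<open>Projective functors\<close>

text \<open>Projectivity is applied once, to the free cover of \<open>P\<close>, and yields a
  splitting \<open>s\<close>. Any choice of preimages of the values of \<open>\<theta>\<close>
  extends over the cover, and composing with \<open>s\<close> gives the lift; hence \<open>A\<close>
  and \<open>B\<close> may take values in arbitrary types. Asking only that \<open>\<theta>\<close>
  lands in the image of \<open>\<psi>\<close> permits lifting along a map onto a kernel without
  turning the kernel into a functor.\<close>

lemma projective_lift:
  fixes P :: "('r, 'm) ds_functor"
  assumes R: "cring R" and P: "projective_functor R P" and A: "contravariant R A" and B: "contravariant R B"
    and \<psi>: "nat_trans R A B \<psi>" and \<theta>: "nat_trans R P B \<theta>"
    and im: "\<And>n x. x \<in> carrier (obj P n) \<Longrightarrow> \<theta> n x \<in> \<psi> n ` carrier (obj A n)"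
  shows "\<exists>\<eta>. nat_trans R P A \<eta> \<and> (\<forall>n. \<forall>x\<in>carrier (obj P n). \<psi> n (\<eta> n x) = \<theta> n x)"
proof -
  interpret cring R by fact
  have cP: "contravariant R P" using P by (simp add: projective_functor_def)
  let ?\<Gamma> = "\<lambda>m. carrier (obj P m)"
  let ?M = "free_functor R ?\<Gamma>"
  let ?g = "yoneda R P (\<lambda>m x. x)"
  have g: "nat_trans R ?M P ?g" by (rule yoneda_nat_trans[OF cP])
  have "?g n ` carrier (obj ?M n) = carrier (obj P n)" for n
  proof
    show "?g n ` carrier (obj ?M n) \<subseteq> carrier (obj P n)" using nat_transD(3)[OF g] by blast
    show "carrier (obj P n) \<subseteq> ?g n ` carrier (obj ?M n)"
    proof
      fix x assume x: "x \<in> carrier (obj P n)"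
      then have s: "(ds_id n, x) \<in> free_gens ?\<Gamma> n" by (rule free_gens_id)
      have "?g n (basis R (ds_id n, x)) = arr P (ds_id n) x"
        by (rule yoneda_basis[OF cP _ s]) simp
      also have "\<dots> = x" using contravariantD(3)[OF cP x] .
      finally show "x \<in> ?g n ` carrier (obj ?M n)" using basis_in_free[OF s] by (metis imageI free_functor_simps(1))
    qed
  qed
  moreover have "nat_trans R P P (\<lambda>n x. x)" by (rule nat_trans_id[OF cP])
  ultimately have "contravariant R ?M \<and> contravariant R P \<and> nat_trans R ?M P ?g \<and>
      (\<forall>n. ?g n ` carrier (obj ?M n) = carrier (obj P n)) \<and> nat_trans R P P (\<lambda>n x. x)"
    using free_functor_contravariant[of ?\<Gamma>] cP g by simp
  then have "\<exists>s. nat_trans R P ?M s \<and> (\<forall>n. \<forall>x\<in>carrier (obj P n). ?g n (s n x) = x)"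
    by (rule P[unfolded projective_functor_def, THEN conjunct2, THEN spec, THEN spec, THEN spec, THEN spec, THEN mp])
  then obtain s where s: "nat_trans R P ?M s" "\<And>n x. x \<in> carrier (obj P n) \<Longrightarrow> ?g n (s n x) = x"
    by blast
  \<comment> \<open>These preimages are chosen without regard to linearity or naturality; both are
    supplied by the extension over the free cover.\<close>
  have "\<forall>m x. \<exists>a. x \<in> carrier (obj P m) \<longrightarrow> a \<in> carrier (obj A m) \<and> \<psi> m a = \<theta> m x"
    using im by (metis imageE)
  then obtain y where y: "\<And>m x. x \<in> carrier (obj P m) \<Longrightarrow> y m x \<in> carrier (obj A m)"
      "\<And>m x. x \<in> carrier (obj P m) \<Longrightarrow> \<psi> m (y m x) = \<theta> m x" by metis
  let ?\<eta> = "\<lambda>n x. yoneda R A y n (s n x)"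
  have "nat_trans R P A ?\<eta>"
    using s(1) yoneda_nat_trans[where \<Gamma> = ?\<Gamma> and y = y, OF A y(1)] by (rule nat_trans_comp)
  moreover have "\<psi> n (?\<eta> n x) = \<theta> n x" if x: "x \<in> carrier (obj P n)" for n x
  proof -
    have sx: "s n x \<in> carrier (free_module R (free_gens ?\<Gamma> n))" using nat_transD(3)[OF s(1) x] by simp
    have "\<psi> n (?\<eta> n x) = yoneda R B \<theta> n (s n x)"
      using y(1) sx y(2) by (rule yoneda_natural[OF A B \<psi>])
    also have "\<dots> = \<theta> n (?g n (s n x))"
      by (rule yoneda_natural[OF cP B \<theta> _ sx, symmetric]) auto
    finally show ?thesis using s(2)[OF x] by simp
  qed
  ultimately show ?thesis by blast
qed

subsection \<open>Comparison with a resolution of finite type\<close>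

text \<open>In degree 0 the augmentation takes the role of the differential; the case distinction
  also keeps the truncated subtraction from being read at 0.\<close>

definition ker_at :: "(nat \<Rightarrow> ('r, 'm) ds_functor) \<Rightarrow> (nat \<Rightarrow> nat \<Rightarrow> 'm \<Rightarrow> 'm) \<Rightarrow> ('r, 'n) ds_functor \<Rightarrow>
    (nat \<Rightarrow> 'm \<Rightarrow> 'n) \<Rightarrow> nat \<Rightarrow> nat \<Rightarrow> 'm set"
  where "ker_at P d G e i n = {x \<in> carrier (obj (P i) n).
    if i = 0 then e n x = \<zero>\<^bsub>obj G n\<^esub> else d (i - 1) n x = \<zero>\<^bsub>obj (P (i - 1)) n\<^esub>}"

text \<open>The identity of \<open>P i\<close> factors, up to homotopy, through a free functor with finitely many
  generators; \<open>K\<close> is the next syzygy of the resolution of finite type.\<close>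

definition finite_factor :: "('r, 'b) ring_scheme \<Rightarrow> ('r, 'n) ds_functor \<Rightarrow> (nat \<Rightarrow> ('r, 'm) ds_functor) \<Rightarrow>
    (nat \<Rightarrow> nat \<Rightarrow> 'm \<Rightarrow> 'm) \<Rightarrow> (nat \<Rightarrow> 'm \<Rightarrow> 'n) \<Rightarrow> nat \<Rightarrow> (nat \<Rightarrow> nat set) \<Rightarrow>
    (nat \<Rightarrow> (ds_mor \<times> nat \<Rightarrow> 'r) set) \<Rightarrow> (nat \<Rightarrow> (ds_mor \<times> nat \<Rightarrow> 'r) \<Rightarrow> 'm) \<Rightarrow>
    (nat \<Rightarrow> 'm \<Rightarrow> ds_mor \<times> nat \<Rightarrow> 'r) \<Rightarrow> (nat \<Rightarrow> 'm \<Rightarrow> 'm) \<Rightarrow> (nat \<Rightarrow> 'm \<Rightarrow> 'm) \<Rightarrow> bool"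
  where "finite_factor R G P d e i \<Gamma> K g f h r \<longleftrightarrow>
    finite_gens \<Gamma> \<and> subfunctor R (free_functor R \<Gamma>) K \<and>
    (\<forall>j. \<exists>N. \<forall>n\<ge>N. acyclic_at (free_functor R \<Gamma>) K n j) \<and>
    nat_trans R (free_functor R \<Gamma>) (P i) g \<and> (\<forall>n. \<forall>x\<in>K n. g n x \<in> ker_at P d G e i n) \<and>
    nat_trans R (P i) (free_functor R \<Gamma>) f \<and> (\<forall>n. \<forall>x\<in>ker_at P d G e i n. f n x \<in> K n) \<and>
    nat_trans R (P i) (P (Suc i)) h \<and>
    nat_trans R (P i) (P i) r \<and> (\<forall>n. \<forall>x\<in>ker_at P d G e i n. r n x = \<zero>\<^bsub>obj (P i) n\<^esub>) \<and>
    (\<forall>n. \<forall>x\<in>carrier (obj (P i) n).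
      d i n (h n x) = (x \<ominus>\<^bsub>obj (P i) n\<^esub> g n (f n x)) \<ominus>\<^bsub>obj (P i) n\<^esub> r n x) \<and>
    (if i = 0 then r = (\<lambda>n x. \<zero>\<^bsub>obj (P 0) n\<^esub>)
     else \<exists>h'. nat_trans R (P (i - 1)) (P i) h' \<and>
       (\<forall>n. \<forall>x\<in>carrier (obj (P i) n). r n x = h' n (d (i - 1) n x)))"

lemma free_functor_acyclic:
  assumes "cring R" "finite_gens \<Gamma>"
  shows "\<exists>N. \<forall>n\<ge>N. acyclic_at (free_functor R \<Gamma>) (\<lambda>n. carrier (obj (free_functor R \<Gamma>) n)) n j"
proof -
  interpret cring R by fact
  obtain B where B: "\<And>m. B < m \<Longrightarrow> \<Gamma> m = {}" using assms(2) by (auto simp: finite_gens_def)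
  have "acyclic_at (free_functor R \<Gamma>) (\<lambda>n. carrier (obj (free_functor R \<Gamma>) n)) n j"
    if "Suc B * (3 * j + 1) \<le> n" for n
    using B that by (intro free_functor_acyclic_at[of B]) auto
  then show ?thesis by blast
qed

text \<open>The bound for degree \<open>j\<close> is the larger of the bounds for degree
  \<open>j\<close> of the free functor and degree \<open>Suc j\<close> of the image. Because of this
  shift, the hypothesis and the conclusion range over all degrees.\<close>

lemma kernel_acyclic:
  assumes R: "cring R" and \<Gamma>: "finite_gens \<Gamma>" and H: "contravariant R H"
    and \<psi>: "nat_trans R (free_functor R \<Gamma>) H \<psi>"
    and im: "\<And>n. \<psi> n ` carrier (obj (free_functor R \<Gamma>) n) = I n"
    and ac: "\<And>j. \<exists>N. \<forall>n\<ge>N. acyclic_at H I n j"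
  shows "\<exists>N. \<forall>n\<ge>N. acyclic_at (free_functor R \<Gamma>)
    (\<lambda>n. {x \<in> carrier (obj (free_functor R \<Gamma>) n). \<psi> n x = \<zero>\<^bsub>obj H n\<^esub>}) n j"
proof -
  interpret cring R by fact
  obtain N1 where N1: "\<And>n. N1 \<le> n \<Longrightarrow> acyclic_at (free_functor R \<Gamma>) (\<lambda>n. carrier (obj (free_functor R \<Gamma>) n)) n j"
    using free_functor_acyclic[OF R \<Gamma>] by blast
  obtain N2 where N2: "\<And>n. N2 \<le> n \<Longrightarrow> acyclic_at H I n (Suc j)" using ac by blast
  have I: "I = (\<lambda>n. \<psi> n ` carrier (obj (free_functor R \<Gamma>) n))" using im by (simp add: fun_eq_iff)
  have "acyclic_at (free_functor R \<Gamma>)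
    (\<lambda>n. {x \<in> carrier (obj (free_functor R \<Gamma>) n). \<psi> n x = \<zero>\<^bsub>obj H n\<^esub>}) n j" if "max N1 N2 \<le> n" for n
    using N1[of n] N2[of n] that unfolding I
    by (intro acyclic_at_kernel[OF free_functor_contravariant H \<psi>]) auto
  then show ?thesis by blast
qed

text \<open>All letters in one fibre, in their natural order. Since such a morphism exists, a single
  generator at [0] is enough to cover the constant functor.\<close>

lemma ds_hom_to_0: "\<lparr>src = n, tgt = 0, fn = (\<lambda>i\<in>{0..n}. 0), fib = (\<lambda>j. if j = 0 then [0..<Suc n] else [])\<rparr> \<in> ds_hom n 0"
  by (auto simp: ds_hom_def)

lemma projective_resolutionD:
  assumes "projective_resolution R G P d e"
  shows "projective_functor R (P i)" "contravariant R (P i)" "nat_trans R (P (Suc i)) (P i) (d i)" "nat_trans R (P 0) G e"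
    "e n ` carrier (obj (P 0) n) = carrier (obj G n)"
    "d i n ` carrier (obj (P (Suc i)) n) = ker_at P d G e i n"
proof -
  note a = assms[unfolded projective_resolution_def]
  show p: "projective_functor R (P i)" using a by (elim conjE) (erule spec)
  show "contravariant R (P i)" using p unfolding projective_functor_def by (rule conjunct1)
  show "nat_trans R (P (Suc i)) (P i) (d i)" using a by (elim conjE) (erule spec)
  show "nat_trans R (P 0) G e" using a by (elim conjE)
  show "e n ` carrier (obj (P 0) n) = carrier (obj G n)" using a by (elim conjE) (erule spec)
  show "d i n ` carrier (obj (P (Suc i)) n) = ker_at P d G e i n"
  proof (cases i)
    case 0
    then show ?thesis using a by (elim conjE) (simp add: ker_at_def)
  next
    case (Suc k)
    then show ?thesis using a by (elim conjE) (simp add: ker_at_def)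
  qed
qed

lemma const_functor_obj [simp]: "carrier (obj (const_functor R) n) = carrier R" "\<zero>\<^bsub>obj (const_functor R) n\<^esub> = \<zero>\<^bsub>R\<^esub>"
  by (simp_all add: const_functor_def)

lemma diff_eq_zero:
  assumes "module R M" "x \<in> carrier M"
  shows "x \<ominus>\<^bsub>M\<^esub> x = \<zero>\<^bsub>M\<^esub>" "x \<ominus>\<^bsub>M\<^esub> \<zero>\<^bsub>M\<^esub> = x"
proof -
  interpret M: module R M by fact
  show "x \<ominus>\<^bsub>M\<^esub> x = \<zero>\<^bsub>M\<^esub>" "x \<ominus>\<^bsub>M\<^esub> \<zero>\<^bsub>M\<^esub> = x"
    using assms(2) by (simp_all add: a_minus_def M.M.r_neg)
qed

lemma module_hom_diff:
  assumes "module R M" "module R N" "h \<in> module_hom R M N" "x \<in> carrier M" "y \<in> carrier M"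
  shows "h (x \<ominus>\<^bsub>M\<^esub> y) = h x \<ominus>\<^bsub>N\<^esub> h y"
proof -
  interpret M: module R M by fact
  show ?thesis
    using assms by (simp add: a_minus_def module_hom_add[OF assms(3)] module_hom_minus[OF assms(1-3)])
qed

lemma module_diff_closed:
  assumes "module R M" "x \<in> carrier M" "y \<in> carrier M"
  shows "x \<ominus>\<^bsub>M\<^esub> y \<in> carrier M"
proof -
  interpret M: module R M by fact
  show ?thesis using assms by simp
qed

text \<open>The finite stage is the representable functor of [0]. The map \<open>g\<close> sends its
  generator to a preimage of 1, and \<open>f\<close> lifts \<open>e\<close> through
  \<open>\<epsilon>\<close> by projectivity. Both respect the augmentations, so x - g f x lies in
  the kernel of \<open>e\<close>, which is the image of \<open>d 0\<close>, and lifts to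
  \<open>h\<close>. There is no earlier homotopy, so \<open>r\<close> is zero.\<close>

lemma finite_factor_0:
  assumes R: "cring R" and res: "projective_resolution R (const_functor R) P d e"
  shows "\<exists>\<Gamma> K g f h r. finite_factor R (const_functor R) P d e 0 \<Gamma> K g f h r"
proof -
  interpret cring R by fact
  let ?G = "const_functor R"
  note P = projective_resolutionD[OF res]
  note cG = const_functor_contravariant[OF R]
  define \<Gamma> where "\<Gamma> = (\<lambda>m. if m = (0::nat) then {0::nat} else {})"
  let ?Q = "free_functor R \<Gamma>"
  note cQ = free_functor_contravariant[of \<Gamma>]
  define \<epsilon> where "\<epsilon> = yoneda R ?G (\<lambda>(m::nat) (l::nat). \<one>\<^bsub>R\<^esub>)"
  have \<epsilon>: "nat_trans R ?Q ?G \<epsilon>" unfolding \<epsilon>_def by (rule yoneda_nat_trans[OF cG]) simp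
  have fin: "finite_gens \<Gamma>" by (auto simp: finite_gens_def \<Gamma>_def)
  have im: "\<epsilon> n ` carrier (obj ?Q n) = carrier R" for n
  proof
    show "\<epsilon> n ` carrier (obj ?Q n) \<subseteq> carrier R" using nat_transD(3)[OF \<epsilon>] by force
    show "carrier R \<subseteq> \<epsilon> n ` carrier (obj ?Q n)"
    proof
      fix x assume x: "x \<in> carrier R"
      obtain \<alpha> where \<alpha>: "\<alpha> \<in> ds_hom n 0" using ds_hom_to_0 by blast
      then have t: "tgt \<alpha> = 0" by (rule ds_homD(2))
      then have s: "(\<alpha>, 0) \<in> free_gens \<Gamma> n" using \<alpha> by (simp add: free_gens_def \<Gamma>_def)
      have "\<epsilon> n (basis R (\<alpha>, 0)) = arr ?G \<alpha> \<one>\<^bsub>R\<^esub>"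
        unfolding \<epsilon>_def by (rule yoneda_basis[OF cG _ s]) simp
      then have e1: "\<epsilon> n (basis R (\<alpha>, 0)) = \<one>\<^bsub>R\<^esub>" by (simp add: const_functor_def)
      have b: "basis R (\<alpha>, 0) \<in> carrier (obj ?Q n)" using basis_in_free[OF s] by simp
      have "\<epsilon> n (x \<odot>\<^bsub>obj ?Q n\<^esub> basis R (\<alpha>, 0)) = x \<odot>\<^bsub>obj ?G n\<^esub> \<one>\<^bsub>R\<^esub>"
        using module_hom_smult[OF nat_transD(1)[OF \<epsilon>] x b] e1 by simp
      also have "\<dots> = x" using x by (simp add: const_functor_def)
      finally show "x \<in> \<epsilon> n ` carrier (obj ?Q n)"
        using module.smult_closed[OF contravariantD(1)[OF cQ] x b] by (metis imageI)
    qed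
  qed
  define K where "K n = {x \<in> carrier (obj ?Q n). \<epsilon> n x = \<zero>\<^bsub>obj ?G n\<^esub>}" for n
  have K: "subfunctor R ?Q K" unfolding K_def by (rule subfunctor_kernel[OF cQ cG \<epsilon>])
  have cb: "\<exists>N. \<forall>n\<ge>N. acyclic_at ?G (\<lambda>_. carrier R) n j" for j
    using const_functor_acyclic[OF R, of j] by (intro exI[of _ "3 * j + 2"]) auto
  have ac: "\<exists>N. \<forall>n\<ge>N. acyclic_at ?Q K n j" for j
    unfolding K_def by (rule kernel_acyclic[OF R fin cG \<epsilon> im cb])
  have "\<exists>y\<in>carrier (obj (P 0) 0). e 0 y = \<one>\<^bsub>R\<^esub>" using P(5)[of 0] by (metis imageE const_functor_obj(1) one_closed)
  then obtain y0 where y0: "y0 \<in> carrier (obj (P 0) 0)" "e 0 y0 = \<one>\<^bsub>R\<^esub>" by blast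
  \<comment> \<open>The element \<open>y0\<close> lives over [0], the only object that carries a
    generator, so the family may be taken constant.\<close>
  define g where "g = yoneda R (P 0) (\<lambda>(m::nat) (l::nat). y0)"
  have y0': "y0 \<in> carrier (obj (P 0) m)" "e m y0 = \<one>\<^bsub>R\<^esub>" if "l \<in> \<Gamma> m" for m and l :: nat
    using that y0 by (auto simp: \<Gamma>_def split: if_splits)
  have g: "nat_trans R ?Q (P 0) g" unfolding g_def using y0'(1) by (rule yoneda_nat_trans[OF P(2)])
  have eg: "e n (g n x) = \<epsilon> n x" if "x \<in> carrier (obj ?Q n)" for n x
    unfolding g_def \<epsilon>_def using y0' that
    by (intro yoneda_natural[OF P(2) cG P(4)]) auto
  have "\<exists>f. nat_trans R (P 0) ?Q f \<and> (\<forall>n. \<forall>x\<in>carrier (obj (P 0) n). \<epsilon> n (f n x) = e n x)"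
  proof (rule projective_lift[OF R P(1) cQ cG \<epsilon> P(4)])
    fix n x assume "x \<in> carrier (obj (P 0) n)"
    then show "e n x \<in> \<epsilon> n ` carrier (obj ?Q n)" using P(5)[of n] im[of n] by auto
  qed
  then obtain f where f: "nat_trans R (P 0) ?Q f" "\<And>n x. x \<in> carrier (obj (P 0) n) \<Longrightarrow> \<epsilon> n (f n x) = e n x" by blast
  define \<theta> where "\<theta> n x = x \<ominus>\<^bsub>obj (P 0) n\<^esub> g n (f n x)" for n x
  have \<theta>: "nat_trans R (P 0) (P 0) \<theta>"
    unfolding \<theta>_def by (rule nat_trans_diff[OF P(2) nat_trans_id[OF P(2)] nat_trans_comp[OF f(1) g]])
  have \<theta>_ker: "\<theta> n x \<in> ker_at P d ?G e 0 n" if x: "x \<in> carrier (obj (P 0) n)" for n x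
  proof -
    have c: "f n x \<in> carrier (obj ?Q n)" "g n (f n x) \<in> carrier (obj (P 0) n)"
      using nat_transD(3)[OF f(1) x] nat_transD(3)[OF g] by auto
    have "e n (\<theta> n x) = e n x \<ominus>\<^bsub>obj ?G n\<^esub> e n (g n (f n x))"
      unfolding \<theta>_def using x c by (intro module_hom_diff[OF contravariantD(1)[OF P(2)] contravariantD(1)[OF cG] nat_transD(1)[OF P(4)]])
    also have "\<dots> = \<zero>\<^bsub>obj ?G n\<^esub>"
      using eg[OF c(1)] f(2)[OF x] diff_eq_zero(1)[OF contravariantD(1)[OF cG] nat_transD(3)[OF P(4) x]] by simp
    finally show ?thesis using nat_transD(3)[OF \<theta> x] by (simp add: ker_at_def)
  qed
  have "\<exists>h. nat_trans R (P 0) (P 1) h \<and> (\<forall>n. \<forall>x\<in>carrier (obj (P 0) n). d 0 n (h n x) = \<theta> n x)"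
    using \<theta>_ker P(3)[of 0] P(6)[of 0] by (intro projective_lift[OF R P(1) P(2) P(2) _ \<theta>]) auto
  then obtain h where h: "nat_trans R (P 0) (P 1) h" "\<And>n x. x \<in> carrier (obj (P 0) n) \<Longrightarrow> d 0 n (h n x) = \<theta> n x" by blast
  have "finite_factor R ?G P d e 0 \<Gamma> K g f h (\<lambda>n x. \<zero>\<^bsub>obj (P 0) n\<^esub>)"
    unfolding finite_factor_def
  proof (intro conjI)
    show "\<forall>n. \<forall>x\<in>K n. g n x \<in> ker_at P d ?G e 0 n"
      using nat_transD(3)[OF g] eg by (auto simp: K_def ker_at_def)
    show "\<forall>n. \<forall>x\<in>ker_at P d ?G e 0 n. f n x \<in> K n"
      using nat_transD(3)[OF f(1)] f(2) by (auto simp: K_def ker_at_def)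
    show "\<forall>n. \<forall>x\<in>carrier (obj (P 0) n). d 0 n (h n x)
        = (x \<ominus>\<^bsub>obj (P 0) n\<^esub> g n (f n x)) \<ominus>\<^bsub>obj (P 0) n\<^esub> \<zero>\<^bsub>obj (P 0) n\<^esub>"
      using h(2) diff_eq_zero(2)[OF contravariantD(1)[OF P(2)] nat_transD(3)[OF \<theta>]] by (simp add: \<theta>_def)
  qed (use fin K ac g f(1) h(1) nat_trans_zero[OF P(2) P(2)] in auto)
  then show ?thesis by blast
qed

text \<open>The syzygy \<open>K\<close> is covered by a finitely generated free functor through
  \<open>\<delta>\<close>; \<open>g'\<close> lifts g \<delta> along d, and \<open>f'\<close> lifts f
  d along \<open>\<delta>\<close>. Put r' = h d and \<theta> = 1 - g' f' - r'. From d h = 1 - g f -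
  r one gets d \<theta> = r d, which is zero because r vanishes on the kernel that contains the
  image of d. So \<theta> lifts to the next homotopy \<open>h'\<close>.\<close>

lemma finite_factor_Suc:
  assumes R: "cring R" "noetherian_ring R" and cG: "contravariant R G" and res: "projective_resolution R G P d e"
    and F: "finite_factor R G P d e i \<Gamma> K g f h r"
  shows "\<exists>\<Gamma> K g f h r. finite_factor R G P d e (Suc i) \<Gamma> K g f h r"
proof -
  interpret cring R by (rule R(1))
  note P = projective_resolutionD[OF res]
  let ?Q = "free_functor R \<Gamma>"
  note cQ = free_functor_contravariant[of \<Gamma>]
  have fin: "finite_gens \<Gamma>" and K: "subfunctor R ?Q K" and acK: "\<And>j. \<exists>N. \<forall>n\<ge>N. acyclic_at ?Q K n j"
    and g: "nat_trans R ?Q (P i) g" and gK: "\<And>n x. x \<in> K n \<Longrightarrow> g n x \<in> ker_at P d G e i n"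
    and f: "nat_trans R (P i) ?Q f" and fK: "\<And>n x. x \<in> ker_at P d G e i n \<Longrightarrow> f n x \<in> K n"
    and h: "nat_trans R (P i) (P (Suc i)) h" and r: "nat_trans R (P i) (P i) r"
    and r0: "\<And>n x. x \<in> ker_at P d G e i n \<Longrightarrow> r n x = \<zero>\<^bsub>obj (P i) n\<^esub>"
    and dh: "\<And>n x. x \<in> carrier (obj (P i) n) \<Longrightarrow>
      d i n (h n x) = (x \<ominus>\<^bsub>obj (P i) n\<^esub> g n (f n x)) \<ominus>\<^bsub>obj (P i) n\<^esub> r n x"
    using F unfolding finite_factor_def by blast+
  obtain N where N: "\<And>n. N \<le> n \<Longrightarrow> acyclic_at ?Q K n 0" using acK by blast
  have KC: "K n \<subseteq> carrier (obj ?Q n)" for n by (rule subfunctor_subset[OF cQ K])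
  have "\<exists>(\<Gamma>' :: nat \<Rightarrow> nat set) y. finite_gens \<Gamma>' \<and> (\<forall>m. \<forall>l\<in>\<Gamma>' m. y m l \<in> K m) \<and>
      (\<forall>n. yoneda R ?Q y n ` carrier (free_module R (free_gens \<Gamma>' n)) = K n)"
    using R(1) cQ K free_functor_sub_fin_gen[OF R fin K] N by (rule generated_in_bounded_degrees)
  then obtain \<Gamma>' :: "nat \<Rightarrow> nat set" and y where y: "finite_gens \<Gamma>' \<and> (\<forall>m. \<forall>l\<in>\<Gamma>' m. y m l \<in> K m) \<and>
      (\<forall>n. yoneda R ?Q y n ` carrier (free_module R (free_gens \<Gamma>' n)) = K n)"
    by (elim exE)
  then have fin': "finite_gens \<Gamma>'" and yK: "\<And>m l. l \<in> \<Gamma>' m \<Longrightarrow> y m l \<in> K m"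
    and im: "\<And>n. yoneda R ?Q y n ` carrier (free_module R (free_gens \<Gamma>' n)) = K n"
    by (elim conjE; simp)+
  let ?Q' = "free_functor R \<Gamma>'"
  note cQ' = free_functor_contravariant[of \<Gamma>']
  define \<delta> where "\<delta> = yoneda R ?Q y"
  have yC: "y m l \<in> carrier (obj ?Q m)" if "l \<in> \<Gamma>' m" for m l using yK[OF that] KC[of m] by blast
  have \<delta>: "nat_trans R ?Q' ?Q \<delta>" unfolding \<delta>_def using yC by (rule yoneda_nat_trans[OF cQ])
  have im': "\<delta> n ` carrier (obj ?Q' n) = K n" for n using im[of n] by (simp add: \<delta>_def)
  define K' where "K' n = {x \<in> carrier (obj ?Q' n). \<delta> n x = \<zero>\<^bsub>obj ?Q n\<^esub>}" for n
  have K': "subfunctor R ?Q' K'" unfolding K'_def by (rule subfunctor_kernel[OF cQ' cQ \<delta>])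
  have acK': "\<exists>N. \<forall>n\<ge>N. acyclic_at ?Q' K' n j" for j
    unfolding K'_def by (rule kernel_acyclic[OF R(1) fin' cQ \<delta> im' acK])
  \<comment> \<open>The map \<open>g\<close> carries \<open>K\<close> into a kernel of the given
    resolution, and by exactness this is the image of \<open>d i\<close>; preimages of the
    generators determine \<open>g'\<close>.\<close>
  have "\<forall>m l. \<exists>p. l \<in> \<Gamma>' m \<longrightarrow> p \<in> carrier (obj (P (Suc i)) m) \<and> d i m p = g m (y m l)"
    using gK[OF yK] P(6)[of i] by (metis imageE)
  then obtain y' where y': "\<And>m l. l \<in> \<Gamma>' m \<Longrightarrow> y' m l \<in> carrier (obj (P (Suc i)) m)"
      "\<And>m l. l \<in> \<Gamma>' m \<Longrightarrow> d i m (y' m l) = g m (y m l)" by metis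
  define g' where "g' = yoneda R (P (Suc i)) y'"
  have g': "nat_trans R ?Q' (P (Suc i)) g'" unfolding g'_def using y'(1) by (rule yoneda_nat_trans[OF P(2)])
  have dg': "d i n (g' n x) = g n (\<delta> n x)" if x: "x \<in> carrier (obj ?Q' n)" for n x
  proof -
    have x': "x \<in> carrier (free_module R (free_gens \<Gamma>' n))" using x by simp
    have "d i n (g' n x) = yoneda R (P i) (\<lambda>m l. g m (y m l)) n x"
      unfolding g'_def using y'(1) x' y'(2) by (rule yoneda_natural[OF P(2) P(2) P(3)])
    also have "\<dots> = g n (\<delta> n x)"
      unfolding \<delta>_def by (rule yoneda_natural[OF cQ P(2) g yC x', symmetric]) auto
    finally show ?thesis .
  qed
  have dker: "d i n x \<in> ker_at P d G e i n" if "x \<in> carrier (obj (P (Suc i)) n)" for n x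
    using that P(6)[of i n] by blast
  have dC: "d i n x \<in> carrier (obj (P i) n)" if "x \<in> carrier (obj (P (Suc i)) n)" for n x
    using dker[OF that] by (simp add: ker_at_def)
  have "\<exists>f'. nat_trans R (P (Suc i)) ?Q' f' \<and> (\<forall>n. \<forall>x\<in>carrier (obj (P (Suc i)) n). \<delta> n (f' n x) = f n (d i n x))"
    using fK[OF dker] im' by (intro projective_lift[OF R(1) P(1) cQ' cQ \<delta> nat_trans_comp[OF P(3) f]]) blast
  then obtain f' where f': "nat_trans R (P (Suc i)) ?Q' f'"
      "\<And>n x. x \<in> carrier (obj (P (Suc i)) n) \<Longrightarrow> \<delta> n (f' n x) = f n (d i n x)" by blast
  let ?P = "\<lambda>n. obj (P (Suc i)) n"
  define r' where "r' n x = h n (d i n x)" for n x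
  have r': "nat_trans R (P (Suc i)) (P (Suc i)) r'" unfolding r'_def by (rule nat_trans_comp[OF P(3) h])
  define \<theta> where "\<theta> n x = (x \<ominus>\<^bsub>?P n\<^esub> g' n (f' n x)) \<ominus>\<^bsub>?P n\<^esub> r' n x" for n x
  have \<theta>: "nat_trans R (P (Suc i)) (P (Suc i)) \<theta>"
    unfolding \<theta>_def
    by (rule nat_trans_diff[OF P(2) nat_trans_diff[OF P(2) nat_trans_id[OF P(2)] nat_trans_comp[OF f'(1) g']] r'])
  have \<theta>_ker: "\<theta> n x \<in> ker_at P d G e (Suc i) n" if x: "x \<in> carrier (?P n)" for n x
  proof -
    note m1 = contravariantD(1)[OF P(2), of "Suc i" n] and m0 = contravariantD(1)[OF P(2), of i n]
    note dd = module_hom_diff[OF m1 m0 nat_transD(1)[OF P(3)]]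
    have c: "f' n x \<in> carrier (obj ?Q' n)" "g' n (f' n x) \<in> carrier (?P n)" "r' n x \<in> carrier (?P n)"
      "x \<ominus>\<^bsub>?P n\<^esub> g' n (f' n x) \<in> carrier (?P n)"
      using nat_transD(3)[OF f'(1) x] nat_transD(3)[OF g'] nat_transD(3)[OF r' x] module_diff_closed[OF m1 x] by blast+
    let ?u = "d i n x"
    have u: "?u \<in> carrier (obj (P i) n)" by (rule dC[OF x])
    have gfu: "g n (f n ?u) \<in> carrier (obj (P i) n)"
      using nat_transD(3)[OF f u] nat_transD(3)[OF g] by blast
    have 1: "d i n (g' n (f' n x)) = g n (f n ?u)" using dg'[OF c(1)] f'(2)[OF x] by simp
    have 2: "d i n (r' n x) = ?u \<ominus>\<^bsub>obj (P i) n\<^esub> g n (f n ?u)"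
      unfolding r'_def dh[OF u] r0[OF dker[OF x]]
      by (rule diff_eq_zero(2)[OF m0 module_diff_closed[OF m0 u gfu]])
    have "d i n (\<theta> n x) = (?u \<ominus>\<^bsub>obj (P i) n\<^esub> d i n (g' n (f' n x))) \<ominus>\<^bsub>obj (P i) n\<^esub> d i n (r' n x)"
      unfolding \<theta>_def using c x by (simp add: dd)
    also have "\<dots> = \<zero>\<^bsub>obj (P i) n\<^esub>"
      unfolding 1 2 by (rule diff_eq_zero(1)[OF m0 module_diff_closed[OF m0 u gfu]])
    finally show ?thesis using nat_transD(3)[OF \<theta> x] by (simp add: ker_at_def)
  qed
  have "\<exists>h'. nat_trans R (P (Suc i)) (P (Suc (Suc i))) h' \<and> (\<forall>n. \<forall>x\<in>carrier (?P n). d (Suc i) n (h' n x) = \<theta> n x)"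
    using \<theta>_ker P(6)[of "Suc i"] by (intro projective_lift[OF R(1) P(1) P(2) P(2) P(3) \<theta>]) auto
  then obtain h' where h': "nat_trans R (P (Suc i)) (P (Suc (Suc i))) h'"
      "\<And>n x. x \<in> carrier (?P n) \<Longrightarrow> d (Suc i) n (h' n x) = \<theta> n x" by blast
  have "finite_factor R G P d e (Suc i) \<Gamma>' K' g' f' h' r'"
    unfolding finite_factor_def
  proof (intro conjI)
    show "\<forall>n. \<forall>x\<in>K' n. g' n x \<in> ker_at P d G e (Suc i) n"
      using nat_transD(3)[OF g'] dg' module_hom_zero[OF contravariantD(1)[OF cQ] contravariantD(1)[OF P(2)] nat_transD(1)[OF g]]
      by (auto simp: K'_def ker_at_def)
    show "\<forall>n. \<forall>x\<in>ker_at P d G e (Suc i) n. f' n x \<in> K' n"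
      using nat_transD(3)[OF f'(1)] f'(2) module_hom_zero[OF contravariantD(1)[OF P(2)] contravariantD(1)[OF cQ] nat_transD(1)[OF f]]
      by (auto simp: K'_def ker_at_def)
    show "\<forall>n. \<forall>x\<in>ker_at P d G e (Suc i) n. r' n x = \<zero>\<^bsub>?P n\<^esub>"
      using module_hom_zero[OF contravariantD(1)[OF P(2)] contravariantD(1)[OF P(2)] nat_transD(1)[OF h]]
      by (auto simp: r'_def ker_at_def)
    show "if Suc i = 0 then r' = (\<lambda>n x. \<zero>\<^bsub>obj (P 0) n\<^esub>)
     else \<exists>h'. nat_trans R (P (Suc i - 1)) (P (Suc i)) h' \<and>
       (\<forall>n. \<forall>x\<in>carrier (obj (P (Suc i)) n). r' n x = h' n (d (Suc i - 1) n x))"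
      using h by (auto simp: r'_def)
    show "\<forall>n. \<forall>x\<in>carrier (?P n). d (Suc i) n (h' n x) = (x \<ominus>\<^bsub>?P n\<^esub> g' n (f' n x)) \<ominus>\<^bsub>?P n\<^esub> r' n x"
      using h'(2) by (simp add: \<theta>_def)
  qed (use fin' K' acK' g' f'(1) h'(1) r' in auto)
  then show ?thesis by blast
qed

lemma finite_factor_ex:
  assumes "cring R" "noetherian_ring R" "projective_resolution R (const_functor R) P d e"
  shows "\<exists>\<Gamma> K g f h r. finite_factor R (const_functor R) P d e i \<Gamma> K g f h r"
proof (induction i)
  case 0
  then show ?case using finite_factor_0[OF assms(1,3)] .
next
  case (Suc i)
  then show ?case
    using finite_factor_Suc[OF assms(1,2) const_functor_contravariant[OF assms(1)] assms(3)] by blast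
qed

subsection \<open>The tensor product over the category\<close>

abbreviation tensor :: "('r, 'b) ring_scheme \<Rightarrow> ('r, 'm) ds_functor \<Rightarrow> ('r, 'f) ds_functor \<Rightarrow>
    nat \<Rightarrow> 'm \<Rightarrow> 'f \<Rightarrow> (nat \<times> 'm \<times> 'f \<Rightarrow> 'r) set"
  where "tensor R G F n x y \<equiv> presented_class R (fun_tensor_gens G F) (fun_tensor_rels R G F) (basis R (n, x, y))"

text \<open>The closure properties that put the relators of \<open>fun_tensor\<close> into the free
  module on its generators.\<close>

definition covariant_data :: "('r, 'b) ring_scheme \<Rightarrow> ('r, 'f) ds_functor \<Rightarrow> bool"
  where "covariant_data R F \<longleftrightarrow> (\<forall>n. module R (obj F n)) \<and>
    (\<forall>n m. \<forall>\<alpha>\<in>ds_hom n m. \<forall>y\<in>carrier (obj F n). arr F \<alpha> y \<in> carrier (obj F m))"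

text \<open>A relator is kept as the pair of elements it identifies. Closure, equality of classes
  and compatibility with maps then become case analyses over five kinds of pairs, with the
  subtraction treated once for all of them.\<close>

inductive_set rel_pairs :: "('r, 'b) ring_scheme \<Rightarrow> ('r, 'm) ds_functor \<Rightarrow> ('r, 'f) ds_functor \<Rightarrow>
    ((nat \<times> 'm \<times> 'f \<Rightarrow> 'r) \<times> (nat \<times> 'm \<times> 'f \<Rightarrow> 'r)) set"
  for R :: "('r, 'b) ring_scheme" and G :: "('r, 'm) ds_functor" and F :: "('r, 'f) ds_functor"
  where
    add_left: "\<lbrakk>x \<in> carrier (obj G n); x' \<in> carrier (obj G n); y \<in> carrier (obj F n)\<rbrakk> \<Longrightarrow>
      (basis R (n, x \<oplus>\<^bsub>obj G n\<^esub> x', y),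
       basis R (n, x, y) \<oplus>\<^bsub>free_module R (fun_tensor_gens G F)\<^esub> basis R (n, x', y)) \<in> rel_pairs R G F"
  | add_right: "\<lbrakk>x \<in> carrier (obj G n); y \<in> carrier (obj F n); y' \<in> carrier (obj F n)\<rbrakk> \<Longrightarrow>
      (basis R (n, x, y \<oplus>\<^bsub>obj F n\<^esub> y'),
       basis R (n, x, y) \<oplus>\<^bsub>free_module R (fun_tensor_gens G F)\<^esub> basis R (n, x, y')) \<in> rel_pairs R G F"
  | smult_left: "\<lbrakk>r \<in> carrier R; x \<in> carrier (obj G n); y \<in> carrier (obj F n)\<rbrakk> \<Longrightarrow>
      (basis R (n, r \<odot>\<^bsub>obj G n\<^esub> x, y),
       r \<odot>\<^bsub>free_module R (fun_tensor_gens G F)\<^esub> basis R (n, x, y)) \<in> rel_pairs R G F"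
  | smult_right: "\<lbrakk>r \<in> carrier R; x \<in> carrier (obj G n); y \<in> carrier (obj F n)\<rbrakk> \<Longrightarrow>
      (basis R (n, x, r \<odot>\<^bsub>obj F n\<^esub> y),
       r \<odot>\<^bsub>free_module R (fun_tensor_gens G F)\<^esub> basis R (n, x, y)) \<in> rel_pairs R G F"
  | arr: "\<lbrakk>\<alpha> \<in> ds_hom n m; x \<in> carrier (obj G m); y \<in> carrier (obj F n)\<rbrakk> \<Longrightarrow>
      (basis R (n, arr G \<alpha> x, y), basis R (m, x, arr F \<alpha> y)) \<in> rel_pairs R G F"

lemma fun_tensor_rels_eq:
  "fun_tensor_rels R G F = (\<lambda>(u, v). u \<ominus>\<^bsub>free_module R (fun_tensor_gens G F)\<^esub> v) ` rel_pairs R G F"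
proof (intro equalityI subsetI)
  fix t assume "t \<in> fun_tensor_rels R G F"
  then show "t \<in> (\<lambda>(u, v). u \<ominus>\<^bsub>free_module R (fun_tensor_gens G F)\<^esub> v) ` rel_pairs R G F"
    unfolding fun_tensor_rels_def Let_def
    by (elim UnE CollectE exE conjE) (auto simp del: image_iff intro!: image_eqI[where x = "(u, v)" for u v] rel_pairs.intros)
next
  fix t assume "t \<in> (\<lambda>(u, v). u \<ominus>\<^bsub>free_module R (fun_tensor_gens G F)\<^esub> v) ` rel_pairs R G F"
  then obtain u v where t: "t = u \<ominus>\<^bsub>free_module R (fun_tensor_gens G F)\<^esub> v" and uv: "(u, v) \<in> rel_pairs R G F" by auto
  show "t \<in> fun_tensor_rels R G F"
    using uv
  proof cases
    case add_left
    show ?thesis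
      unfolding t fun_tensor_rels_def Let_def add_left(1,2) by (rule UnI1, rule UnI1, rule UnI1, rule UnI1, use add_left(3-) in blast)
  next
    case add_right
    show ?thesis
      unfolding t fun_tensor_rels_def Let_def add_right(1,2) by (rule UnI1, rule UnI1, rule UnI1, rule UnI2, use add_right(3-) in blast)
  next
    case smult_left
    show ?thesis
      unfolding t fun_tensor_rels_def Let_def smult_left(1,2) by (rule UnI1, rule UnI1, rule UnI2, use smult_left(3-) in blast)
  next
    case smult_right
    show ?thesis
      unfolding t fun_tensor_rels_def Let_def smult_right(1,2) by (rule UnI1, rule UnI2, use smult_right(3-) in blast)
  next
    case arr
    show ?thesis
      unfolding t fun_tensor_rels_def Let_def arr(1,2) by (rule UnI2, use arr(3-) in blast)
  qed
qed

context cring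
begin

lemma rel_pairs_closed:
  assumes G: "contravariant R G" and F: "covariant_data R F" and uv: "(u, v) \<in> rel_pairs R G F"
  shows "u \<in> carrier (free_module R (fun_tensor_gens G F))" "v \<in> carrier (free_module R (fun_tensor_gens G F))"
proof -
  let ?L = "free_module R (fun_tensor_gens G F)"
  interpret L: module R ?L by (rule free_is_module)
  have b: "basis R (n, x, y) \<in> carrier ?L" if "x \<in> carrier (obj G n)" "y \<in> carrier (obj F n)" for n x y
    using that by (intro basis_in_free) (simp add: fun_tensor_gens_def)
  have mG: "x \<oplus>\<^bsub>obj G n\<^esub> x' \<in> carrier (obj G n)" "r \<in> carrier R \<Longrightarrow> r \<odot>\<^bsub>obj G n\<^esub> x \<in> carrier (obj G n)"
    if "x \<in> carrier (obj G n)" "x' \<in> carrier (obj G n)" for n x x' r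
  proof -
    interpret M: module R "obj G n" by (rule contravariantD(1)[OF G])
    show "x \<oplus>\<^bsub>obj G n\<^esub> x' \<in> carrier (obj G n)" "r \<in> carrier R \<Longrightarrow> r \<odot>\<^bsub>obj G n\<^esub> x \<in> carrier (obj G n)"
      using that by auto
  qed
  have mF: "x \<oplus>\<^bsub>obj F n\<^esub> x' \<in> carrier (obj F n)" "r \<in> carrier R \<Longrightarrow> r \<odot>\<^bsub>obj F n\<^esub> x \<in> carrier (obj F n)"
    if "x \<in> carrier (obj F n)" "x' \<in> carrier (obj F n)" for n x x' r
  proof -
    interpret M: module R "obj F n" using F by (simp add: covariant_data_def)
    show "x \<oplus>\<^bsub>obj F n\<^esub> x' \<in> carrier (obj F n)" "r \<in> carrier R \<Longrightarrow> r \<odot>\<^bsub>obj F n\<^esub> x \<in> carrier (obj F n)"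
      using that by auto
  qed
  have aF: "arr F \<alpha> y \<in> carrier (obj F m)" if "\<alpha> \<in> ds_hom n m" "y \<in> carrier (obj F n)" for \<alpha> n m y
    using F that by (auto simp: covariant_data_def)
  show "u \<in> carrier ?L"
    using uv by cases (auto intro!: b mG mF arr_closed[OF G])
  show "v \<in> carrier ?L"
    using uv by cases (auto simp del: free_simps intro!: b aF L.a_closed L.smult_closed)
qed

lemma fun_tensor_rels_closed:
  assumes "contravariant R G" "covariant_data R F"
  shows "fun_tensor_rels R G F \<subseteq> carrier (free_module R (fun_tensor_gens G F))"
  unfolding fun_tensor_rels_eq
proof (rule image_subsetI)
  fix p assume "p \<in> rel_pairs R G F"
  then show "(case p of (u, v) \<Rightarrow> u \<ominus>\<^bsub>free_module R (fun_tensor_gens G F)\<^esub> v) \<in> carrier (free_module R (fun_tensor_gens G F))"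
    using module_diff_closed[OF free_is_module rel_pairs_closed[OF assms]] by (cases p) simp
qed

lemma fun_tensor_is_module:
  assumes "contravariant R G" "covariant_data R F"
  shows "module R (fun_tensor R G F)"
  unfolding fun_tensor_def by (rule presented_is_module[OF fun_tensor_rels_closed[OF assms]])

lemma rel_pairs_eq:
  assumes "contravariant R G" "covariant_data R F" "(u, v) \<in> rel_pairs R G F"
  shows "presented_class R (fun_tensor_gens G F) (fun_tensor_rels R G F) u = presented_class R (fun_tensor_gens G F) (fun_tensor_rels R G F) v"
proof (rule presented_class_eq[OF fun_tensor_rels_closed[OF assms(1,2)] _ rel_pairs_closed[OF assms]])
  interpret L: module R "free_module R (fun_tensor_gens G F)" by (rule free_is_module)
  have "u \<ominus>\<^bsub>free_module R (fun_tensor_gens G F)\<^esub> v \<in> fun_tensor_rels R G F"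
    using assms(3) unfolding fun_tensor_rels_eq by (auto intro!: image_eqI[where x = "(u, v)"])
  then show "u \<ominus>\<^bsub>free_module R (fun_tensor_gens G F)\<^esub> v
      \<in> submodule_span R (free_module R (fun_tensor_gens G F)) (fun_tensor_rels R G F)"
    using L.submodule_span_incl by blast
qed

lemma tensor_closed:
  assumes "contravariant R G" "covariant_data R F" "x \<in> carrier (obj G n)" "y \<in> carrier (obj F n)"
  shows "tensor R G F n x y \<in> carrier (fun_tensor R G F)"
  unfolding fun_tensor_def presented_carrier using assms
  by (intro imageI basis_in_free) (simp add: fun_tensor_gens_def)

lemma tensor_rules:
  assumes G: "contravariant R G" and F: "covariant_data R F"
  shows tensor_add_left: "\<lbrakk>x \<in> carrier (obj G n); x' \<in> carrier (obj G n); y \<in> carrier (obj F n)\<rbrakk> \<Longrightarrow>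
      tensor R G F n (x \<oplus>\<^bsub>obj G n\<^esub> x') y = tensor R G F n x y \<oplus>\<^bsub>fun_tensor R G F\<^esub> tensor R G F n x' y"
    and tensor_add_right: "\<lbrakk>x \<in> carrier (obj G n); y \<in> carrier (obj F n); y' \<in> carrier (obj F n)\<rbrakk> \<Longrightarrow>
      tensor R G F n x (y \<oplus>\<^bsub>obj F n\<^esub> y') = tensor R G F n x y \<oplus>\<^bsub>fun_tensor R G F\<^esub> tensor R G F n x y'"
    and tensor_smult_left: "\<lbrakk>r \<in> carrier R; x \<in> carrier (obj G n); y \<in> carrier (obj F n)\<rbrakk> \<Longrightarrow>
      tensor R G F n (r \<odot>\<^bsub>obj G n\<^esub> x) y = r \<odot>\<^bsub>fun_tensor R G F\<^esub> tensor R G F n x y"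
    and tensor_smult_right: "\<lbrakk>r \<in> carrier R; x \<in> carrier (obj G n); y \<in> carrier (obj F n)\<rbrakk> \<Longrightarrow>
      tensor R G F n x (r \<odot>\<^bsub>obj F n\<^esub> y) = r \<odot>\<^bsub>fun_tensor R G F\<^esub> tensor R G F n x y"
    and tensor_arr: "\<lbrakk>\<alpha> \<in> ds_hom n m; x \<in> carrier (obj G m); y \<in> carrier (obj F n)\<rbrakk> \<Longrightarrow>
      tensor R G F n (arr G \<alpha> x) y = tensor R G F m x (arr F \<alpha> y)"
proof -
  note h = presented_class_hom[OF fun_tensor_rels_closed[OF G F], folded fun_tensor_def]
  have b: "basis R (n, x, y) \<in> carrier (free_module R (fun_tensor_gens G F))"
    if "x \<in> carrier (obj G n)" "y \<in> carrier (obj F n)" for n x y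
    using that by (intro basis_in_free) (simp add: fun_tensor_gens_def)
  note eq = rel_pairs_eq[OF G F]
  show "\<lbrakk>x \<in> carrier (obj G n); x' \<in> carrier (obj G n); y \<in> carrier (obj F n)\<rbrakk> \<Longrightarrow>
      tensor R G F n (x \<oplus>\<^bsub>obj G n\<^esub> x') y = tensor R G F n x y \<oplus>\<^bsub>fun_tensor R G F\<^esub> tensor R G F n x' y"
    using eq[OF rel_pairs.add_left] module_hom_add[OF h] b by metis
  show "\<lbrakk>x \<in> carrier (obj G n); y \<in> carrier (obj F n); y' \<in> carrier (obj F n)\<rbrakk> \<Longrightarrow>
      tensor R G F n x (y \<oplus>\<^bsub>obj F n\<^esub> y') = tensor R G F n x y \<oplus>\<^bsub>fun_tensor R G F\<^esub> tensor R G F n x y'"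
    using eq[OF rel_pairs.add_right] module_hom_add[OF h] b by metis
  show "\<lbrakk>r \<in> carrier R; x \<in> carrier (obj G n); y \<in> carrier (obj F n)\<rbrakk> \<Longrightarrow>
      tensor R G F n (r \<odot>\<^bsub>obj G n\<^esub> x) y = r \<odot>\<^bsub>fun_tensor R G F\<^esub> tensor R G F n x y"
    using eq[OF rel_pairs.smult_left] module_hom_smult[OF h] b by metis
  show "\<lbrakk>r \<in> carrier R; x \<in> carrier (obj G n); y \<in> carrier (obj F n)\<rbrakk> \<Longrightarrow>
      tensor R G F n x (r \<odot>\<^bsub>obj F n\<^esub> y) = r \<odot>\<^bsub>fun_tensor R G F\<^esub> tensor R G F n x y"
    using eq[OF rel_pairs.smult_right] module_hom_smult[OF h] b by metis
  show "\<lbrakk>\<alpha> \<in> ds_hom n m; x \<in> carrier (obj G m); y \<in> carrier (obj F n)\<rbrakk> \<Longrightarrow>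
      tensor R G F n (arr G \<alpha> x) y = tensor R G F m x (arr F \<alpha> y)"
    using eq[OF rel_pairs.arr] .
qed

lemma tensor_zero_left:
  assumes G: "contravariant R G" and F: "covariant_data R F" and y: "y \<in> carrier (obj F n)"
  shows "tensor R G F n \<zero>\<^bsub>obj G n\<^esub> y = \<zero>\<^bsub>fun_tensor R G F\<^esub>"
proof -
  interpret M: module R "obj G n" by (rule contravariantD(1)[OF G])
  interpret T: module R "fun_tensor R G F" by (rule fun_tensor_is_module[OF G F])
  have "tensor R G F n (\<zero> \<odot>\<^bsub>obj G n\<^esub> \<zero>\<^bsub>obj G n\<^esub>) y = \<zero> \<odot>\<^bsub>fun_tensor R G F\<^esub> tensor R G F n \<zero>\<^bsub>obj G n\<^esub> y"
    using y by (intro tensor_smult_left[OF G F]) auto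
  then show ?thesis using tensor_closed[OF G F _ y] by simp
qed

lemma fun_tensor_hom_eqI:
  assumes G: "contravariant R G" and F: "covariant_data R F" and M: "module R M"
    and h: "h \<in> module_hom R (fun_tensor R G F) M" "k \<in> module_hom R (fun_tensor R G F) M"
    and eq: "\<And>n x y. x \<in> carrier (obj G n) \<Longrightarrow> y \<in> carrier (obj F n) \<Longrightarrow> h (tensor R G F n x y) = k (tensor R G F n x y)"
    and z: "z \<in> carrier (fun_tensor R G F)"
  shows "h z = k z"
  using fun_tensor_rels_closed[OF G F] M h[unfolded fun_tensor_def] _ z[unfolded fun_tensor_def]
  by (rule presented_hom_eqI) (use eq in \<open>auto simp: fun_tensor_gens_def\<close>)

lemma fun_tensor_subsetI:
  assumes G: "contravariant R G" and F: "covariant_data R F" and N: "submodule N R (fun_tensor R G F)"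
    and mem: "\<And>n x y. x \<in> carrier (obj G n) \<Longrightarrow> y \<in> carrier (obj F n) \<Longrightarrow> tensor R G F n x y \<in> N"
  shows "carrier (fun_tensor R G F) \<subseteq> N"
  using fun_tensor_rels_closed[OF G F] N[unfolded fun_tensor_def] _ unfolding fun_tensor_def
  by (rule presented_spanI) (use mem in \<open>auto simp: fun_tensor_gens_def\<close>)

text \<open>The map on generators sends each kind of pair to a pair of the same kind. For the two
  kinds that express linearity on the left this is linearity of \<open>\<eta>\<close>, for arrows it
  is naturality, and the two kinds on the right leave the left factor unchanged.\<close>

lemma fun_tensor_map:
  assumes G: "contravariant R G" and H: "contravariant R H" and F: "covariant_data R F"
    and \<eta>: "nat_trans R G H \<eta>"
  shows fun_tensor_map_hom: "fun_tensor_map R H F \<eta> \<in> module_hom R (fun_tensor R G F) (fun_tensor R H F)"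
    and fun_tensor_map_tensor: "x \<in> carrier (obj G n) \<Longrightarrow> y \<in> carrier (obj F n) \<Longrightarrow>
      fun_tensor_map R H F \<eta> (tensor R G F n x y) = tensor R H F n (\<eta> n x) y"
proof -
  let ?\<phi> = "\<lambda>(n, x, y). (n, \<eta> n x, y)"
  let ?L = "free_module R (fun_tensor_gens G F)" and ?L' = "free_module R (fun_tensor_gens H F)"
  interpret L: module R ?L by (rule free_is_module)
  interpret L': module R ?L' by (rule free_is_module)
  have \<phi>: "?\<phi> \<in> fun_tensor_gens G F \<rightarrow> fun_tensor_gens H F"
    using nat_transD(3)[OF \<eta>] by (auto simp: fun_tensor_gens_def)
  note fm = free_map_hom[OF \<phi>]
  have b: "basis R (n, x, y) \<in> carrier ?L"
    if "x \<in> carrier (obj G n)" "y \<in> carrier (obj F n)" for n x y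
    using that by (intro basis_in_free) (simp add: fun_tensor_gens_def)
  have pairs: "(free_map R ?\<phi> u, free_map R ?\<phi> v) \<in> rel_pairs R H F" if "(u, v) \<in> rel_pairs R G F" for u v
    using that
  proof cases
    case (add_left x n x' y)
    then show ?thesis
      using rel_pairs.add_left[OF nat_transD(3)[OF \<eta> add_left(3)] nat_transD(3)[OF \<eta> add_left(4)] add_left(5), of R]
      by (simp add: module_hom_add[OF fm] b free_map_basis module_hom_add[OF nat_transD(1)[OF \<eta>]] del: free_simps)
  next
    case (add_right x n y y')
    then show ?thesis
      using rel_pairs.add_right[OF nat_transD(3)[OF \<eta> add_right(3)] add_right(4,5), of R]
      by (simp add: module_hom_add[OF fm] b free_map_basis del: free_simps)
  next
    case (smult_left r x n y)
    then show ?thesis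
      using rel_pairs.smult_left[OF smult_left(3) nat_transD(3)[OF \<eta> smult_left(4)] smult_left(5)]
      by (simp add: module_hom_smult[OF fm] b free_map_basis module_hom_smult[OF nat_transD(1)[OF \<eta>]] del: free_simps)
  next
    case (smult_right r x n y)
    then show ?thesis
      using rel_pairs.smult_right[OF smult_right(3) nat_transD(3)[OF \<eta> smult_right(4)] smult_right(5)]
      by (simp add: module_hom_smult[OF fm] b free_map_basis del: free_simps)
  next
    case (arr \<alpha> n m x y)
    then show ?thesis
      using rel_pairs.arr[OF arr(3) nat_transD(3)[OF \<eta> arr(4)] arr(5), of R]
      by (simp add: free_map_basis nat_transD(2)[OF \<eta>])
  qed
  have rel: "free_map R ?\<phi> t \<in> submodule_span R ?L' (fun_tensor_rels R H F)" if t: "t \<in> fun_tensor_rels R G F" for t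
  proof -
    obtain u v where uv: "t = u \<ominus>\<^bsub>?L\<^esub> v" "(u, v) \<in> rel_pairs R G F" using t unfolding fun_tensor_rels_eq by auto
    have "free_map R ?\<phi> t = free_map R ?\<phi> u \<ominus>\<^bsub>?L'\<^esub> free_map R ?\<phi> v"
      unfolding uv(1) by (rule module_hom_diff[OF L.module_axioms L'.module_axioms fm rel_pairs_closed[OF G F uv(2)]])
    also have "\<dots> \<in> fun_tensor_rels R H F"
      unfolding fun_tensor_rels_eq using pairs[OF uv(2)] by (auto intro!: image_eqI)
    finally show ?thesis using L'.submodule_span_incl by blast
  qed
  note T = fun_tensor_rels_closed[OF G F] and T' = fun_tensor_rels_closed[OF H F]
  show "fun_tensor_map R H F \<eta> \<in> module_hom R (fun_tensor R G F) (fun_tensor R H F)"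
    unfolding fun_tensor_map_def fun_tensor_def using T T' \<phi> rel by (rule presented_map_hom)
  assume "x \<in> carrier (obj G n)" "y \<in> carrier (obj F n)"
  then show "fun_tensor_map R H F \<eta> (tensor R G F n x y) = tensor R H F n (\<eta> n x) y"
    unfolding fun_tensor_map_def
    by (subst presented_map_class[OF T T' \<phi> rel b]) (auto simp: free_map_basis)
qed

end

subsection \<open>Finite generation of Tor\<close>

lemma (in abelian_group) add_diff_diff_cancel:
  assumes "a \<in> carrier G" "b \<in> carrier G" "x \<in> carrier G"
  shows "a \<oplus> ((x \<ominus> a) \<ominus> b) \<oplus> b = x"
proof -
  have "(x \<ominus> a) \<ominus> b = \<ominus> a \<oplus> (x \<oplus> \<ominus> b)" using assms by (simp add: a_minus_def a_ac)
  then have "a \<oplus> ((x \<ominus> a) \<ominus> b) = x \<oplus> \<ominus> b" using assms by (simp add: r_neg2)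
  then show ?thesis using assms by (simp add: a_assoc l_neg)
qed

lemma module_hom_sum:
  assumes "module R M" "module R N" "h \<in> module_hom R M N" "k \<in> module_hom R M N"
  shows "(\<lambda>x. h x \<oplus>\<^bsub>N\<^esub> k x) \<in> module_hom R M N"
proof -
  interpret N: module R N by fact
  note c = module_hom_closed[OF assms(3)] module_hom_closed[OF assms(4)]
  show ?thesis
    by (intro module_homI) (auto simp: c module_hom_add[OF assms(3)] module_hom_add[OF assms(4)]
        module_hom_smult[OF assms(3)] module_hom_smult[OF assms(4)] N.smult_r_distr N.M.a_ac)
qed

text \<open>In the tensor product an arrow acting on the left factor may be moved to the right one,
  so a tensor whose left factor comes from a generator by pullback can be rewritten at the object of
  that generator. The generators are finite in number and each module of \<open>F\<close> is
  finitely generated, so finitely many tensors span. The argument stays inside the tensor product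
  with \<open>P\<close>, so that with the free functor is never computed.\<close>

lemma finite_type_image:
  fixes F :: "('r, 'f) ds_functor"
  assumes R: "cring R" and P: "contravariant R P" and F: "covariant_data R F"
    and fgF: "\<And>n. fin_gen_module R (obj F n)"
    and \<Gamma>: "finite_gens \<Gamma>" and g: "nat_trans R (free_functor R \<Gamma>) P g"
  shows "\<exists>S. finite S \<and> S \<subseteq> carrier (fun_tensor R P F) \<and>
    (\<forall>n. \<forall>q\<in>carrier (obj (free_functor R \<Gamma>) n). \<forall>y\<in>carrier (obj F n).
      tensor R P F n (g n q) y \<in> submodule_span R (fun_tensor R P F) S)"
proof -
  interpret cring R by fact
  let ?T = "fun_tensor R P F" and ?Q = "free_functor R \<Gamma>"
  interpret T: module R ?T by (rule fun_tensor_is_module[OF P F])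
  note cQ = free_functor_contravariant[of \<Gamma>]
  have "\<forall>n. \<exists>Y. finite Y \<and> Y \<subseteq> carrier (obj F n) \<and> submodule_span R (obj F n) Y = carrier (obj F n)"
    using fgF by (simp add: fin_gen_module_def)
  then obtain Y where Y: "\<And>n. finite (Y n)" "\<And>n. Y n \<subseteq> carrier (obj F n)"
      "\<And>n. submodule_span R (obj F n) (Y n) = carrier (obj F n)" by metis
  obtain B where B: "\<And>m. B < m \<Longrightarrow> \<Gamma> m = {}" using \<Gamma> by (auto simp: finite_gens_def)
  define u where "u m l = g m (basis R (ds_id m, l))" for m l
  define S where "S = (\<Union>m\<in>{..B}. (\<lambda>(l, y). tensor R P F m (u m l) y) ` (\<Gamma> m \<times> Y m))"
  have finS: "finite S" using \<Gamma> Y(1) by (auto simp: S_def finite_gens_def)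
  have uC: "u m l \<in> carrier (obj P m)" if "l \<in> \<Gamma> m" for m l
    unfolding u_def using basis_in_free[OF free_gens_id[of l \<Gamma> m]] that by (intro nat_transD(3)[OF g]) simp
  have SC: "S \<subseteq> carrier ?T"
  proof
    fix s assume "s \<in> S"
    then obtain m l y where s: "s = tensor R P F m (u m l) y" "l \<in> \<Gamma> m" "y \<in> Y m" by (auto simp: S_def)
    show "s \<in> carrier ?T" unfolding s(1) using uC[OF s(2)] s(3) Y(2)[of m] by (intro tensor_closed[OF P F]) auto
  qed
  let ?W = "submodule_span R ?T S"
  have W: "submodule ?W R ?T" by (rule T.submodule_span_submodule[OF SC])
  note W' = W[unfolded T.submodule_iff]
  have tuW: "tensor R P F m (u m l) y \<in> ?W" if l: "l \<in> \<Gamma> m" and y: "y \<in> carrier (obj F m)" for m l y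
  proof -
    interpret Fm: module R "obj F m" using F by (simp add: covariant_data_def)
    have "m \<le> B" using l B[of m] by (cases "B < m") auto
    then have "Y m \<subseteq> {y \<in> carrier (obj F m). tensor R P F m (u m l) y \<in> ?W}"
      using l Y(2)[of m] T.submodule_span_incl[of S] by (fastforce simp: S_def)
    moreover have "submodule {y \<in> carrier (obj F m). tensor R P F m (u m l) y \<in> ?W} R (obj F m)"
      unfolding Fm.submodule_iff
    proof (intro conjI ballI)
      have "tensor R P F m (u m l) (\<zero>\<^bsub>R\<^esub> \<odot>\<^bsub>obj F m\<^esub> \<zero>\<^bsub>obj F m\<^esub>) = \<zero>\<^bsub>R\<^esub> \<odot>\<^bsub>?T\<^esub> tensor R P F m (u m l) \<zero>\<^bsub>obj F m\<^esub>"
        using uC[OF l] by (intro tensor_smult_right[OF P F]) auto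
      then show "\<zero>\<^bsub>obj F m\<^esub> \<in> {y \<in> carrier (obj F m). tensor R P F m (u m l) y \<in> ?W}"
        using W' tensor_closed[OF P F uC[OF l], of "\<zero>\<^bsub>obj F m\<^esub>"] by simp
    qed (use W' uC[OF l] in \<open>auto simp: tensor_add_right[OF P F] tensor_smult_right[OF P F]\<close>)
    ultimately show ?thesis using Fm.submodule_span_least[of _ "Y m"] Y(3)[of m] y by blast
  qed
  have "tensor R P F n (g n q) y \<in> ?W" if q: "q \<in> carrier (obj ?Q n)" and y: "y \<in> carrier (obj F n)" for n q y
  proof -
    interpret Qn: module R "free_module R (free_gens \<Gamma> n)" by (rule free_is_module)
    interpret Pn: module R "obj P n" by (rule contravariantD(1)[OF P])
    note gh = nat_transD(1)[OF g, of n, unfolded free_functor_simps(1)]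
    note gc = module_hom_closed[OF gh]
    let ?L = "{q \<in> carrier (free_module R (free_gens \<Gamma> n)). tensor R P F n (g n q) y \<in> ?W}"
    have "carrier (free_module R (free_gens \<Gamma> n)) \<subseteq> ?L"
    proof (rule free_spanI)
      show "submodule ?L R (free_module R (free_gens \<Gamma> n))"
        unfolding Qn.submodule_iff
      proof (intro conjI ballI)
        show "\<zero>\<^bsub>free_module R (free_gens \<Gamma> n)\<^esub> \<in> ?L"
          using module_hom_zero[OF Qn.module_axioms Pn.module_axioms gh] tensor_zero_left[OF P F y] W'
          by (simp del: free_simps)
      next
        fix a b assume ab: "a \<in> ?L" "b \<in> ?L"
        then have "tensor R P F n (g n (a \<oplus>\<^bsub>free_module R (free_gens \<Gamma> n)\<^esub> b)) y
            = tensor R P F n (g n a) y \<oplus>\<^bsub>?T\<^esub> tensor R P F n (g n b) y"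
          using tensor_add_left[OF P F gc gc y] module_hom_add[OF gh] by simp
        then show "a \<oplus>\<^bsub>free_module R (free_gens \<Gamma> n)\<^esub> b \<in> ?L"
          using ab W' Qn.a_closed[of a b] by (simp del: free_simps)
      next
        fix r a assume ra: "r \<in> carrier R" "a \<in> ?L"
        then have "tensor R P F n (g n (r \<odot>\<^bsub>free_module R (free_gens \<Gamma> n)\<^esub> a)) y
            = r \<odot>\<^bsub>?T\<^esub> tensor R P F n (g n a) y"
          using tensor_smult_left[OF P F ra(1) gc y] module_hom_smult[OF gh ra(1)] by simp
        then show "r \<odot>\<^bsub>free_module R (free_gens \<Gamma> n)\<^esub> a \<in> ?L"
          using ra W' Qn.smult_closed[of r a] by (simp del: free_simps)
      qed auto
    next
      fix s assume s: "s \<in> free_gens \<Gamma> n"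
      obtain \<alpha> l where sl: "s = (\<alpha>, l)" by (cases s)
      define m where "m = tgt \<alpha>"
      have a: "\<alpha> \<in> ds_hom n m" "l \<in> \<Gamma> m" using s by (auto simp: sl free_gens_def m_def)
      note b = basis_in_free[OF free_gens_id[of l \<Gamma> m, OF a(2)]]
      \<comment> \<open>The basis element \<open>(\<alpha>, l)\<close> is the pullback of the
        generator \<open>(ds_id m, l)\<close> along \<open>\<alpha>\<close>; naturality of
        \<open>g\<close> gives the form to which \<open>tensor_arr\<close> applies.\<close>
      have "g n (basis R s) = g n (arr ?Q \<alpha> (basis R (ds_id m, l)))"
        using ds_comp_id_left[OF a(1)] by (simp add: free_map_basis sl)
      also have "\<dots> = arr P \<alpha> (u m l)" unfolding u_def using b by (intro nat_transD(2)[OF g a(1)]) simp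
      finally have "tensor R P F n (g n (basis R s)) y = tensor R P F m (u m l) (arr F \<alpha> y)"
        using tensor_arr[OF P F a(1) uC[OF a(2)] y] by simp
      moreover have "arr F \<alpha> y \<in> carrier (obj F m)" using F a(1) y by (auto simp: covariant_data_def)
      ultimately show "basis R s \<in> ?L" using tuW[OF a(2)] basis_in_free[OF s] by simp
    qed
    then show ?thesis using q by auto
  qed
  then show ?thesis using finS SC by blast
qed

text \<open>Tensoring 1 = g f + d h + r with \<open>F\<close> writes every z as \<Phi> z + d(H z) +
  \<rho> z. On cycles \<rho> vanishes, since r is zero in degree 0 and otherwise factors through the
  preceding differential. Hence a cycle is homologous to \<Phi> z, which is again a cycle and lies
  in the finitely generated span of the tensors from the free functor.\<close>

theorem ds_tor_fin_gen:
  fixes P :: "nat \<Rightarrow> ('r, 'm) ds_functor" and F :: "('r, 'f) ds_functor"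
  assumes R: "cring R" "noetherian_ring R" and res: "projective_resolution R (const_functor R) P d e"
    and F: "covariant_data R F" and fgF: "\<And>n. fin_gen_module R (obj F n)"
  shows "fin_gen_module R (ds_tor R P d F i)"
proof -
  interpret cring R by (rule R(1))
  note PD = projective_resolutionD[OF res]
  note cP = PD(2)
  obtain \<Gamma> K g f h r where ff: "finite_factor R (const_functor R) P d e i \<Gamma> K g f h r"
    using finite_factor_ex[OF R res] by blast
  have fin: "finite_gens \<Gamma>" and g: "nat_trans R (free_functor R \<Gamma>) (P i) g"
    and f: "nat_trans R (P i) (free_functor R \<Gamma>) f" and h: "nat_trans R (P i) (P (Suc i)) h"
    and r: "nat_trans R (P i) (P i) r"
    and dh: "\<And>n x. x \<in> carrier (obj (P i) n) \<Longrightarrow>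
      d i n (h n x) = (x \<ominus>\<^bsub>obj (P i) n\<^esub> g n (f n x)) \<ominus>\<^bsub>obj (P i) n\<^esub> r n x"
    and r': "if i = 0 then r = (\<lambda>n x. \<zero>\<^bsub>obj (P 0) n\<^esub>)
     else \<exists>h'. nat_trans R (P (i - 1)) (P i) h' \<and>
       (\<forall>n. \<forall>x\<in>carrier (obj (P i) n). r n x = h' n (d (i - 1) n x))"
    using ff unfolding finite_factor_def by (elim conjE; simp)+
  let ?T = "\<lambda>i. fun_tensor R (P i) F"
  let ?D = "\<lambda>i. fun_tensor_map R (P i) F (d i)"
  interpret T: module R "?T i" by (rule fun_tensor_is_module[OF cP F])
  note mT = fun_tensor_is_module[OF cP F]
  note Dh = fun_tensor_map_hom[OF cP cP F PD(3)] and Dt = fun_tensor_map_tensor[OF cP cP F PD(3)]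
  define \<Phi> where "\<Phi> = fun_tensor_map R (P i) F (\<lambda>n x. g n (f n x))"
  define \<rho> where "\<rho> = fun_tensor_map R (P i) F r"
  define H where "H = fun_tensor_map R (P (Suc i)) F h"
  note gf = nat_trans_comp[OF f g]
  note \<Phi>h = fun_tensor_map_hom[OF cP cP F gf, folded \<Phi>_def] and \<Phi>t = fun_tensor_map_tensor[OF cP cP F gf, folded \<Phi>_def]
  note \<rho>h = fun_tensor_map_hom[OF cP cP F r, folded \<rho>_def] and \<rho>t = fun_tensor_map_tensor[OF cP cP F r, folded \<rho>_def]
  note Hh = fun_tensor_map_hom[OF cP cP F h, folded H_def] and Ht = fun_tensor_map_tensor[OF cP cP F h, folded H_def]
  have split: "z = (\<Phi> z \<oplus>\<^bsub>?T i\<^esub> ?D i (H z)) \<oplus>\<^bsub>?T i\<^esub> \<rho> z" if z: "z \<in> carrier (?T i)" for z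
  proof (rule fun_tensor_hom_eqI[where h = "\<lambda>z. z" and k = "\<lambda>z. (\<Phi> z \<oplus>\<^bsub>?T i\<^esub> ?D i (H z)) \<oplus>\<^bsub>?T i\<^esub> \<rho> z", OF cP F mT _ _ _ z])
    show "(\<lambda>z. z) \<in> module_hom R (?T i) (?T i)" by (simp add: module_hom_def)
    show "(\<lambda>z. (\<Phi> z \<oplus>\<^bsub>?T i\<^esub> ?D i (H z)) \<oplus>\<^bsub>?T i\<^esub> \<rho> z) \<in> module_hom R (?T i) (?T i)"
      by (intro module_hom_sum mT \<Phi>h \<rho>h module_hom_compose[OF Hh Dh])
    fix n x y assume x: "x \<in> carrier (obj (P i) n)" and y: "y \<in> carrier (obj F n)"
    interpret M: module R "obj (P i) n" by (rule contravariantD(1)[OF cP])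
    have c: "g n (f n x) \<in> carrier (obj (P i) n)" "h n x \<in> carrier (obj (P (Suc i)) n)"
      "r n x \<in> carrier (obj (P i) n)" "d i n (h n x) \<in> carrier (obj (P i) n)"
      using nat_transD(3)[OF gf x] nat_transD(3)[OF h x] nat_transD(3)[OF r x] nat_transD(3)[OF PD(3)] by auto
    have "x = (g n (f n x) \<oplus>\<^bsub>obj (P i) n\<^esub> d i n (h n x)) \<oplus>\<^bsub>obj (P i) n\<^esub> r n x"
      unfolding dh[OF x] using c x by (simp add: M.M.add_diff_diff_cancel)
    then have "tensor R (P i) F n x y
        = tensor R (P i) F n ((g n (f n x) \<oplus>\<^bsub>obj (P i) n\<^esub> d i n (h n x)) \<oplus>\<^bsub>obj (P i) n\<^esub> r n x) y" by simp
    also have "\<dots> = (tensor R (P i) F n (g n (f n x)) y \<oplus>\<^bsub>?T i\<^esub> tensor R (P i) F n (d i n (h n x)) y)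
        \<oplus>\<^bsub>?T i\<^esub> tensor R (P i) F n (r n x) y"
      using c y by (simp add: tensor_add_left[OF cP F])
    finally show "tensor R (P i) F n x y = (\<Phi> (tensor R (P i) F n x y) \<oplus>\<^bsub>?T i\<^esub> ?D i (H (tensor R (P i) F n x y)))
        \<oplus>\<^bsub>?T i\<^esub> \<rho> (tensor R (P i) F n x y)"
      using \<Phi>t[OF x y] \<rho>t[OF x y] Ht[OF x y] Dt[OF c(2) y] by simp
  qed
  have zero_map: "\<xi> z = \<zero>\<^bsub>?T j\<^esub>"
    if hh: "\<xi> \<in> module_hom R (?T l) (?T j)" and h0: "\<And>n x y. x \<in> carrier (obj (P l) n) \<Longrightarrow> y \<in> carrier (obj F n) \<Longrightarrow>
      \<xi> (tensor R (P l) F n x y) = \<zero>\<^bsub>?T j\<^esub>" and z: "z \<in> carrier (?T l)" for \<xi> l j z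
  proof -
    interpret Tj: module R "?T j" by (rule mT)
    have "(\<lambda>_. \<zero>\<^bsub>?T j\<^esub>) \<in> module_hom R (?T l) (?T j)" by (intro module_homI) auto
    from fun_tensor_hom_eqI[where k = "\<lambda>_. \<zero>\<^bsub>?T j\<^esub>", OF cP F mT hh this h0 z] show ?thesis .
  qed
  let ?Z = "cycles ?T ?D i"
  have ZC: "?Z \<subseteq> carrier (?T i)" by (cases i) auto
  have Z: "submodule ?Z R (?T i)"
  proof (cases i)
    case 0
    then show ?thesis using module.carrier_is_submodule[OF mT] by simp
  next
    case (Suc k)
    interpret Tk: module R "?T k" by (rule mT)
    have "submodule {\<zero>\<^bsub>?T k\<^esub>} R (?T k)" by (auto simp: Tk.submodule_iff)
    from hom_preimage_submodule[OF mT mT Dh this] show ?thesis by (simp add: Suc)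
  qed
  have rho0: "\<rho> z = \<zero>\<^bsub>?T i\<^esub>" if z: "z \<in> ?Z" for z
  proof (cases i)
    case 0
    have "\<rho> (tensor R (P i) F n x y) = \<zero>\<^bsub>?T i\<^esub>" if "x \<in> carrier (obj (P i) n)" "y \<in> carrier (obj F n)" for n x y
      using \<rho>t[OF that] r' 0 tensor_zero_left[OF cP F that(2), of i] by simp
    then show ?thesis using zero_map[OF \<rho>h] z ZC by blast
  next
    case (Suc k)
    then obtain h' where h': "nat_trans R (P k) (P i) h'" "\<And>n x. x \<in> carrier (obj (P i) n) \<Longrightarrow> r n x = h' n (d k n x)"
      using r' by auto
    let ?H' = "fun_tensor_map R (P i) F h'"
    note h'h = fun_tensor_map_hom[OF cP cP F h'(1)] and h't = fun_tensor_map_tensor[OF cP cP F h'(1)]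
    have Dk: "?D k \<in> module_hom R (?T i) (?T k)" using Dh[of k] Suc by simp
    have zc: "z \<in> carrier (?T i)" "?D k z = \<zero>\<^bsub>?T k\<^esub>" using z Suc by auto
    have "\<rho> z = ?H' (?D k z)"
    proof (rule fun_tensor_hom_eqI[where h = \<rho> and k = "\<lambda>z. ?H' (?D k z)", OF cP F mT \<rho>h module_hom_compose[OF Dk h'h] _ zc(1)])
      fix n x y assume x: "x \<in> carrier (obj (P i) n)" and y: "y \<in> carrier (obj F n)"
      have dx: "d k n x \<in> carrier (obj (P k) n)" using nat_transD(3)[OF PD(3)[of k]] x Suc by simp
      have "?D k (tensor R (P i) F n x y) = tensor R (P k) F n (d k n x) y"
        using Dt[of x k n y] x y Suc by simp
      then show "\<rho> (tensor R (P i) F n x y) = ?H' (?D k (tensor R (P i) F n x y))"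
        using \<rho>t[OF x y] h't[OF dx y] h'(2)[OF x] by simp
    qed
    then show ?thesis using zc(2) module_hom_zero[OF mT mT h'h] by simp
  qed
  let ?B = "?D i ` carrier (?T (Suc i))"
  have B: "submodule ?B R (?T i)"
    by (rule hom_image_submodule[OF mT mT Dh module.carrier_is_submodule[OF mT]])
  have BZ: "?B \<subseteq> ?Z"
  proof (cases i)
    case 0
    then show ?thesis using module_hom_closed[OF Dh[of i]] by auto
  next
    case (Suc k)
    have Dk: "?D k \<in> module_hom R (?T i) (?T k)" using Dh[of k] Suc by simp
    have "?D k (?D i z) = \<zero>\<^bsub>?T k\<^esub>" if z: "z \<in> carrier (?T (Suc i))" for z
    proof (rule zero_map[OF module_hom_compose[OF Dh Dk] _ z])
      fix n x y assume x: "x \<in> carrier (obj (P (Suc i)) n)" and y: "y \<in> carrier (obj F n)"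
      have dx: "d i n x \<in> ker_at P d (const_functor R) e i n" using PD(6)[of i n] x by blast
      then have dx': "d i n x \<in> carrier (obj (P (Suc k)) n)" "d k n (d i n x) = \<zero>\<^bsub>obj (P k) n\<^esub>"
        using Suc by (auto simp: ker_at_def)
      show "?D k (?D i (tensor R (P (Suc i)) F n x y)) = \<zero>\<^bsub>?T k\<^esub>"
        using Dt[OF x y] Dt[OF dx'(1) y] dx'(2) tensor_zero_left[OF cP F y, of k] Suc by simp
    qed
    then show ?thesis using module_hom_closed[OF Dh[of i]] Suc by auto
  qed
  obtain S where S: "finite S" "S \<subseteq> carrier (?T i)"
      "\<And>n q y. q \<in> carrier (obj (free_functor R \<Gamma>) n) \<Longrightarrow> y \<in> carrier (obj F n) \<Longrightarrow>
        tensor R (P i) F n (g n q) y \<in> submodule_span R (?T i) S"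
    using finite_type_image[OF R(1) cP F fgF fin g] by blast
  let ?W = "submodule_span R (?T i) S"
  have W: "submodule ?W R (?T i)" by (rule T.submodule_span_submodule[OF S(2)])
  have "carrier (?T i) \<subseteq> {z \<in> carrier (?T i). \<Phi> z \<in> ?W}"
  proof (rule fun_tensor_subsetI[OF cP F hom_preimage_submodule[OF mT mT \<Phi>h W]])
    fix n x y assume x: "x \<in> carrier (obj (P i) n)" and y: "y \<in> carrier (obj F n)"
    then show "tensor R (P i) F n x y \<in> {z \<in> carrier (?T i). \<Phi> z \<in> ?W}"
      using S(3)[OF nat_transD(3)[OF f x] y] \<Phi>t[OF x y] tensor_closed[OF cP F x y] by simp
  qed
  then have \<Phi>W: "\<Phi> z \<in> ?W" if "z \<in> carrier (?T i)" for z using that by blast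
  \<comment> \<open>The elements of \<open>S\<close> need not be cycles, so the cycles in their span
    receive generators of their own; besides the syzygies, this is where the ground ring has to be
    Noetherian.\<close>
  have WZ: "submodule (?W \<inter> ?Z) R (?T i)" using W Z unfolding T.submodule_iff by auto
  obtain S' where S': "finite S'" "S' \<subseteq> ?W \<inter> ?Z" "submodule_span R (?T i) S' = ?W \<inter> ?Z"
    using submodule_of_fin_gen[OF R mT S(1,2) WZ] by auto
  have gen: "\<exists>b\<in>?B. \<exists>y\<in>submodule_span R (?T i) S'. z = b \<oplus>\<^bsub>?T i\<^esub> y" if z: "z \<in> ?Z" for z
  proof -
    have zc: "z \<in> carrier (?T i)" using z ZC by blast
    have c: "\<Phi> z \<in> carrier (?T i)" "?D i (H z) \<in> ?B" "?D i (H z) \<in> carrier (?T i)"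
      using module_hom_closed[OF \<Phi>h zc] module_hom_closed[OF Hh zc] module_hom_closed[OF Dh] by auto
    have eq: "z = ?D i (H z) \<oplus>\<^bsub>?T i\<^esub> \<Phi> z"
      using split[OF zc] rho0[OF z] c by (simp add: T.M.a_comm)
    have "\<Phi> z = \<ominus>\<^bsub>?T i\<^esub> ?D i (H z) \<oplus>\<^bsub>?T i\<^esub> z"
      by (subst (2) eq) (simp add: c T.M.r_neg1)
    moreover have "\<ominus>\<^bsub>?T i\<^esub> ?D i (H z) \<in> ?Z" using BZ c(2) T.submoduleE(3)[OF Z] by blast
    ultimately have "\<Phi> z \<in> ?Z" using T.submoduleE(5)[OF Z] z by simp
    then have "\<Phi> z \<in> submodule_span R (?T i) S'" using \<Phi>W[OF zc] S'(3) by blast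
    then show ?thesis using eq c(2) by blast
  qed
  have "S' \<subseteq> ?Z" using S'(2) by blast
  then show ?thesis
    unfolding ds_tor_def homology_def using gen
    by (intro T.fin_gen_subquotI[OF Z B BZ S'(1)]) auto
qed

subsection \<open>The symmetric bar construction\<close>

text \<open>The map of generators from \<open>bar_sym\<close>, named so that its multilinearity can
  be stated.\<close>

definition bar_map :: "('r, 'a, 'c) module_scheme \<Rightarrow> ds_mor \<Rightarrow> 'a list \<Rightarrow> 'a list"
  where "bar_map A \<alpha> as = map (\<lambda>j. foldr (\<otimes>\<^bsub>A\<^esub>) (map (\<lambda>i. as ! i) (fib \<alpha> j)) \<one>\<^bsub>A\<^esub>) [0..<Suc (tgt \<alpha>)]"

inductive_set tensor_power_pairs :: "('r, 'b) ring_scheme \<Rightarrow> ('r, 'a, 'c) module_scheme \<Rightarrow> nat \<Rightarrow>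
    (('a list \<Rightarrow> 'r) \<times> ('a list \<Rightarrow> 'r)) set"
  for R :: "('r, 'b) ring_scheme" and A :: "('r, 'a, 'c) module_scheme" and k :: nat
  where
    add: "\<lbrakk>as \<in> tensor_power_gens A k; i < k; x \<in> carrier A; y \<in> carrier A\<rbrakk> \<Longrightarrow>
      (basis R (as[i := x \<oplus>\<^bsub>A\<^esub> y]),
       basis R (as[i := x]) \<oplus>\<^bsub>free_module R (tensor_power_gens A k)\<^esub> basis R (as[i := y])) \<in> tensor_power_pairs R A k"
  | smult: "\<lbrakk>as \<in> tensor_power_gens A k; i < k; r \<in> carrier R; x \<in> carrier A\<rbrakk> \<Longrightarrow>
      (basis R (as[i := r \<odot>\<^bsub>A\<^esub> x]),
       r \<odot>\<^bsub>free_module R (tensor_power_gens A k)\<^esub> basis R (as[i := x])) \<in> tensor_power_pairs R A k"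

lemma tensor_power_rels_eq:
  "tensor_power_rels R A k = (\<lambda>(u, v). u \<ominus>\<^bsub>free_module R (tensor_power_gens A k)\<^esub> v) ` tensor_power_pairs R A k"
proof (intro equalityI subsetI)
  fix t assume "t \<in> tensor_power_rels R A k"
  then show "t \<in> (\<lambda>(u, v). u \<ominus>\<^bsub>free_module R (tensor_power_gens A k)\<^esub> v) ` tensor_power_pairs R A k"
    unfolding tensor_power_rels_def Let_def
    by (elim UnE CollectE exE conjE)
      (auto simp del: image_iff intro!: image_eqI[where x = "(u, v)" for u v] tensor_power_pairs.intros)
next
  fix t assume "t \<in> (\<lambda>(u, v). u \<ominus>\<^bsub>free_module R (tensor_power_gens A k)\<^esub> v) ` tensor_power_pairs R A k"
  then obtain u v where t: "t = u \<ominus>\<^bsub>free_module R (tensor_power_gens A k)\<^esub> v"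
    and uv: "(u, v) \<in> tensor_power_pairs R A k" by auto
  show "t \<in> tensor_power_rels R A k"
    using uv
  proof cases
    case add
    show ?thesis
      unfolding t tensor_power_rels_def Let_def add(1,2) by (rule UnI1, use add(3-) in blast)
  next
    case smult
    show ?thesis
      unfolding t tensor_power_rels_def Let_def smult(1,2) by (rule UnI2, use smult(3-) in blast)
  qed
qed

context assoc_algebra
begin

lemma gens_update: "as \<in> tensor_power_gens A k \<Longrightarrow> x \<in> carrier A \<Longrightarrow> as[i := x] \<in> tensor_power_gens A k"
  using set_update_subset_insert[of as i x] by (auto simp: tensor_power_gens_def)

lemma gens_nth: "as \<in> tensor_power_gens A k \<Longrightarrow> i < k \<Longrightarrow> as ! i \<in> carrier A"
  by (auto simp: tensor_power_gens_def)

lemma tensor_power_pairs_closed: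
  assumes "(u, v) \<in> tensor_power_pairs R A k"
  shows "u \<in> carrier (free_module R (tensor_power_gens A k))" "v \<in> carrier (free_module R (tensor_power_gens A k))"
proof -
  interpret L: module R "free_module R (tensor_power_gens A k)" by (rule R.free_is_module)
  show "u \<in> carrier (free_module R (tensor_power_gens A k))"
    using assms by cases (auto intro!: R.basis_in_free gens_update)
  show "v \<in> carrier (free_module R (tensor_power_gens A k))"
    using assms
    by cases (auto simp del: R.free_simps intro!: L.a_closed L.smult_closed R.basis_in_free gens_update)
qed

lemma tensor_power_rels_closed:
  "tensor_power_rels R A k \<subseteq> carrier (free_module R (tensor_power_gens A k))"
  unfolding tensor_power_rels_eq
proof (rule image_subsetI)
  fix p assume "p \<in> tensor_power_pairs R A k"
  then show "(case p of (u, v) \<Rightarrow> u \<ominus>\<^bsub>free_module R (tensor_power_gens A k)\<^esub> v) \<in> carrier (free_module R (tensor_power_gens A k))"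
    using module_diff_closed[OF R.free_is_module tensor_power_pairs_closed] by (cases p) simp
qed

lemma foldr_mult_closed: "set xs \<subseteq> carrier A \<Longrightarrow> z \<in> carrier A \<Longrightarrow> foldr (\<otimes>\<^bsub>A\<^esub>) xs z \<in> carrier A"
  by (induction xs) auto

lemma foldr_mult_eq: "set xs \<subseteq> carrier A \<Longrightarrow> z \<in> carrier A \<Longrightarrow>
    foldr (\<otimes>\<^bsub>A\<^esub>) xs z = foldr (\<otimes>\<^bsub>A\<^esub>) xs \<one>\<^bsub>A\<^esub> \<otimes>\<^bsub>A\<^esub> z"
  by (induction xs) (auto simp: m_assoc foldr_mult_closed)

lemma bar_map_gens:
  assumes \<alpha>: "\<alpha> \<in> ds_hom n m" and as: "as \<in> tensor_power_gens A (Suc n)"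
  shows "bar_map A \<alpha> as \<in> tensor_power_gens A (Suc m)"
proof -
  have "as ! i \<in> carrier A" if "i \<in> set (fib \<alpha> j)" for i j
    using that ds_homD(5)[OF \<alpha>, of j] gens_nth[OF as, of i] by auto
  then have "foldr (\<otimes>\<^bsub>A\<^esub>) (map (\<lambda>i. as ! i) (fib \<alpha> j)) \<one>\<^bsub>A\<^esub> \<in> carrier A" for j
    by (intro foldr_mult_closed) auto
  then show ?thesis
    using ds_homD(2)[OF \<alpha>] by (auto simp: bar_map_def tensor_power_gens_def)
qed

text \<open>The letter \<open>i\<close> occurs in exactly one fibre, and once in it. The image
  therefore depends on the entry x at \<open>i\<close> only in the place
  \<open>fn \<alpha> i\<close>, where it is u x v with u and v the products of the letters before
  and after \<open>i\<close>. This is linear in x.\<close>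

lemma bar_map_update:
  assumes \<alpha>: "\<alpha> \<in> ds_hom n m" and as: "as \<in> tensor_power_gens A (Suc n)" and i: "i < Suc n"
  shows "\<exists>u\<in>carrier A. \<exists>v\<in>carrier A. \<forall>x\<in>carrier A.
    bar_map A \<alpha> (as[i := x]) = (bar_map A \<alpha> as)[fn \<alpha> i := u \<otimes>\<^bsub>A\<^esub> (x \<otimes>\<^bsub>A\<^esub> v)]"
proof -
  note h = ds_homD[OF \<alpha>]
  have "i \<in> set (fib \<alpha> (fn \<alpha> i))" using h(5) i by auto
  then obtain us vs where w: "fib \<alpha> (fn \<alpha> i) = us @ i # vs" by (meson split_list)
  have nin: "i \<notin> set us" "i \<notin> set vs" using h(4)[of "fn \<alpha> i"] unfolding w by auto
  have le: "set us \<subseteq> {0..n}" "set vs \<subseteq> {0..n}" using h(5)[of "fn \<alpha> i"] unfolding w by auto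
  have len: "length as = Suc n" using as by (simp add: tensor_power_gens_def)
  let ?pr = "\<lambda>l. foldr (\<otimes>\<^bsub>A\<^esub>) (map (\<lambda>i. as ! i) l) \<one>\<^bsub>A\<^esub>"
  have c: "set (map (\<lambda>i. as ! i) us) \<subseteq> carrier A" "set (map (\<lambda>i. as ! i) vs) \<subseteq> carrier A"
    using le gens_nth[OF as] by auto
  have same: "map (\<lambda>l. as[i := x] ! l) ws = map (\<lambda>l. as ! l) ws" if "i \<notin> set ws" for ws x
    using that by (intro map_cong refl nth_list_update_neq) auto
  have "bar_map A \<alpha> (as[i := x]) = (bar_map A \<alpha> as)[fn \<alpha> i := ?pr us \<otimes>\<^bsub>A\<^esub> (x \<otimes>\<^bsub>A\<^esub> ?pr vs)]" if x: "x \<in> carrier A" for x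
  proof (rule nth_equalityI)
    fix j assume "j < length (bar_map A \<alpha> (as[i := x]))"
    then have j: "j < Suc (tgt \<alpha>)" by (simp add: bar_map_def)
    show "bar_map A \<alpha> (as[i := x]) ! j = (bar_map A \<alpha> as)[fn \<alpha> i := ?pr us \<otimes>\<^bsub>A\<^esub> (x \<otimes>\<^bsub>A\<^esub> ?pr vs)] ! j"
    proof (cases "j = fn \<alpha> i")
      case True
      have "bar_map A \<alpha> (as[i := x]) ! j = foldr (\<otimes>\<^bsub>A\<^esub>) (map (\<lambda>l. as[i := x] ! l) (us @ i # vs)) \<one>\<^bsub>A\<^esub>"
        using j True by (simp add: bar_map_def w del: upt_Suc)
      also have "\<dots> = foldr (\<otimes>\<^bsub>A\<^esub>) (map (\<lambda>i. as ! i) us) (x \<otimes>\<^bsub>A\<^esub> ?pr vs)"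
        using same[OF nin(1)] same[OF nin(2)] len i by (simp del: map_eq_conv)
      also have "\<dots> = ?pr us \<otimes>\<^bsub>A\<^esub> (x \<otimes>\<^bsub>A\<^esub> ?pr vs)"
        using c x by (intro foldr_mult_eq) (auto intro: foldr_mult_closed)
      finally show ?thesis using True j by (simp add: bar_map_def del: upt_Suc)
    next
      case False
      then have "i \<notin> set (fib \<alpha> j)" using h(5)[of j] by auto
      then show ?thesis using False j same[of "fib \<alpha> j" x] by (simp add: bar_map_def del: upt_Suc map_eq_conv)
    qed
  qed (simp add: bar_map_def)
  moreover have "?pr us \<in> carrier A" "?pr vs \<in> carrier A" using c by (auto intro: foldr_mult_closed)
  ultimately show ?thesis by blast
qed

text \<open>By distributivity u x v is additive in x, and the two compatibility laws of an
  associative algebra pull scalars out of it; so each relator goes to a relator of the same kind at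
  the place \<open>fn \<alpha> i\<close>.\<close>

lemma bar_map_rels:
  assumes \<alpha>: "\<alpha> \<in> ds_hom n m" and t: "t \<in> tensor_power_rels R A (Suc n)"
  shows "free_map R (bar_map A \<alpha>) t \<in> tensor_power_rels R A (Suc m)"
proof -
  let ?L = "free_module R (tensor_power_gens A (Suc n))" and ?L' = "free_module R (tensor_power_gens A (Suc m))"
  have \<phi>: "bar_map A \<alpha> \<in> tensor_power_gens A (Suc n) \<rightarrow> tensor_power_gens A (Suc m)"
    using bar_map_gens[OF \<alpha>] by auto
  note fm = R.free_map_hom[OF \<phi>]
  have pairs: "(free_map R (bar_map A \<alpha>) u, free_map R (bar_map A \<alpha>) v) \<in> tensor_power_pairs R A (Suc m)"
    if "(u, v) \<in> tensor_power_pairs R A (Suc n)" for u v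
    using that
  proof cases
    case (add as i x y)
    obtain p q where pq: "p \<in> carrier A" "q \<in> carrier A" "\<And>x. x \<in> carrier A \<Longrightarrow>
      bar_map A \<alpha> (as[i := x]) = (bar_map A \<alpha> as)[fn \<alpha> i := p \<otimes>\<^bsub>A\<^esub> (x \<otimes>\<^bsub>A\<^esub> q)]"
      using bar_map_update[OF \<alpha> add(3,4)] by blast
    have "fn \<alpha> i < Suc m" using ds_homD(3)[OF \<alpha>] add(4) by (auto simp: PiE_iff less_Suc_eq_le)
    then show ?thesis
      using tensor_power_pairs.add[OF bar_map_gens[OF \<alpha> add(3)], of "fn \<alpha> i" "p \<otimes>\<^bsub>A\<^esub> (x \<otimes>\<^bsub>A\<^esub> q)" "p \<otimes>\<^bsub>A\<^esub> (y \<otimes>\<^bsub>A\<^esub> q)" R]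
        add pq
      by (simp add: R.free_map_basis module_hom_add[OF fm] R.basis_in_free gens_update l_distr r_distr del: R.free_simps)
  next
    case (smult as i r x)
    obtain p q where pq: "p \<in> carrier A" "q \<in> carrier A" "\<And>x. x \<in> carrier A \<Longrightarrow>
      bar_map A \<alpha> (as[i := x]) = (bar_map A \<alpha> as)[fn \<alpha> i := p \<otimes>\<^bsub>A\<^esub> (x \<otimes>\<^bsub>A\<^esub> q)]"
      using bar_map_update[OF \<alpha> smult(3,4)] by blast
    have "fn \<alpha> i < Suc m" using ds_homD(3)[OF \<alpha>] smult(4) by (auto simp: PiE_iff less_Suc_eq_le)
    then show ?thesis
      using tensor_power_pairs.smult[OF bar_map_gens[OF \<alpha> smult(3)], of "fn \<alpha> i" r R "p \<otimes>\<^bsub>A\<^esub> (x \<otimes>\<^bsub>A\<^esub> q)"]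
        smult pq
      by (simp add: R.free_map_basis module_hom_smult[OF fm] R.basis_in_free gens_update smult_mult_left smult_mult_right del: R.free_simps)
  qed
  obtain u v where uv: "t = u \<ominus>\<^bsub>?L\<^esub> v" "(u, v) \<in> tensor_power_pairs R A (Suc n)"
    using t unfolding tensor_power_rels_eq by auto
  have "free_map R (bar_map A \<alpha>) t = free_map R (bar_map A \<alpha>) u \<ominus>\<^bsub>?L'\<^esub> free_map R (bar_map A \<alpha>) v"
    unfolding uv(1) by (rule module_hom_diff[OF R.free_is_module R.free_is_module fm tensor_power_pairs_closed[OF uv(2)]])
  then show ?thesis
    unfolding tensor_power_rels_eq using pairs[OF uv(2)] by (auto intro!: image_eqI)
qed

lemma bar_sym_covariant_data: "covariant_data R (bar_sym R A)"
  unfolding covariant_data_def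
proof (intro conjI allI ballI)
  show "module R (obj (bar_sym R A) n)" for n
    unfolding bar_sym_def by (simp add: R.presented_is_module[OF tensor_power_rels_closed])
  fix n m \<alpha> y assume \<alpha>: "\<alpha> \<in> ds_hom n m" and y: "y \<in> carrier (obj (bar_sym R A) n)"
  let ?L' = "free_module R (tensor_power_gens A (Suc m))"
  interpret L': module R ?L' by (rule R.free_is_module)
  have "presented_map R (tensor_power_gens A (Suc m)) (tensor_power_rels R A (Suc m)) (bar_map A \<alpha>)
    \<in> module_hom R (presented_module R (tensor_power_gens A (Suc n)) (tensor_power_rels R A (Suc n)))
       (presented_module R (tensor_power_gens A (Suc m)) (tensor_power_rels R A (Suc m)))"
    using bar_map_gens[OF \<alpha>] bar_map_rels[OF \<alpha>] L'.submodule_span_incl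
    by (intro R.presented_map_hom[OF tensor_power_rels_closed tensor_power_rels_closed]) auto
  from module_hom_closed[OF this] y ds_homD(2)[OF \<alpha>]
  show "arr (bar_sym R A) \<alpha> y \<in> carrier (obj (bar_sym R A) m)"
    unfolding bar_sym_def by (simp add: bar_map_def[abs_def])
qed

text \<open>Tensors whose entries all come from a finite generating set \<open>X\<close> of
  \<open>A\<close> span the tensor power. The entries are released from \<open>X\<close> one slot at
  a time; since the class is linear in each slot, the elements allowed there form a submodule that
  contains \<open>X\<close>, hence all of \<open>A\<close>.\<close>

lemma bar_sym_fin_gen:
  assumes "fin_gen_module R A"
  shows "fin_gen_module R (obj (bar_sym R A) n)"
proof -
  let ?k = "Suc n"
  let ?S = "tensor_power_gens A ?k" and ?T = "tensor_power_rels R A ?k"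
  let ?M = "presented_module R ?S ?T"
  note T = tensor_power_rels_closed[of ?k]
  interpret P: module R ?M by (rule R.presented_is_module[OF T])
  interpret L: module R "free_module R ?S" by (rule R.free_is_module)
  obtain X where X: "finite X" "X \<subseteq> carrier A" "submodule_span R A X = carrier A"
    using assms by (auto simp: fin_gen_module_def)
  let ?c = "\<lambda>as. presented_class R ?S ?T (basis R as)"
  define Y where "Y = ?c ` {as. set as \<subseteq> X \<and> length as = ?k}"
  have finY: "finite Y" unfolding Y_def using X(1) by (intro finite_imageI finite_lists_length_eq)
  have YC: "Y \<subseteq> carrier ?M"
    unfolding Y_def R.presented_carrier using X(2)
    by (auto simp: tensor_power_gens_def intro!: imageI R.basis_in_free)
  let ?W = "submodule_span R ?M Y"
  have W: "submodule ?W R ?M" by (rule P.submodule_span_submodule[OF YC])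
  note W' = W[unfolded P.submodule_iff]
  note p = R.presented_class_hom[OF T]
  have pe: "presented_class R ?S ?T u = presented_class R ?S ?T v" if "(u, v) \<in> tensor_power_pairs R A ?k" for u v
  proof (rule R.presented_class_eq[OF T _ tensor_power_pairs_closed[OF that]])
    have "u \<ominus>\<^bsub>free_module R ?S\<^esub> v \<in> ?T"
      unfolding tensor_power_rels_eq using that by (auto intro!: image_eqI[where x = "(u, v)"])
    then show "u \<ominus>\<^bsub>free_module R ?S\<^esub> v \<in> submodule_span R (free_module R ?S) ?T"
      using L.submodule_span_incl by blast
  qed
  have cadd: "?c (as[i := x \<oplus>\<^bsub>A\<^esub> y]) = ?c (as[i := x]) \<oplus>\<^bsub>?M\<^esub> ?c (as[i := y])"
    if "as \<in> ?S" "i < ?k" "x \<in> carrier A" "y \<in> carrier A" for as i x y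
    using pe[OF tensor_power_pairs.add[OF that]] that
    by (simp add: module_hom_add[OF p] R.basis_in_free gens_update del: R.free_simps)
  have csmult: "?c (as[i := r \<odot>\<^bsub>A\<^esub> x]) = r \<odot>\<^bsub>?M\<^esub> ?c (as[i := x])"
    if "as \<in> ?S" "i < ?k" "r \<in> carrier R" "x \<in> carrier A" for as i r x
    using pe[OF tensor_power_pairs.smult[OF that]] that
    by (simp add: module_hom_smult[OF p] R.basis_in_free gens_update del: R.free_simps)
  \<comment> \<open>\<open>t\<close> is the number of leading slots whose entries are arbitrary;
    from slot \<open>t\<close> on the entries lie in \<open>X\<close>. For \<open>t = ?k\<close> the
    condition on entries is void.\<close>
  have main: "?c as \<in> ?W" if "as \<in> ?S" "\<And>i. t \<le> i \<Longrightarrow> i < ?k \<Longrightarrow> as ! i \<in> X" "t \<le> ?k" for t as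
    using that
  proof (induction t arbitrary: as)
    case 0
    then have "as \<in> {as. set as \<subseteq> X \<and> length as = ?k}"
      by (auto simp: tensor_power_gens_def in_set_conv_nth)
    then show ?case using P.submodule_span_incl[of Y] by (auto simp: Y_def)
  next
    case (Suc t)
    have tk: "t < ?k" using Suc.prems(3) by simp
    have len: "length as = ?k" using Suc.prems(1) by (simp add: tensor_power_gens_def)
    have cc: "?c (as[t := x]) \<in> carrier ?M" if "x \<in> carrier A" for x
      using module_hom_closed[OF p R.basis_in_free[OF gens_update[OF Suc.prems(1) that]]] .
    have "X \<subseteq> {x \<in> carrier A. ?c (as[t := x]) \<in> ?W}"
    proof
      fix x assume x: "x \<in> X"
      have "?c (as[t := x]) \<in> ?W"
      proof (rule Suc.IH)
        show "as[t := x] \<in> ?S" using x X(2) by (intro gens_update Suc.prems(1)) auto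
        show "as[t := x] ! i \<in> X" if "t \<le> i" "i < ?k" for i
          using that x Suc.prems(2)[of i] len by (cases "i = t") auto
      qed (use tk in simp)
      then show "x \<in> {x \<in> carrier A. ?c (as[t := x]) \<in> ?W}" using x X(2) by auto
    qed
    moreover have "submodule {x \<in> carrier A. ?c (as[t := x]) \<in> ?W} R A"
      unfolding submodule_iff
    proof (intro conjI ballI)
      have "?c (as[t := \<zero>\<^bsub>R\<^esub> \<odot>\<^bsub>A\<^esub> \<zero>\<^bsub>A\<^esub>]) = \<zero>\<^bsub>R\<^esub> \<odot>\<^bsub>?M\<^esub> ?c (as[t := \<zero>\<^bsub>A\<^esub>])"
        using Suc.prems(1) tk by (intro csmult) auto
      then show "\<zero>\<^bsub>A\<^esub> \<in> {x \<in> carrier A. ?c (as[t := x]) \<in> ?W}"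
        using W' cc[of "\<zero>\<^bsub>A\<^esub>"] by simp
    qed (use W' Suc.prems(1) tk in \<open>auto simp: cadd csmult\<close>)
    ultimately have "as ! t \<in> {x \<in> carrier A. ?c (as[t := x]) \<in> ?W}"
      using submodule_span_least[of _ X] X(3) gens_nth[OF Suc.prems(1) tk] by blast
    then show ?case by simp
  qed
  have "carrier ?M \<subseteq> ?W"
    by (rule R.presented_spanI[OF T W]) (use main[of _ ?k] in auto)
  moreover have "?W \<subseteq> carrier ?M" by (rule P.submodule_span_subset[OF YC])
  ultimately have "fin_gen_module R ?M"
    unfolding fin_gen_module_def using finY YC by blast
  then show ?thesis by (simp add: bar_sym_def)
qed

end

theorem corollary4:
  fixes R :: "('r, 'b) ring_scheme"
    and A :: "('r, 'a, 'c) module_scheme"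
    and P :: "nat \<Rightarrow> ('r, 'm) ds_functor"
    and d :: "nat \<Rightarrow> nat \<Rightarrow> 'm \<Rightarrow> 'm"
    and e :: "nat \<Rightarrow> 'm \<Rightarrow> 'r"
    and n :: nat
  assumes "cring R" and "noetherian_ring R"
    and "assoc_algebra R A" and "fin_gen_module R A"
    and "projective_resolution R (const_functor R) P d e"
  shows "fin_gen_module R (HS R A P d n)"
  unfolding HS_def
  using assms(1,2,5) assoc_algebra.bar_sym_covariant_data[OF assms(3)]
    assoc_algebra.bar_sym_fin_gen[OF assms(3,4)]
  by (rule ds_tor_fin_gen)

end
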